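(* Let $m$ be a fixed positive integer and let $(r_n)$ be a sequence of real numbers in $(0,0.5)$ with $r_n=o(1)$ and $nr_n^m=\omega(1)$ as $n\to\infty$. For each $n$ let $A\sim\mathcal{G}_{n,m}(r_n,F)$ be the adjacency matrix of a random geometric graph, and suppose that the null hypothesis $H_0: F=U([0,1]^m)$ holds, i.e. $F$ is the uniform distribution on $[0,1]^m$. Then, as $n\to\infty$, $$\frac{\sqrt{2}\,T_n}{n^5\bar{A}_n\hat{\sigma}_{n2}}\Rightarrow N(0,1),$$ where $$T_{n}=\left(\sum_{i\neq j\neq k\neq l}A_{ij}A_{jk}A_{kl}\right)\left(\sum_{i\neq j}A_{ij}\right)-\left(\sum_{i\neq j\neq k}A_{ij}A_{jk}\right)^2,$$ $$\bar{A}_n=\frac{1}{n(n-1)}\sum_{i\neq j}A_{ij},\qquad \hat{\sigma}_{n2}^2=\frac{4\sum_{i_1\neq i_2\neq \dots \neq i_6}A_{i_1i_2}A_{i_2i_3}A_{i_3i_4}A_{i_4i_5}A_{i_5i_6}A_{i_6i_1}}{n^6},$$ and $\hat\sigma_{n2}$ is the nonnegative square root of $\hat\sigma_{n2}^2$.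
   Context: Random geometric graph: let $r_n\in(0,0.5)$, let $m$ be a positive integer and $F$ a probability distribution on $[0,1]^m$. Given i.i.d. random vectors $X_1,\dots,X_n\sim F$, $X_i=(X_{i1},\dots,X_{im})$, the graph $\mathcal{G}_{n,m}(r_n,F)$ on the node set $\{1,\dots,n\}$ has symmetric adjacency matrix $A$ with $A_{ii}=0$ and, for $i\neq j$, $A_{ij}=I[d(X_i,X_j)\leq r_n]$ ($I$ denotes the indicator), where $$d(X_i,X_j)=\max_{1\leq k\leq m}\Big\{\min\{|X_{ik}-X_{jk}|,\,1-|X_{ik}-X_{jk}|\}\Big\}$$ is the $L_\infty$ distance on the $m$-dimensional torus. Notation: $\sum_{i_1\neq i_2\neq\dots\neq i_t}$ denotes summation over all $i_1,\dots,i_t\in\{1,\dots,n\}$ that are pairwise distinct, i.e. $|\{i_1,\dots,i_t\}|=t$. $a_n=o(b_n)$ means $|a_n/b_n|\to0$; $a_n=\omega(b_n)$ means $|a_n/b_n|\to\infty$. $\Rightarrow N(0,1)$ denotes convergence in distribution to the standard normal distribution as $n\to\infty$. *)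

theory Defs
  imports "HOL-Probability.Probability" "HOL-Library.Landau_Symbols"
begin

text \<open>
  The dimension \<open>m\<close> is \<open>CARD('m)\<close>, for an arbitrary finite index type \<open>'m\<close>.
\<close>

definition unit_cube :: "(real ^ 'm) set" where
  "unit_cube = {x. \<forall>k. 0 \<le> x $ k \<and> x $ k \<le> 1}"

definition torus_dist :: "real ^ 'm \<Rightarrow> real ^ 'm \<Rightarrow> real" where
  "torus_dist x y = (MAX k. min \<bar>x $ k - y $ k\<bar> (1 - \<bar>x $ k - y $ k\<bar>))"

locale random_geometric_graph = prob_space M + F: prob_space F
  for M :: "'a measure" and F :: "(real ^ 'm) measure" +
  fixes n :: nat and r :: real and X :: "nat \<Rightarrow> 'a \<Rightarrow> real ^ 'm"
  assumes sets_F: "sets F = sets borel"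
    and F_unit_cube: "AE x in F. x \<in> unit_cube"
    and radius: "0 < r" "r < 1 / 2"
    and indep: "indep_vars (\<lambda>_. borel) X {1..n}"
    and distr: "\<And>i. i \<in> {1..n} \<Longrightarrow> distr M borel (X i) = F"

definition rgg_adjacency :: "real \<Rightarrow> (nat \<Rightarrow> 'a \<Rightarrow> real ^ 'm) \<Rightarrow> 'a \<Rightarrow> nat \<Rightarrow> nat \<Rightarrow> real" where
  "rgg_adjacency r X \<omega> i j = (if i \<noteq> j \<and> torus_dist (X i \<omega>) (X j \<omega>) \<le> r then 1 else 0)"

text \<open>
  The index set of a sum over pairwise distinct \<open>i\<^sub>1, \<dots>, i\<^sub>t\<close> in \<open>{1..n}\<close>. The
  tuple is a list, so \<open>i\<^sub>1\<close> is entry number \<open>0\<close>.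
\<close>

definition distinct_tuples :: "nat \<Rightarrow> nat \<Rightarrow> nat list set" where
  "distinct_tuples n t = {v. length v = t \<and> set v \<subseteq> {1..n} \<and> distinct v}"

definition T_stat :: "nat \<Rightarrow> (nat \<Rightarrow> nat \<Rightarrow> real) \<Rightarrow> real" where
  "T_stat n A =
     (\<Sum>v\<in>distinct_tuples n 4. A (v!0) (v!1) * A (v!1) (v!2) * A (v!2) (v!3))
       * (\<Sum>v\<in>distinct_tuples n 2. A (v!0) (v!1))
     - (\<Sum>v\<in>distinct_tuples n 3. A (v!0) (v!1) * A (v!1) (v!2))\<^sup>2"

definition A_bar :: "nat \<Rightarrow> (nat \<Rightarrow> nat \<Rightarrow> real) \<Rightarrow> real" where
  "A_bar n A = 1 / (real n * (real n - 1)) * (\<Sum>v\<in>distinct_tuples n 2. A (v!0) (v!1))"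

definition sigma_hat2 :: "nat \<Rightarrow> (nat \<Rightarrow> nat \<Rightarrow> real) \<Rightarrow> real" where
  "sigma_hat2 n A = sqrt (4 * (\<Sum>v\<in>distinct_tuples n 6.
       A (v!0) (v!1) * A (v!1) (v!2) * A (v!2) (v!3) *
       A (v!3) (v!4) * A (v!4) (v!5) * A (v!5) (v!0)) / real n ^ 6)"

end

theory Submission
  imports Defs
begin

text \<open>
  Under the null hypothesis every vertex has the same conditional edge probability
  \<open>p = (2r)\<^sup>m\<close>, so centred edges \<open>a\<^sub>i\<^sub>j = A\<^sub>i\<^sub>j - p\<close> along a forest are independent. Expanding \<open>T\<^sub>n\<close>
  in them, everything of larger order cancels except \<open>n (n-1) p \<Sum> a\<^sub>i\<^sub>j a\<^sub>j\<^sub>k a\<^sub>k\<^sub>l\<close>. The projection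
  of this sum onto the end points of the path is a degenerate quadratic form in the kernel
  \<open>a * a * a\<close>; the other Hoeffding components are negligible because \<open>np \<rightarrow> \<infinity>\<close>. Adding one
  point at a time makes the quadratic form a martingale. Its conditional variances concentrate since
  the 12-cycle density is at most \<open>p\<^sup>1\<^sup>1\<close>, while the square of the 6-cycle density has order \<open>p\<^sup>1\<^sup>0\<close>,
  and comparing characteristic functions gives normality. The normalisation is handled by second
  moments. Of the torus only the constant degree and a lower bound \<open>c p\<^sup>5\<close> for the 6-cycle
  density matter.
\<close>

section \<open>Bounded measurable functions\<close>

text \<open>All errors are measured against the size n^5 p^(7/2) of \<open>T_stat\<close>: the
  end-point projection of the 3-path sum has size n^3 p^(5/2) and comes with the factor n^2 p.
  Dropping the other Hoeffding components costs a relative error 1/sqrt(np), products of lower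
  counts cost 1/(n sqrt p), and a deterministic leftover n^5 p^4 costs sqrt p. A degenerate
  quadratic form usually tends to a weighted sum of centred chi-squares. It is Gaussian here because
  no eigenvalue of a * a * a dominates: the 12-cycle density bounds the sum of the fourth powers of
  the eigenvalues, the 6-cycle density is nearly the sum of their squares, and the first is
  negligible against the square of the second because p tends to 0. Conditioning is done without
  conditional expectations: one coordinate of the sample is redrawn and integrated out. This calls
  for functions that are bounded and measurable on the whole space, so that every such partial
  integral makes sense pointwise.\<close>

definition bdm :: "'x measure \<Rightarrow> ('x \<Rightarrow> 'c::{banach, second_countable_topology}) \<Rightarrow> bool" where
  "bdm N f \<longleftrightarrow> f \<in> borel_measurable N \<and> (\<exists>B. \<forall>x. norm (f x) \<le> B)"

named_theorems bdm_intros

lemma bdm_measurable: "bdm N f \<Longrightarrow> f \<in> borel_measurable N"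
  by (simp add: bdm_def)

lemma bdmI: "f \<in> borel_measurable N \<Longrightarrow> (\<And>x. norm (f x) \<le> B) \<Longrightarrow> bdm N f"
  by (auto simp: bdm_def)

lemma bdm_bound:
  assumes "bdm N f"
  obtains B where "B \<ge> 0" "\<And>x. norm (f x) \<le> B"
proof -
  from assms obtain B where B: "\<And>x. norm (f x) \<le> B" by (auto simp: bdm_def)
  have "B \<ge> 0" using B[of undefined] norm_ge_zero order_trans by blast
  with B that show ?thesis by blast
qed

lemma bdm_const [bdm_intros]: "bdm N (\<lambda>x. c)"
  by (auto simp: bdm_def)

lemma bdm_add [bdm_intros]: "bdm N f \<Longrightarrow> bdm N g \<Longrightarrow> bdm N (\<lambda>x. f x + g x)"
  unfolding bdm_def by (auto intro: norm_triangle_mono)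

lemma bdm_uminus [bdm_intros]: "bdm N f \<Longrightarrow> bdm N (\<lambda>x. - f x)"
  unfolding bdm_def by auto

lemma bdm_diff [bdm_intros]: "bdm N f \<Longrightarrow> bdm N g \<Longrightarrow> bdm N (\<lambda>x. f x - g x)"
  using bdm_add[of N f "\<lambda>x. - g x"] bdm_uminus[of N g] by simp

lemma bdm_mult [bdm_intros]:
  fixes f g :: "'x \<Rightarrow> 'c::{banach, second_countable_topology, real_normed_algebra}"
  assumes "bdm N f" "bdm N g" shows "bdm N (\<lambda>x. f x * g x)"
proof -
  obtain B where B: "B \<ge> 0" "\<And>x. norm (f x) \<le> B" using assms(1) by (rule bdm_bound) blast
  obtain C where C: "C \<ge> 0" "\<And>x. norm (g x) \<le> C" using assms(2) by (rule bdm_bound) blast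
  have "norm (f x * g x) \<le> B * C" for x
    using norm_mult_ineq mult_mono[OF B(2) C(2) B(1) norm_ge_zero] order_trans by blast
  then show ?thesis using assms by (auto simp: bdm_def)
qed

lemma bdm_power [bdm_intros]:
  fixes f :: "'x \<Rightarrow> 'c::{banach, second_countable_topology, real_normed_algebra_1}"
  shows "bdm N f \<Longrightarrow> bdm N (\<lambda>x. f x ^ k)"
  by (induction k) (auto intro!: bdm_intros)

lemma bdm_sum [bdm_intros]: "(\<And>i. i \<in> A \<Longrightarrow> bdm N (f i)) \<Longrightarrow> bdm N (\<lambda>x. \<Sum>i\<in>A. f i x)"
  by (induction A rule: infinite_finite_induct) (auto intro!: bdm_intros)

lemma bdm_divide_const [bdm_intros]:
  fixes f :: "'x \<Rightarrow> 'c::{banach, second_countable_topology, real_normed_field}"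
  shows "bdm N f \<Longrightarrow> bdm N (\<lambda>x. f x / c)"
  unfolding divide_inverse by (intro bdm_intros)

lemma bdm_prod [bdm_intros]:
  fixes f :: "'i \<Rightarrow> 'x \<Rightarrow> 'c::{banach, second_countable_topology, real_normed_field}"
  shows "(\<And>i. i \<in> A \<Longrightarrow> bdm N (f i)) \<Longrightarrow> bdm N (\<lambda>x. \<Prod>i\<in>A. f i x)"
  by (induction A rule: infinite_finite_induct) (auto intro!: bdm_intros)

lemma bdm_norm [bdm_intros]: "bdm N f \<Longrightarrow> bdm N (\<lambda>x. norm (f x))"
  unfolding bdm_def by auto

lemma bdm_abs [bdm_intros]: "bdm N f \<Longrightarrow> bdm N (\<lambda>x. \<bar>f x :: real\<bar>)"
  using bdm_norm[of N f] by simp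

lemma bdm_of_real [bdm_intros]: "bdm N f \<Longrightarrow> bdm N (\<lambda>x. complex_of_real (f x))"
  unfolding bdm_def by auto

lemma bdm_iexp [bdm_intros]: "bdm N f \<Longrightarrow> bdm N (\<lambda>x. iexp (f x))"
  by (rule bdmI[where B=1]) (auto simp: bdm_def)

lemma bdm_compose:
  assumes "bdm N f" "h \<in> measurable M N" shows "bdm M (\<lambda>x. f (h x))"
  using assms unfolding bdm_def by (auto intro: measurable_compose)

text \<open>The bound in \<open>bdm\<close> holds at every point, not almost everywhere. It
  therefore passes to sections and partial integrals, and integrability is automatic on every
  probability space.\<close>

lemma (in prob_space) bdm_integrable [intro]: "bdm M f \<Longrightarrow> integrable M f"
  unfolding bdm_def by (auto intro: integrable_const_bound)

text \<open>A non-integrable function has integral 0 by convention, and B is nonnegative because it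
  bounds a norm; hence the bound holds in either case.\<close>

lemma (in prob_space) bdm_integral_bound:
  fixes f :: "'a \<Rightarrow> 'c::{banach, second_countable_topology}"
  assumes "\<And>x. norm (f x) \<le> (B::real)" shows "norm (\<integral>x. f x \<partial>M) \<le> B"
proof (cases "integrable M f")
  case True
  have "norm (\<integral>x. f x \<partial>M) \<le> (\<integral>x. norm (f x) \<partial>M)" by (rule integral_norm_bound)
  also have "\<dots> \<le> B" using assms True by (intro integral_le_const) auto
  finally show ?thesis .
next
  case False
  have "B \<ge> 0" using assms[of undefined] norm_ge_zero order_trans by blast
  then show ?thesis using False by (simp add: not_integrable_integral_eq)
qed

text \<open>Integrates the inequality of arithmetic and geometric means with free weights s and u;
  the weights \<open>sqrt b\<close> and \<open>sqrt a\<close> balance the two second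
  moments.\<close>

lemma (in prob_space) Cauchy_Schwarz_bdm:
  assumes "bdm M f" "bdm M g"
  shows "(\<integral>x. \<bar>f x * g x :: real\<bar> \<partial>M) \<le> sqrt (\<integral>x. (f x)^2 \<partial>M) * sqrt (\<integral>x. (g x)^2 \<partial>M)"
proof -
  define a where "a = (\<integral>x. (f x)^2 \<partial>M)"
  define b where "b = (\<integral>x. (g x)^2 \<partial>M)"
  define c where "c = (\<integral>x. \<bar>f x * g x\<bar> \<partial>M)"
  have ab: "a \<ge> 0" "b \<ge> 0" by (auto simp: a_def b_def)
  have i: "integrable M (\<lambda>x. (f x)^2)" "integrable M (\<lambda>x. (g x)^2)" "integrable M (\<lambda>x. \<bar>f x * g x\<bar>)"
    using assms by (auto intro!: bdm_intros bdm_integrable)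
  have key: "2 * s * u * c \<le> s^2 * a + u^2 * b" for s u :: real
  proof -
    have "2 * s * u * \<bar>f x * g x\<bar> \<le> s^2 * (f x)^2 + u^2 * (g x)^2" for x
    proof -
      have "0 \<le> (s * \<bar>f x\<bar> - u * \<bar>g x\<bar>)^2" by simp
      then show ?thesis by (simp add: power2_eq_square abs_mult algebra_simps)
    qed
    then have "(\<integral>x. 2 * s * u * \<bar>f x * g x\<bar> \<partial>M) \<le> (\<integral>x. s^2 * (f x)^2 + u^2 * (g x)^2 \<partial>M)"
      using i by (intro integral_mono) auto
    then show ?thesis using i by (simp add: a_def b_def c_def)
  qed
  have "c \<le> sqrt a * sqrt b"
  proof (cases "a > 0 \<and> b > 0")
    case True
    have "2 * (sqrt a * sqrt b) * c \<le> 2 * (a * b)"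
      using key[of "sqrt b" "sqrt a"] True by (simp add: mult_ac)
    also have "\<dots> = 2 * (sqrt a * sqrt b) * (sqrt a * sqrt b)"
      using True by (simp add: mult_ac flip: power2_eq_square real_sqrt_mult)
    finally show ?thesis using True by (subst (asm) mult_le_cancel_left) auto
  next
    case False
    have "c \<le> 0"
    proof (rule ccontr)
      assume "\<not> c \<le> 0"
      then have c: "c > 0" by simp
      from False ab consider "a = 0" | "b = 0" by linarith
      then show False
      proof cases
        case 1
        \<comment> \<open>A second moment equal to 0 leaves its weight free; this choice yields 2 *
          (b + 1) \<le> b.\<close>
        have "2 * ((b + 1) / c) * c \<le> b" using key[of "(b+1)/c" 1] 1 by simp
        then show False using c ab by simp
      next
        case 2
        have "2 * ((a + 1) / c) * c \<le> a" using key[of 1 "(a+1)/c"] 2 by simp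
        then show False using c ab by simp
      qed
    qed
    then show ?thesis using False ab by (metis mult_nonneg_nonneg order_trans real_sqrt_ge_zero)
  qed
  then show ?thesis by (simp add: a_def b_def c_def)
qed

lemma (in prob_space) abs_le_sqrt_second_moment:
  assumes "bdm M f" shows "(\<integral>x. \<bar>f x :: real\<bar> \<partial>M) \<le> sqrt (\<integral>x. (f x)^2 \<partial>M)"
  using Cauchy_Schwarz_bdm[OF assms bdm_const[of M 1]] by (simp add: prob_space)

section \<open>Infinite samples and the resampling identity\<close>

text \<open>With \<open>space F = UNIV\<close> the product space consists of all sequences, so an
  update \<open>x(j := y)\<close> never leaves it and integrands can be compared pointwise without
  side conditions.\<close>

locale iid_sample = F: prob_space F for F :: "'b measure" +
  assumes space_F [simp]: "space F = UNIV"
begin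

text \<open>One infinite product carries the samples of all sizes; a statistic of the first n points
  ignores the other coordinates.\<close>

definition P :: "(nat \<Rightarrow> 'b) measure" where
  "P = (\<Pi>\<^sub>M i\<in>UNIV. F)"

lemma space_P [simp]: "space P = UNIV"
  by (simp add: P_def space_PiM PiE_def)

lemma sets_P [measurable_cong]: "sets P = sets (\<Pi>\<^sub>M i\<in>UNIV. F)"
  by (simp add: P_def)

sublocale P: prob_space P
  unfolding P_def by (intro prob_space_PiM F.prob_space_axioms)

abbreviation mean (binder "\<mu>" 10) where
  "mean f \<equiv> integral\<^sup>L F f"

abbreviation E_sample (binder "\<E>" 10) where
  "E_sample f \<equiv> integral\<^sup>L P f"

sublocale FP: pair_prob_space F P ..
sublocale FF: pair_prob_space F F ..

lemma measurable_coord [measurable]: "(\<lambda>x. x i) \<in> measurable P F"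
  by measurable

lemma distr_resample: "distr (F \<Otimes>\<^sub>M P) P (\<lambda>(y, x). x(j := y)) = P"
  using distr_pair_PiM_eq_PiM[of UNIV "\<lambda>_. F" j] F.prob_space_axioms
  by (simp add: P_def)

lemma measurable_resample [measurable]: "(\<lambda>(y, x). x(j := y)) \<in> measurable (F \<Otimes>\<^sub>M P) P"
  unfolding P_def by (rule measurable_PiM_single') (auto simp: space_PiM space_pair_measure split_beta)

lemma bdm_resample_integral [bdm_intros]:
  fixes f :: "_ \<Rightarrow> 'c::{banach, second_countable_topology}"
  assumes "bdm P f" shows "bdm P (\<lambda>x. \<integral>y. f (x(j := y)) \<partial>F)"
proof -
  obtain B where B: "B \<ge> 0" "\<And>x. norm (f x) \<le> B" using assms by (rule bdm_bound) blast
  have [measurable]: "f \<in> borel_measurable P" using assms by (rule bdm_measurable)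
  have "(\<lambda>x. \<integral>y. f (x(j := y)) \<partial>F) \<in> borel_measurable P"
  proof (rule F.borel_measurable_lebesgue_integral)
    have "(\<lambda>z. f ((\<lambda>(y, x). x(j := y)) (snd z, fst z))) \<in> borel_measurable (P \<Otimes>\<^sub>M F)"
      by measurable
    then show "(\<lambda>(x, y). f (x(j := y))) \<in> borel_measurable (P \<Otimes>\<^sub>M F)"
      by (simp add: split_beta')
  qed
  moreover have "norm (\<mu> y. f (x(j := y))) \<le> B" for x
    by (rule F.bdm_integral_bound) (rule B(2))
  ultimately show ?thesis by (rule bdmI)
qed

text \<open>Redrawing coordinate j independently preserves the product measure. The inner integral
  is the conditional expectation given all other coordinates, in a version defined at every point;
  it replaces conditioning throughout.\<close>

theorem resample:
  fixes f :: "_ \<Rightarrow> 'c::{banach, second_countable_topology}"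
  assumes "bdm P f"
  shows "(\<E> x. f x) = (\<E> x. (\<mu> y. f (x(j := y))))"
proof -
  have [measurable]: "f \<in> borel_measurable P" using assms by (rule bdm_measurable)
  have b: "bdm (F \<Otimes>\<^sub>M P) (\<lambda>z. f ((\<lambda>(y, x). x(j := y)) z))"
    by (rule bdm_compose[OF assms measurable_resample])
  have "(\<E> x. f x) = (\<integral>x. f x \<partial>distr (F \<Otimes>\<^sub>M P) P (\<lambda>(y, x). x(j := y)))"
    by (simp add: distr_resample)
  also have "\<dots> = (\<integral>z. f ((\<lambda>(y, x). x(j := y)) z) \<partial>(F \<Otimes>\<^sub>M P))"
    by (rule integral_distr) auto
  also have "\<dots> = (\<integral>(y, x). f (x(j := y)) \<partial>(F \<Otimes>\<^sub>M P))"
    by (simp add: split_beta')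
  also have "\<dots> = (\<E> x. (\<mu> y. f (x(j := y))))"
    using FP.bdm_integrable[OF b] by (subst FP.integral_snd) (auto simp: split_beta')
  finally show ?thesis .
qed

text \<open>Tuples with different vertex sets are uncorrelated: redrawing a vertex of one that is
  missing from the other annihilates the product. Each tuple then has only boundedly many partners,
  and those covariances are at most B.\<close>

lemma degenerate_second_moment:
  fixes g :: "nat list \<Rightarrow> (nat \<Rightarrow> 'b) \<Rightarrow> real"
  assumes V: "finite V" "\<And>v. v \<in> V \<Longrightarrow> length v = t \<and> distinct v"
    and g: "\<And>v. v \<in> V \<Longrightarrow> bdm P (g v)"
    and B: "\<And>v. v \<in> V \<Longrightarrow> (\<E> x. (g v x)^2) \<le> B"
    and dep: "\<And>v j x y. v \<in> V \<Longrightarrow> j \<notin> set v \<Longrightarrow> g v (x(j := y)) = g v x"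
    and deg: "\<And>v j x. v \<in> V \<Longrightarrow> j \<in> set v \<Longrightarrow> (\<mu> y. g v (x(j := y))) = 0"
  shows "(\<E> x. (\<Sum>v\<in>V. g v x)^2) \<le> real (t ^ t) * real (card V) * B"
proof -
  have orth: "(\<E> x. g v x * g w x) = 0" if vw: "v \<in> V" "w \<in> V" "set v \<noteq> set w" for v w
  proof -
    \<comment> \<open>Equal size excludes proper inclusion, so a vertex of w outside v
      exists.\<close>
    have "card (set v) = card (set w)" using V(2) vw by (metis distinct_card)
    then have "\<not> set w \<subseteq> set v" using vw(3) by (metis List.finite_set card_subset_eq)
    then obtain j where j: "j \<in> set w" "j \<notin> set v" by auto
    have "(\<E> x. g v x * g w x) = (\<E> x. (\<mu> y. g v (x(j := y)) * g w (x(j := y))))"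
      using vw by (intro resample bdm_intros g)
    also have "\<dots> = 0" using vw j by (simp add: dep deg)
    finally show ?thesis .
  qed
  have cov: "(\<E> x. g v x * g w x) \<le> B" if vw: "v \<in> V" "w \<in> V" for v w
  proof -
    have "(\<E> x. g v x * g w x) \<le> (\<E> x. ((g v x)^2 + (g w x)^2) / 2)"
    proof (rule integral_mono)
      show "integrable P (\<lambda>x. g v x * g w x)"
        using vw g by (intro P.bdm_integrable bdm_intros) auto
      have "integrable P (\<lambda>x. (1/2) * ((g v x)^2 + (g w x)^2))"
        using vw g by (intro P.bdm_integrable bdm_intros) auto
      then show "integrable P (\<lambda>x. ((g v x)^2 + (g w x)^2) / 2)" by simp
      show "g v x * g w x \<le> ((g v x)^2 + (g w x)^2) / 2" for x
        using sum_squares_bound[of "g v x" "g w x"] by simp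
    qed
    also have "\<dots> = ((\<E> x. (g v x)^2) + (\<E> x. (g w x)^2)) / 2"
      using vw g by (subst integral_divide_zero, subst Bochner_Integration.integral_add)
        (auto intro!: P.bdm_integrable bdm_intros)
    also have "\<dots> \<le> B" using B[OF vw(1)] B[OF vw(2)] by simp
    finally show ?thesis .
  qed
  show ?thesis
  proof (cases "V = {}")
    case False
    then obtain v0 where "v0 \<in> V" by auto
    have B0: "B \<ge> 0"
      using B[OF \<open>v0 \<in> V\<close>] by (rule order_trans[rotated]) simp
    have "(\<E> x. (\<Sum>v\<in>V. g v x)^2) = (\<E> x. (\<Sum>v\<in>V. \<Sum>w\<in>V. g v x * g w x))"
      by (simp add: power2_eq_square sum_product)
    also have "\<dots> = (\<Sum>v\<in>V. \<Sum>w\<in>V. \<integral>x. g v x * g w x \<partial>P)"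
      by (simp add: Bochner_Integration.integral_sum g P.bdm_integrable bdm_intros)
    also have "\<dots> \<le> (\<Sum>v\<in>V. \<Sum>w\<in>V. if w \<in> {w \<in> V. set w = set v} then B else 0)"
      by (intro sum_mono) (auto simp: cov orth)
    also have "\<dots> = (\<Sum>v\<in>V. real (card {w \<in> V. set w = set v}) * B)"
      using V(1) by (simp add: sum.If_cases Int_def)
    also have "\<dots> \<le> (\<Sum>v\<in>V. real (t ^ t) * B)"
    proof (intro sum_mono mult_right_mono B0)
      fix v assume v: "v \<in> V"
      \<comment> \<open>Counting all lists over the t vertices gives t ^ t instead of the factorial;
        only a constant is lost.\<close>
      have "card {w \<in> V. set w = set v} \<le> card {w. set w \<subseteq> set v \<and> length w = t}"
        using V by (intro card_mono finite_lists_length_eq) auto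
      also have "\<dots> = t ^ t"
        using V(2)[OF v] by (simp add: card_lists_length_eq distinct_card)
      finally show "real (card {w \<in> V. set w = set v}) \<le> real (t ^ t)" by (simp only: of_nat_le_iff)
    qed
    finally show ?thesis by (simp add: mult_ac)
  qed simp
qed

end

section \<open>Integral kernels of constant degree: composition and centring\<close>

context iid_sample
begin

definition bk :: "('b \<Rightarrow> 'b \<Rightarrow> real) \<Rightarrow> bool" where
  "bk K \<longleftrightarrow> bdm (F \<Otimes>\<^sub>M F) (\<lambda>(x, y). K x y)"

text \<open>The kernel of the product of the two integral operators; powers of an adjacency kernel
  are walk densities.\<close>

definition kcomp :: "('b \<Rightarrow> 'b \<Rightarrow> real) \<Rightarrow> ('b \<Rightarrow> 'b \<Rightarrow> real) \<Rightarrow> 'b \<Rightarrow> 'b \<Rightarrow> real" where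
  "kcomp K L x y = (\<mu> z. K x z * L z y)"

lemma bk_pull:
  assumes "bk K" "f \<in> measurable N F" "g \<in> measurable N F"
  shows "bdm N (\<lambda>x. K (f x) (g x))"
  using bdm_compose[OF assms(1)[unfolded bk_def] measurable_Pair[OF assms(2,3)]] by simp

lemma bk_sections:
  assumes "bk K"
  shows "bdm F (\<lambda>y. K x y)" "bdm F (\<lambda>y. K y x)" "bdm F (\<lambda>y. K y y)"
    "bdm P (\<lambda>x. K (x i) (x j))"
  by (rule bk_pull[OF assms]; measurable)+

lemma bk_pair:
  assumes "bk K"
  shows "bdm (F \<Otimes>\<^sub>M F) (\<lambda>z. K (fst z) (snd z))" "bdm (F \<Otimes>\<^sub>M F) (\<lambda>z. K (snd z) (fst z))"
    "bdm (F \<Otimes>\<^sub>M F) (\<lambda>z. K x (fst z))" "bdm (F \<Otimes>\<^sub>M F) (\<lambda>z. K x (snd z))"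
    "bdm (F \<Otimes>\<^sub>M F) (\<lambda>z. K (fst z) x)" "bdm (F \<Otimes>\<^sub>M F) (\<lambda>z. K (snd z) x)"
  by (rule bk_pull[OF assms]; measurable)+

lemma bdm_integral_param:
  fixes f :: "'x \<Rightarrow> 'b \<Rightarrow> 'c::{banach, second_countable_topology}"
  assumes "bdm (N \<Otimes>\<^sub>M F) (\<lambda>z. f (fst z) (snd z))"
  shows "bdm N (\<lambda>x. \<integral>y. f x y \<partial>F)"
proof -
  obtain B where B: "\<And>z. norm (f (fst z) (snd z)) \<le> B" using assms by (rule bdm_bound) blast
  have "(\<lambda>x. \<integral>y. f x y \<partial>F) \<in> borel_measurable N"
    using bdm_measurable[OF assms] by (intro F.borel_measurable_lebesgue_integral) (simp add: split_beta')
  moreover have "norm (\<mu> y. f x y) \<le> B" for x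
    using B[of "(x, _)"] by (intro F.bdm_integral_bound) simp
  ultimately show ?thesis by (rule bdmI)
qed

lemma Fubini_bdm:
  fixes f :: "'b \<Rightarrow> 'b \<Rightarrow> real"
  assumes "bdm (F \<Otimes>\<^sub>M F) (\<lambda>z. f (fst z) (snd z))"
  shows "(\<mu> x. (\<mu> y. f x y)) = (\<mu> y. (\<mu> x. f x y))"
  using FF.bdm_integrable[OF assms] by (intro FF.Fubini_integral[symmetric]) (simp add: split_beta')

lemma bk_kcomp:
  assumes "bk K" "bk L" shows "bk (kcomp K L)"
  unfolding bk_def kcomp_def split_beta'
  by (intro bdm_integral_param bdm_mult bk_pull assms) measurable

lemma kcomp_assoc:
  assumes "bk K" "bk L" "bk N"
  shows "kcomp (kcomp K L) N = kcomp K (kcomp L N)"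
proof (intro ext)
  fix x y
  have "kcomp (kcomp K L) N x y = (\<mu> z. (\<mu> u. K x u * L u z * N z y))"
    by (simp add: kcomp_def)
  also have "\<dots> = (\<mu> u. (\<mu> z. K x u * L u z * N z y))"
    by (intro Fubini_bdm bdm_mult bk_pair assms)
  also have "\<dots> = kcomp K (kcomp L N) x y"
    by (simp add: kcomp_def mult.assoc)
  finally show "kcomp (kcomp K L) N x y = kcomp K (kcomp L N) x y" .
qed

text \<open>The pointwise bound B is carried separately from the degree m because composition turns
  it into \<open>m * B'\<close>: a walk of k edges has degree p^k but supremum p^(k-1). The second
  moments of the centred kernels come from the product of these two numbers.\<close>

definition reg :: "('b \<Rightarrow> 'b \<Rightarrow> real) \<Rightarrow> real \<Rightarrow> real \<Rightarrow> bool" where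
  "reg K m B \<longleftrightarrow> bk K \<and> (\<forall>x y. 0 \<le> K x y \<and> K x y \<le> B) \<and> (\<forall>x y. K x y = K y x) \<and>
     (\<forall>x. (\<mu> y. K x y) = m)"

definition cen :: "('b \<Rightarrow> 'b \<Rightarrow> real) \<Rightarrow> real \<Rightarrow> 'b \<Rightarrow> 'b \<Rightarrow> real" where
  "cen K m x y = K x y - m"

lemma regD:
  assumes "reg K m B"
  shows "bk K" "0 \<le> K x y" "K x y \<le> B" "K x y = K y x" "(\<mu> y. K x y) = m" "(\<mu> y. K y x) = m"
    "0 \<le> m" "m \<le> B" "0 \<le> B"
proof -
  show bk: "bk K" and K: "0 \<le> K x y" "K x y \<le> B" and sym: "K x y = K y x" and m: "(\<mu> y. K x y) = m" for x y
    using assms unfolding reg_def by blast+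
  show "(\<mu> y. K y x) = m" using m[of x] by (subst sym)
  show "0 \<le> m" using m[of x] K by (subst m[of x, symmetric]) (auto intro: Bochner_Integration.integral_nonneg)
  show "m \<le> B" by (subst m[of x, symmetric]) (auto intro!: F.integral_le_const K F.bdm_integrable bk_sections[OF bk])
  show "0 \<le> B" using K[of x y] by linarith
qed

lemma kcomp_commute:
  assumes "\<And>x y. K x y = K y x" "\<And>x y. L x y = L y x"
  shows "kcomp K L x y = kcomp L K y x"
proof -
  have "K x z * L z y = L y z * K z x" for z using assms by (metis mult.commute)
  then show ?thesis by (simp add: kcomp_def)
qed

lemma reg_kcomp:
  assumes K: "reg K m B" and L: "reg L m' B'" and sym: "\<And>x y. kcomp K L x y = kcomp K L y x"
  shows "reg (kcomp K L) (m * m') (m * B')"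
  unfolding reg_def
proof (intro conjI allI)
  note K' = regD[OF K] and L' = regD[OF L]
  show "bk (kcomp K L)" by (intro bk_kcomp K' L')
  show "kcomp K L x y = kcomp K L y x" for x y by (rule sym)
  show "0 \<le> kcomp K L x y" for x y
    unfolding kcomp_def using K' L' by (intro Bochner_Integration.integral_nonneg) auto
  show "kcomp K L x y \<le> m * B'" for x y
  proof -
    have "kcomp K L x y \<le> (\<mu> z. K x z * B')"
      unfolding kcomp_def using K' L'
      by (intro integral_mono F.bdm_integrable bdm_intros bk_sections[OF K'(1)] bk_sections[OF L'(1)] mult_left_mono) auto
    then show ?thesis using K' by simp
  qed
  show "(\<mu> y. kcomp K L x y) = m * m'" for x
  proof -
    have "(\<mu> y. kcomp K L x y) = (\<mu> z. (\<mu> y. K x z * L z y))"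
      unfolding kcomp_def by (intro Fubini_bdm bdm_mult bk_pair K' L')
    then show ?thesis using K' L' by simp
  qed
qed

lemma bk_cen [intro]: "reg K m B \<Longrightarrow> bk (cen K m')"
  using bk_pair(1)[OF regD(1)[of K m B]] unfolding bk_def cen_def split_beta' by (intro bdm_intros)

lemma cen_integral:
  assumes "reg K m B"
  shows "(\<mu> y. cen K m x y) = 0" "(\<mu> y. cen K m y x) = 0"
  using regD(5,6)[OF assms] bk_sections[OF regD(1)[OF assms]] F.prob_space unfolding cen_def
  by (auto simp: F.bdm_integrable)

lemma cen_sym: "reg K m B \<Longrightarrow> cen K m x y = cen K m y x"
  using regD(4)[of K m B x y] by (simp add: cen_def)

lemma cen_bound: assumes "reg K m B" shows "\<bar>cen K m x y\<bar> \<le> B"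
  using regD(2,3)[OF assms, of x y] regD(7,8)[OF assms] unfolding cen_def by (auto simp: abs_le_iff)

text \<open>Constant degrees turn both cross terms into the constant m * m', so centring commutes
  with composition. Hence walks of centred edges are centred walk densities.\<close>

lemma cen_kcomp:
  assumes K: "reg K m B" and L: "reg L m' B'"
  shows "kcomp (cen K m) (cen L m') = cen (kcomp K L) (m * m')"
proof (intro ext)
  fix x y
  note K' = regD[OF K] and L' = regD[OF L]
  have *: "integrable F (\<lambda>z. K x z * L z y)" "integrable F (\<lambda>z. K x z)" "integrable F (\<lambda>z. L z y)"
    by (intro F.bdm_integrable bdm_intros bk_sections[OF K'(1)] bk_sections[OF L'(1)])+
  have "kcomp (cen K m) (cen L m') x y = (\<mu> z. K x z * L z y - m' * K x z - m * L z y + m * m')"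
    unfolding kcomp_def cen_def by (simp add: algebra_simps)
  also have "\<dots> = kcomp K L x y - m' * m - m * m' + m * m'"
    using * K'(5,6) L'(5,6) F.prob_space by (simp add: kcomp_def)
  finally show "kcomp (cen K m) (cen L m') x y = cen (kcomp K L) (m * m') x y"
    by (simp add: cen_def)
qed

lemma reg_integral_power2:
  assumes K: "reg K m B"
  shows "(\<mu> y. (K x y)^2) \<le> B * m"
proof -
  note K' = regD[OF K]
  have "(\<mu> y. (K x y)^2) \<le> (\<mu> y. B * K x y)"
    using K' by (intro integral_mono F.bdm_integrable bdm_intros bk_sections[OF K'(1)]) (auto simp: power2_eq_square intro: mult_right_mono)
  then show ?thesis using K' by simp
qed

lemma cen_integral_power2:
  assumes K: "reg K m B"
  shows "(\<mu> y. (cen K m x y)^2) = (\<mu> y. (K x y)^2) - m\<^sup>2"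
    and "(\<mu> y. (cen K m x y)^2) \<le> B * m"
proof -
  note K' = regD[OF K]
  have *: "integrable F (\<lambda>z. (K x z)^2)" "integrable F (\<lambda>z. K x z)"
    by (intro F.bdm_integrable bdm_intros bk_sections[OF K'(1)])+
  have "(\<mu> y. (cen K m x y)^2) = (\<mu> y. (K x y)^2 - 2 * m * K x y + m^2)"
    unfolding cen_def by (simp add: algebra_simps power2_eq_square)
  also have "\<dots> = (\<mu> y. (K x y)^2) - m\<^sup>2"
    using * K'(5,6) F.prob_space by (simp add: power2_eq_square)
  finally show "(\<mu> y. (cen K m x y)^2) = (\<mu> y. (K x y)^2) - m\<^sup>2" .
  then show "(\<mu> y. (cen K m x y)^2) \<le> B * m"
    using reg_integral_power2[OF K, of x] zero_le_power2[of m] by linarith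
qed

end

section \<open>Regular graph kernels\<close>

text \<open>The degree is p at every point, not just at almost every point, so centred kernels
  integrate to exactly 0 after any redrawing of the other coordinates.\<close>

locale regular_kernel = iid_sample F for F :: "'b measure" +
  fixes W :: "'b \<Rightarrow> 'b \<Rightarrow> real" and p :: real
  assumes W_measurable: "(\<lambda>(x, y). W x y) \<in> borel_measurable (F \<Otimes>\<^sub>M F)"
    and W_01: "W x y \<in> {0, 1}"
    and W_sym: "W x y = W y x"
    and W_mass: "(\<mu> y. W x y) = p"
begin

definition "w2 = kcomp W W"
definition "w3 = kcomp W w2"
definition "w6 = kcomp w3 w3"

definition "a = cen W p"
definition "a2 = cen w2 (p^2)"
definition "a3 = cen w3 (p^3)"
definition "a6 = cen w6 (p^6)"

lemma W_bounds: "0 \<le> W x y" "W x y \<le> 1" "W x y * W x y = W x y"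
  using W_01[of x y] by auto

lemma reg_W: "reg W p 1"
  unfolding reg_def bk_def
  using W_measurable W_bounds W_mass W_sym by (auto intro!: bdmI[where B=1])

lemma p_bounds: "0 \<le> p" "p \<le> 1"
  using regD(7,8)[OF reg_W] by auto

lemma np_pos: assumes "real n * p \<ge> 1" shows "0 < p" "0 < real n"
  using assms p_bounds by (cases "p = 0"; cases "n = 0"; force)+

lemma reg_w2: "reg w2 (p^2) p"
  using reg_kcomp[OF reg_W reg_W] kcomp_commute[of W W] W_sym
  by (auto simp: w2_def power2_eq_square)

lemma bk_W: "bk W" by (rule regD(1)[OF reg_W])
lemma bk_w2: "bk w2" by (rule regD(1)[OF reg_w2])

lemma w3_alt: "w3 = kcomp w2 W"
  by (simp add: w3_def w2_def kcomp_assoc bk_W)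

text \<open>A composition of symmetric kernels is symmetric when the factors commute; W and w2
  commute by associativity.\<close>

lemma reg_w3: "reg w3 (p^3) (p^2)"
proof -
  have "kcomp W w2 x y = kcomp W w2 y x" for x y
    using kcomp_commute[of W w2 x y] regD(4)[OF reg_w2] W_sym w3_alt w3_def by metis
  from reg_kcomp[OF reg_W reg_w2 this] show ?thesis
    by (simp add: w3_def power3_eq_cube power2_eq_square mult.assoc)
qed

lemma bk_w3: "bk w3" by (rule regD(1)[OF reg_w3])

lemma reg_w6: "reg w6 (p^6) (p^5)"
proof -
  have "kcomp w3 w3 x y = kcomp w3 w3 y x" for x y
    using kcomp_commute[of w3 w3 x y] regD(4)[OF reg_w3] by metis
  from reg_kcomp[OF reg_w3 reg_w3 this] show ?thesis
    by (simp add: w6_def flip: power_add)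
qed

lemma bk_w6: "bk w6" by (rule regD(1)[OF reg_w6])

lemma bk_a: "bk a" "bk a2" "bk a3" "bk a6"
  unfolding a_def a2_def a3_def a6_def using reg_W reg_w2 reg_w3 reg_w6 by auto

lemmas bdm_kernels [bdm_intros] =
  bk_sections[OF bk_W] bk_sections[OF bk_w2] bk_sections[OF bk_w3] bk_sections[OF bk_w6]
  bk_sections[OF bk_a(1)] bk_sections[OF bk_a(2)] bk_sections[OF bk_a(3)] bk_sections[OF bk_a(4)]

lemma kcomp_a: "kcomp a a = a2" "kcomp a a2 = a3" "kcomp a2 a = a3" "kcomp a3 a3 = a6"
  unfolding a_def a2_def a3_def a6_def
  by (simp_all add: cen_kcomp[OF reg_W reg_W] cen_kcomp[OF reg_W reg_w2] cen_kcomp[OF reg_w2 reg_W]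
     cen_kcomp[OF reg_w3 reg_w3] w2_def[symmetric] w3_def[symmetric] w3_alt[symmetric] w6_def[symmetric]
     flip: power_Suc power_Suc2 power_add)
    (simp add: power2_eq_square)

lemma integral_a_mult:
  "(\<mu> z. a x z * a z y) = a2 x y" "(\<mu> z. a x z * a2 z y) = a3 x y"
  "(\<mu> z. a2 x z * a z y) = a3 x y" "(\<mu> z. a3 x z * a3 z y) = a6 x y"
  using kcomp_a by (auto simp: kcomp_def fun_eq_iff)

lemma integral_a [simp]:
  "(\<mu> y. a x y) = 0" "(\<mu> y. a2 x y) = 0" "(\<mu> y. a3 x y) = 0" "(\<mu> y. a6 x y) = 0"
  "(\<mu> y. a y x) = 0" "(\<mu> y. a2 y x) = 0" "(\<mu> y. a3 y x) = 0" "(\<mu> y. a6 y x) = 0"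
  unfolding a_def a2_def a3_def a6_def
  using cen_integral[OF reg_W] cen_integral[OF reg_w2] cen_integral[OF reg_w3] cen_integral[OF reg_w6] by auto

lemma a_sym: "a x y = a y x" "a2 x y = a2 y x" "a3 x y = a3 y x" "a6 x y = a6 y x"
  unfolding a_def a2_def a3_def a6_def
  using cen_sym[OF reg_W] cen_sym[OF reg_w2] cen_sym[OF reg_w3] cen_sym[OF reg_w6] by auto

lemma a_bound: "\<bar>a3 x y\<bar> \<le> p^2" "\<bar>a6 x y\<bar> \<le> p^5"
  unfolding a3_def a6_def using cen_bound[OF reg_w3] cen_bound[OF reg_w6] by auto

text \<open>A square is at most the supremum times the function, so each bound is degree times
  supremum: p * 1, p^2 * p, p^3 * p^2 and p^6 * p^5.\<close>

lemma integral_a_power2: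
  "(\<mu> y. (a x y)^2) \<le> p" "(\<mu> y. (a2 x y)^2) \<le> p^3" "(\<mu> y. (a3 x y)^2) \<le> p^5"
  "(\<mu> y. (a6 x y)^2) \<le> p^11"
  unfolding a_def a2_def a3_def a6_def
  using cen_integral_power2(2)[OF reg_W, of x] cen_integral_power2(2)[OF reg_w2, of x]
    cen_integral_power2(2)[OF reg_w3, of x] cen_integral_power2(2)[OF reg_w6, of x]
  by (auto simp flip: power_add power_Suc)

text \<open>The probability that six independent points, taken in cyclic order, are adjacent to
  their successors; see \<open>E_cyc\<close>.\<close>

definition "q6 = (\<mu> x. w6 x x)"

lemma q6_bounds: "0 \<le> q6" "q6 \<le> p^5"
  unfolding q6_def using regD(2,3)[OF reg_w6]
  by (auto intro!: Bochner_Integration.integral_nonneg F.integral_le_const F.bdm_integrable bdm_intros)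

lemma integral_a6_diag: "(\<mu> x. a6 x x) = q6 - p^6"
  unfolding a6_def cen_def q6_def using bk_sections(3)[OF bk_w6] F.prob_space
  by (simp add: F.bdm_integrable)

end

section \<open>Sums over distinct tuples\<close>

lemma finite_distinct_tuples [simp]: "finite (distinct_tuples n t)"
  unfolding distinct_tuples_def
  by (rule finite_subset[OF _ finite_lists_length_eq[of "{1..n}" t]]) auto

lemma sum_distinct_tuples_Suc:
  "(\<Sum>v\<in>distinct_tuples n (Suc t). f v) = (\<Sum>u\<in>distinct_tuples n t. \<Sum>j\<in>{1..n} - set u. f (u @ [j]))"
proof -
  have bij: "bij_betw (\<lambda>(u, j). u @ [j]) (Sigma (distinct_tuples n t) (\<lambda>u. {1..n} - set u)) (distinct_tuples n (Suc t))"
  proof (rule bij_betwI[where g="\<lambda>v. (butlast v, last v)"])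
    show "(\<lambda>v. (butlast v, last v)) \<in> distinct_tuples n (Suc t) \<rightarrow> Sigma (distinct_tuples n t) (\<lambda>u. {1..n} - set u)"
    proof
      fix v assume v: "v \<in> distinct_tuples n (Suc t)"
      then obtain u j where "v = u @ [j]" by (auto simp: distinct_tuples_def length_Suc_conv_rev)
      with v show "(butlast v, last v) \<in> Sigma (distinct_tuples n t) (\<lambda>u. {1..n} - set u)"
        by (auto simp: distinct_tuples_def)
    qed
    show "(\<lambda>(u, j). u @ [j]) ((butlast v, last v)) = v" if "v \<in> distinct_tuples n (Suc t)" for v
      using that by (auto simp: distinct_tuples_def intro!: append_butlast_last_id)
  qed (auto simp: distinct_tuples_def)
  show ?thesis
    by (subst sum.reindex_bij_betw[OF bij, symmetric]) (simp add: sum.Sigma split_beta')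
qed

text \<open>Given the first i entries there are n - i choices for the next one. If s \<le> n < t,
  truncated subtraction makes a factor 0, in accordance with the empty sum on the left.\<close>

lemma sum_distinct_tuples_take:
  fixes f :: "nat list \<Rightarrow> real"
  assumes "s \<le> t"
  shows "(\<Sum>v\<in>distinct_tuples n t. f (take s v)) =
    (\<Prod>i\<in>{s..<t}. real (n - i)) * (\<Sum>u\<in>distinct_tuples n s. f u)"
  using assms
proof (induction t rule: dec_induct)
  case base
  then show ?case by (auto simp: distinct_tuples_def intro!: sum.cong)
next
  case (step t)
  have "(\<Sum>v\<in>distinct_tuples n (Suc t). f (take s v)) =
    (\<Sum>u\<in>distinct_tuples n t. \<Sum>j\<in>{1..n} - set u. f (take s u))"
    using step.hyps unfolding sum_distinct_tuples_Suc by (intro sum.cong) (auto simp: distinct_tuples_def)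
  also have "\<dots> = (\<Sum>u\<in>distinct_tuples n t. real (n - t) * f (take s u))"
    by (intro sum.cong) (auto simp: distinct_tuples_def card_Diff_subset distinct_card)
  also have "\<dots> = real (n - t) * (\<Sum>u\<in>distinct_tuples n t. f (take s u))"
    by (simp add: sum_distrib_left)
  finally show ?case using step by (simp add: prod.atLeastLessThan_Suc)
qed

lemma sum_distinct_tuples_permute:
  assumes "distinct qs" "set qs = {..<t}"
  shows "(\<Sum>v\<in>distinct_tuples n t. f (map ((!) v) qs)) = (\<Sum>v\<in>distinct_tuples n t. f v)"
proof -
  have len: "length qs = t" using assms by (metis card_lessThan distinct_card)
  let ?g = "\<lambda>v::nat list. map ((!) v) qs"
  have inj: "inj_on ?g (distinct_tuples n t)"
  proof (rule inj_onI)
    fix v w assume vw: "v \<in> distinct_tuples n t" "w \<in> distinct_tuples n t" "?g v = ?g w"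
    then have "\<forall>i\<in>set qs. v ! i = w ! i" by simp
    with vw assms show "v = w" by (auto simp: distinct_tuples_def intro!: nth_equalityI)
  qed
  have sub: "?g ` distinct_tuples n t \<subseteq> distinct_tuples n t"
  proof safe
    fix v assume v: "v \<in> distinct_tuples n t"
    then have "inj_on ((!) v) (set qs)" using assms
      by (auto simp: distinct_tuples_def inj_on_def nth_eq_iff_index_eq)
    with v show "?g v \<in> distinct_tuples n t"
      using assms len by (auto simp: distinct_tuples_def distinct_map)
  qed
  have "bij_betw ?g (distinct_tuples n t) (distinct_tuples n t)"
    using inj endo_inj_surj[OF _ sub inj] by (simp add: bij_betw_def)
  then show ?thesis by (rule sum.reindex_bij_betw)
qed

text \<open>A permutation of positions moves ps to the front; the remaining entries are then free
  choices.\<close>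

lemma sum_distinct_tuples_marginal:
  fixes f :: "nat list \<Rightarrow> real"
  assumes "distinct ps" "set ps \<subseteq> {..<t}"
  shows "(\<Sum>v\<in>distinct_tuples n t. f (map ((!) v) ps)) =
    (\<Prod>i\<in>{length ps..<t}. real (n - i)) * (\<Sum>u\<in>distinct_tuples n (length ps). f u)"
proof -
  define qs where "qs = ps @ filter (\<lambda>i. i \<notin> set ps) [0..<t]"
  have qs: "distinct qs" "set qs = {..<t}" using assms by (auto simp: qs_def)
  have "card (set ps) \<le> card {..<t}" using assms(2) by (intro card_mono) auto
  then have le: "length ps \<le> t" using assms(1) by (simp add: distinct_card)
  have "(\<Sum>v\<in>distinct_tuples n t. f (map ((!) v) ps)) =
    (\<Sum>v\<in>distinct_tuples n t. (\<lambda>u. f (take (length ps) u)) (map ((!) v) qs))"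
    by (simp add: qs_def)
  also have "\<dots> = (\<Sum>v\<in>distinct_tuples n t. f (take (length ps) v))"
    by (rule sum_distinct_tuples_permute[OF qs])
  finally show ?thesis using sum_distinct_tuples_take[OF le, of f n] by simp
qed

lemma card_distinct_tuples: "real (card (distinct_tuples n t)) = (\<Prod>i<t. real (n - i))"
proof -
  have "distinct_tuples n 0 = {[]}" by (auto simp: distinct_tuples_def)
  then show ?thesis
    using sum_distinct_tuples_take[of 0 t "\<lambda>_. 1" n] by (simp add: lessThan_atLeast0)
qed

lemma card_distinct_tuples_le: "real (card (distinct_tuples n t)) \<le> real n ^ t"
proof -
  have "(\<Prod>i<t. real (n - i)) \<le> (\<Prod>i<t. real n)" by (intro prod_mono) auto
  then show ?thesis by (simp add: card_distinct_tuples)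
qed

lemma distinct_tuplesD: "v \<in> distinct_tuples n t \<Longrightarrow> length v = t \<and> distinct v"
  by (simp add: distinct_tuples_def)

lemma distinct_tuples2E:
  assumes "v \<in> distinct_tuples n 2"
  obtains i j where "v = [i, j]" "i \<noteq> j"
  using assms that by (auto simp: distinct_tuples_def numeral_eq_Suc length_Suc_conv)

lemma distinct_tuples3E:
  assumes "v \<in> distinct_tuples n 3"
  obtains i j k where "v = [i, j, k]" "i \<noteq> j" "i \<noteq> k" "j \<noteq> k"
  using assms that by (auto simp: distinct_tuples_def numeral_eq_Suc length_Suc_conv)

lemma distinct_tuples4E:
  assumes "v \<in> distinct_tuples n 4"
  obtains i j k l where "v = [i, j, k, l]" "i \<noteq> j" "i \<noteq> k" "i \<noteq> l" "j \<noteq> k" "j \<noteq> l" "k \<noteq> l"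
  using assms that by (auto simp: distinct_tuples_def numeral_eq_Suc length_Suc_conv)

section \<open>Second moments of the centred subgraph counts\<close>

context iid_sample
begin

lemma int_F: "bdm F f \<Longrightarrow> integrable F f"
  by (rule F.bdm_integrable)

lemma prob_UNIV [simp]: "F.prob UNIV = 1"
  using F.prob_space by simp

lemma E_mono_resample:
  fixes f g :: "_ \<Rightarrow> real"
  assumes "bdm P f" "bdm P g" "\<And>x. (\<mu> y. f (x(j := y))) \<le> g x"
  shows "(\<E> x. f x) \<le> (\<E> x. g x)"
  unfolding resample[OF assms(1), of j] by (intro integral_mono P.bdm_integrable bdm_resample_integral assms)

lemma E_integral_le:
  assumes "bdm P f" "\<And>x. (\<mu> y. f (x(j := y))) \<le> (c::real)"
  shows "(\<E> x. f x) \<le> c"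
  using E_mono_resample[of f "\<lambda>_. c" j] assms P.prob_space by (simp add: bdm_const)

text \<open>Removes a leaf j from a forest of factors: Z ignores j, so the factor attached to j can
  be integrated first.\<close>

lemma E_peel:
  fixes Z f :: "_ \<Rightarrow> real"
  assumes "bdm P Z" "bdm P f" "\<And>x. 0 \<le> Z x" "\<And>x y. Z (x(j := y)) = Z x" "\<And>x. (\<mu> y. f (x(j := y))) \<le> c"
  shows "(\<E> x. Z x * f x) \<le> c * (\<E> x. Z x)"
proof -
  have "(\<E> x. Z x * f x) \<le> (\<E> x. Z x * c)"
    using assms by (intro E_mono_resample[where j=j] bdm_intros) (auto intro: mult_left_mono)
  then show ?thesis by (simp add: mult.commute)
qed

lemma degenerate_tuples_second_moment:
  fixes g :: "nat list \<Rightarrow> (nat \<Rightarrow> 'b) \<Rightarrow> real"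
  assumes "\<And>v. bdm P (g v)" "0 \<le> B"
    and "\<And>v. v \<in> distinct_tuples n t \<Longrightarrow> (\<E> x. (g v x)^2) \<le> B"
    and "\<And>v j x y. v \<in> distinct_tuples n t \<Longrightarrow> j \<notin> set v \<Longrightarrow> g v (x(j := y)) = g v x"
    and "\<And>v j x. v \<in> distinct_tuples n t \<Longrightarrow> j \<in> set v \<Longrightarrow> (\<mu> y. g v (x(j := y))) = 0"
  shows "(\<E> x. (\<Sum>v\<in>distinct_tuples n t. g v x)^2) \<le> real (t ^ t) * real n ^ t * B"
proof -
  have "(\<E> x. (\<Sum>v\<in>distinct_tuples n t. g v x)^2) \<le> real (t ^ t) * real (card (distinct_tuples n t)) * B"
    by (rule degenerate_second_moment[OF finite_distinct_tuples distinct_tuplesD assms(1,3,4,5)])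
  also have "\<dots> \<le> real (t ^ t) * real n ^ t * B"
    using assms(2) card_distinct_tuples_le[of n t] by (intro mult_right_mono mult_left_mono) auto
  finally show ?thesis .
qed

lemma degenerate_pairs_second_moment:
  assumes K: "bk K" and int: "\<And>u. (\<mu> y. K u y) = 0" "\<And>u. (\<mu> y. K y u) = 0"
    and B: "0 \<le> B" "\<And>i j. i \<noteq> j \<Longrightarrow> (\<E> x. (K (x i) (x j))^2) \<le> B"
  shows "(\<E> x. (\<Sum>v\<in>distinct_tuples n 2. K (x (v!0)) (x (v!1)))^2) \<le> 4 * real n ^ 2 * B"
proof -
  have "(\<E> x. (\<Sum>v\<in>distinct_tuples n 2. K (x (v!0)) (x (v!1)))^2) \<le> real (2 ^ 2) * real n ^ 2 * B"
  proof (rule degenerate_tuples_second_moment, goal_cases)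
    case (3 v)
    then show ?case by (elim distinct_tuples2E) (simp add: B)
  next
    case (4 v j x y)
    then show ?case by (elim distinct_tuples2E) simp
  next
    case (5 v j x)
    then show ?case by (elim distinct_tuples2E) (auto simp: int)
  qed (intro bk_sections K B)+
  then show ?thesis by simp
qed

lemma E_sum_power2:
  assumes "bdm P f" "bdm P g" "(\<E> x. (f x)^2) \<le> A" "(\<E> x. (g x)^2) \<le> (B::real)"
  shows "(\<E> x. (f x + g x)^2) \<le> 2 * A + 2 * B" "(\<E> x. (f x - g x)^2) \<le> 2 * A + 2 * B"
proof -
  have *: "(u + v)^2 \<le> 2 * u^2 + 2 * v^2" "(u - v)^2 \<le> 2 * u^2 + 2 * v^2" for u v :: real
    using zero_le_power2[of "u - v"] zero_le_power2[of "u + v"] by (auto simp: power2_eq_square algebra_simps)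
  have i: "integrable P (\<lambda>x. (f x)^2)" "integrable P (\<lambda>x. (g x)^2)" "integrable P (\<lambda>x. (f x + g x)^2)" "integrable P (\<lambda>x. (f x - g x)^2)"
    using assms by (intro P.bdm_integrable bdm_intros; simp)+
  have "(\<E> x. (f x + g x)^2) \<le> (\<E> x. 2 * (f x)^2 + 2 * (g x)^2)"
    using i * by (intro integral_mono) auto
  then show "(\<E> x. (f x + g x)^2) \<le> 2 * A + 2 * B" using i assms by simp
  have "(\<E> x. (f x - g x)^2) \<le> (\<E> x. 2 * (f x)^2 + 2 * (g x)^2)"
    using i * by (intro integral_mono) auto
  then show "(\<E> x. (f x - g x)^2) \<le> 2 * A + 2 * B" using i assms by simp
qed

lemma E_path_power2:
  assumes K: "bk K" "\<And>u. (\<mu> y. (K u y)^2) \<le> \<alpha>" and L: "bk L" "\<And>u. (\<mu> y. (L u y)^2) \<le> \<beta>"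
    and "0 \<le> \<beta>" and ne: "i \<noteq> j" "i \<noteq> k" "j \<noteq> k"
  shows "(\<E> x. (K (x i) (x j))^2 * (L (x j) (x k))^2) \<le> \<alpha> * \<beta>"
proof -
  have "(\<E> x. (K (x i) (x j))^2 * (L (x j) (x k))^2) \<le> \<beta> * (\<E> x. (K (x i) (x j))^2)"
    using ne L(2) by (intro E_peel[where j=k] bdm_power bk_sections K L) auto
  also have "\<dots> \<le> \<beta> * \<alpha>"
    using ne K(2) \<open>0 \<le> \<beta>\<close> by (intro mult_left_mono E_integral_le[where j=j] bdm_power bk_sections K(1)) auto
  finally show ?thesis by (simp add: mult.commute)
qed

lemma path_kernel_power2:
  assumes K: "bk K" "\<And>u. (\<mu> y. (K u y)^2) \<le> \<alpha>" and L: "bk L" "\<And>u. (\<mu> y. (L u y)^2) \<le> \<beta>"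
    and N: "bk N" "\<And>u. (\<mu> y. (N u y)^2) \<le> \<alpha> * \<beta>" and "0 \<le> \<beta>" and ne: "i \<noteq> j" "i \<noteq> k" "j \<noteq> k"
  shows "(\<E> x. (K (x i) (x j) * L (x j) (x k) - N (x i) (x k))^2) \<le> 4 * (\<alpha> * \<beta>)"
proof -
  have "(\<E> x. (N (x i) (x k))^2) \<le> \<alpha> * \<beta>"
    using ne N(2) by (intro E_integral_le[where j=k] bdm_power bk_sections N(1)) auto
  then have "(\<E> x. (K (x i) (x j) * L (x j) (x k) - N (x i) (x k))^2) \<le> 2 * (\<alpha> * \<beta>) + 2 * (\<alpha> * \<beta>)"
    using E_path_power2[OF K L \<open>0 \<le> \<beta>\<close> ne]
    by (intro E_sum_power2 bdm_mult bk_sections K N L) (simp_all add: power_mult_distrib)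
  then show ?thesis by simp
qed

text \<open>N is the integral of the path over its middle vertex. Subtracting it makes the summand
  degenerate in all three vertices, so the orthogonality bound applies; 108 is 3 ^ 3 times the 4 of
  \<open>path_kernel_power2\<close>.\<close>

lemma path_kernel_second_moment:
  assumes K: "bk K" "\<And>u. (\<mu> y. (K u y)^2) \<le> \<alpha>" and L: "bk L" "\<And>u. (\<mu> y. (L u y)^2) \<le> \<beta>"
    and N: "bk N" "\<And>u. (\<mu> y. (N u y)^2) \<le> \<alpha> * \<beta>" and nn: "0 \<le> \<alpha>" "0 \<le> \<beta>"
    and comp: "\<And>u w. (\<mu> z. K u z * L z w) = N u w"
    and int: "\<And>u. (\<mu> y. K y u) = 0" "\<And>u. (\<mu> y. L u y) = 0" "\<And>u. (\<mu> y. N u y) = 0" "\<And>u. (\<mu> y. N y u) = 0"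
  shows "(\<E> x. (\<Sum>v\<in>distinct_tuples n 3. K (x (v!0)) (x (v!1)) * L (x (v!1)) (x (v!2)) - N (x (v!0)) (x (v!2)))^2)
    \<le> 108 * (real n ^ 3 * (\<alpha> * \<beta>))"
proof -
  have i: "integrable F (\<lambda>y. K y u)" "integrable F (\<lambda>y. L u y)" "integrable F (\<lambda>y. N u y)" "integrable F (\<lambda>y. N y u)"
    "integrable F (\<lambda>y. K u y * L y w)" for u w
    by (intro int_F bdm_mult bk_sections K L N)+
  have "(\<E> x. (\<Sum>v\<in>distinct_tuples n 3. K (x (v!0)) (x (v!1)) * L (x (v!1)) (x (v!2)) - N (x (v!0)) (x (v!2)))^2)
    \<le> real (3 ^ 3) * real n ^ 3 * (4 * (\<alpha> * \<beta>))"
  proof (rule degenerate_tuples_second_moment, goal_cases)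
    case (1 v) show ?case by (intro bdm_diff bdm_mult bk_sections K L N)
  next
    case (3 v)
    then show ?case by (elim distinct_tuples3E) (simp add: path_kernel_power2[OF K L N nn(2)])
  next
    case (4 v j x y)
    then show ?case by (elim distinct_tuples3E) auto
  next
    case (5 v j x)
    then show ?case
      by (elim distinct_tuples3E) (auto simp: i comp int Bochner_Integration.integral_diff)
  qed (simp add: nn)
  then show ?thesis by simp
qed

end

context regular_kernel
begin

text \<open>The digits list the lengths of the paths that make up the counted forest, so
  \<open>S11\<close> belongs to two disjoint edges. All sums run over ordered tuples.\<close>

definition "S1 n x = (\<Sum>v\<in>distinct_tuples n 2. a (x (v!0)) (x (v!1)))"

definition "S2 n x = (\<Sum>v\<in>distinct_tuples n 3. a (x (v!0)) (x (v!1)) * a (x (v!1)) (x (v!2)))"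

definition "S11 n x = (\<Sum>v\<in>distinct_tuples n 4. a (x (v!0)) (x (v!1)) * a (x (v!2)) (x (v!3)))"

definition "S3 n x = (\<Sum>v\<in>distinct_tuples n 4. a (x (v!0)) (x (v!1)) * a (x (v!1)) (x (v!2)) * a (x (v!2)) (x (v!3)))"

text \<open>The projection of \<open>S3\<close> onto the end points of the path, without the factor
  (n - 2) * (n - 3) for the choice of the inner vertices.\<close>

definition "H2 n x = (\<Sum>v\<in>distinct_tuples n 2. a3 (x (v!0)) (x (v!1)))"

lemma bdm_S: "bdm P (S1 n)" "bdm P (S2 n)" "bdm P (S11 n)" "bdm P (S3 n)" "bdm P (H2 n)"
  unfolding S1_def S2_def S11_def S3_def H2_def by (intro bdm_intros)+

lemma integral_a_mult_left: "(\<mu> z. c * a x z * a z y) = c * a2 x y"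
  using integral_a_mult(1)[of x y] by (simp add: mult.assoc)

lemma E_a_power2:
  assumes "i \<noteq> j"
  shows "(\<E> x. (a (x i) (x j))^2) \<le> p" "(\<E> x. (a2 (x i) (x j))^2) \<le> p^3"
    "(\<E> x. (a3 (x i) (x j))^2) \<le> p^5" "(\<E> x. (a6 (x i) (x j))^2) \<le> p^11"
  using assms by (auto intro!: E_integral_le[where j=j] bdm_intros integral_a_power2)

lemmas a_rows = bk_a(1) integral_a_power2(1)
lemmas a2_rows = bk_a(2) integral_a_power2(2)

lemma p_power_le: "k \<le> m \<Longrightarrow> p ^ m \<le> p ^ k"
  using p_bounds by (intro power_decreasing) auto

text \<open>The bounds for a2 and a3 are weakened to the product form \<alpha> * \<beta> in which
  \<open>path_kernel_second_moment\<close> wants the norm of a composition.\<close>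

lemma integral_a_power2_weak: "(\<mu> y. (a2 x y)^2) \<le> p * p" "(\<mu> y. (a3 x y)^2) \<le> p * p^3" "(\<mu> y. (a3 x y)^2) \<le> p^3 * p"
  using order_trans[OF integral_a_power2(2) p_power_le[of 2 3]] order_trans[OF integral_a_power2(3) p_power_le[of 4 5]]
  by (simp_all add: power2_eq_square mult.commute[of "p^3"] flip: power_Suc)

lemma S1_second_moment: "(\<E> x. (S1 n x)^2) \<le> 4 * real n ^ 2 * p"
  unfolding S1_def by (intro degenerate_pairs_second_moment bk_a integral_a E_a_power2 p_bounds)

lemma H2_second_moment: "(\<E> x. (H2 n x)^2) \<le> 4 * real n ^ 2 * p^5"
  unfolding H2_def by (intro degenerate_pairs_second_moment bk_a integral_a E_a_power2 p_bounds zero_le_power)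

lemma S11_second_moment: "(\<E> x. (S11 n x)^2) \<le> 256 * real n ^ 4 * p^2"
proof -
  have "(\<E> x. (S11 n x)^2) \<le> real (4 ^ 4) * real n ^ 4 * p^2"
    unfolding S11_def
  proof (rule degenerate_tuples_second_moment, goal_cases)
    case (3 v)
    then show ?case
    proof (elim distinct_tuples4E)
      fix i j k l assume v: "v = [i, j, k, l]" "i \<noteq> j" "i \<noteq> k" "i \<noteq> l" "j \<noteq> k" "j \<noteq> l" "k \<noteq> l"
      have "(\<E> x. (a (x i) (x j))^2 * (a (x k) (x l))^2) \<le> p * (\<E> x. (a (x i) (x j))^2)"
        using v by (intro E_peel[where j=l] bdm_intros) (auto simp: integral_a_power2)
      also have "\<dots> \<le> p * p" using v p_bounds by (intro mult_left_mono E_a_power2) auto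
      finally show ?thesis by (simp add: v power_mult_distrib power2_eq_square[of p])
    qed
  next
    case (1 v) show ?case by (intro bdm_intros)
  next
    case (4 v j x y)
    then show ?case by (elim distinct_tuples4E) auto
  next
    case (5 v j x)
    then show ?case by (elim distinct_tuples4E) auto
  qed (simp add: p_bounds)
  then show ?thesis by simp
qed

text \<open>The end-point projection contributes n^4 p^3. The rest is degenerate in three vertices
  and contributes n^3 p^2, which np \<ge> 1 absorbs. The constant is 2 * 4 + 2 * 108.\<close>

lemma S2_second_moment:
  assumes "real n * p \<ge> 1"
  shows "(\<E> x. (S2 n x)^2) \<le> 224 * real n ^ 4 * p^3"
proof -
  define U where "U x = (\<Sum>v\<in>distinct_tuples n 2. a2 (x (v!0)) (x (v!1)))" for x
  define Y where "Y x = (\<Sum>v\<in>distinct_tuples n 3. a (x (v!0)) (x (v!1)) * a (x (v!1)) (x (v!2)) - a2 (x (v!0)) (x (v!2)))"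
    for x :: "nat \<Rightarrow> 'b"
  have bdm: "bdm P U" "bdm P Y" unfolding U_def Y_def by (intro bdm_intros)+
  have split: "S2 n x = real (n - 2) * U x + Y x" for x
    using sum_distinct_tuples_marginal[of "[0, 2]" 3 "\<lambda>u. a2 (x (u!0)) (x (u!1))" n]
    by (simp add: S2_def U_def Y_def sum_subtractf numeral_eq_Suc)
  have U: "(\<E> x. (U x)^2) \<le> 4 * real n ^ 2 * p^3"
    unfolding U_def by (intro degenerate_pairs_second_moment bk_a integral_a E_a_power2 p_bounds zero_le_power)
  have "(\<E> x. (real (n - 2) * U x)^2) = (real (n - 2))^2 * (\<E> x. (U x)^2)"
    by (simp add: power_mult_distrib)
  also have "\<dots> \<le> real n ^ 2 * (4 * real n ^ 2 * p^3)"
    using U by (intro mult_mono power_mono) auto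
  finally have U': "(\<E> x. (real (n - 2) * U x)^2) \<le> real n ^ 2 * (4 * real n ^ 2 * p^3)" .
  have Y: "(\<E> x. (Y x)^2) \<le> 108 * (real n ^ 3 * (p * p))"
    unfolding Y_def by (intro path_kernel_second_moment a_rows bk_a integral_a integral_a_mult integral_a_power2_weak p_bounds)
  have "real n ^ 3 * (p * p) * 1 \<le> real n ^ 3 * (p * p) * (real n * p)"
    using assms p_bounds by (intro mult_left_mono) auto
  also have "\<dots> = real n ^ 4 * p^3" by (simp add: numeral_eq_Suc)
  finally have "real n ^ 3 * (p * p) \<le> real n ^ 4 * p^3" by simp
  moreover have "(\<E> x. (S2 n x)^2) \<le> 2 * (real n ^ 2 * (4 * real n ^ 2 * p^3)) + 2 * (108 * (real n ^ 3 * (p * p)))"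
    unfolding split by (intro E_sum_power2 bdm_intros bdm U' Y)
  moreover have "2 * (real n ^ 2 * (4 * real n ^ 2 * p^3)) = 8 * real n ^ 4 * p^3"
    by (simp flip: power_add)
  ultimately show ?thesis by linarith
qed

text \<open>Hoeffding decomposition of the centred 3-path count: after removing the projection onto the
  two end points, every remaining component is completely degenerate in at least three vertices.\<close>

lemma S3_projection:
  assumes "real n * p \<ge> 1"
  shows "(\<E> x. (S3 n x - real (n - 2) * real (n - 3) * H2 n x)^2) \<le> 17248 * real n ^ 5 * p^4"
proof -
  define \<psi> where "\<psi> v x = a (x (v!0)) (x (v!1)) * a2 (x (v!1)) (x (v!2)) - a3 (x (v!0)) (x (v!2))"
    for v :: "nat list" and x :: "nat \<Rightarrow> 'b"
  define \<psi>' where "\<psi>' v x = a2 (x (v!0)) (x (v!1)) * a (x (v!1)) (x (v!2)) - a3 (x (v!0)) (x (v!2))"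
    for v :: "nat list" and x :: "nat \<Rightarrow> 'b"
  \<comment> \<open>Inclusion and exclusion over the two inner vertices: the path, minus its
    integrals over the third and over the second vertex, plus the integral over both.\<close>
  define \<phi> where "\<phi> v x = a (x (v!0)) (x (v!1)) * a (x (v!1)) (x (v!2)) * a (x (v!2)) (x (v!3))
      - a (x (v!0)) (x (v!1)) * a2 (x (v!1)) (x (v!3))
      - (a2 (x (v!0)) (x (v!2)) * a (x (v!2)) (x (v!3)) - a3 (x (v!0)) (x (v!3)))"
    for v :: "nat list" and x :: "nat \<Rightarrow> 'b"
  define Y where "Y x = (\<Sum>v\<in>distinct_tuples n 3. \<psi> v x)" for x
  define Y' where "Y' x = (\<Sum>v\<in>distinct_tuples n 3. \<psi>' v x)" for x
  define U where "U x = (\<Sum>v\<in>distinct_tuples n 4. \<phi> v x)" for x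
  have bdm: "bdm P U" "bdm P Y" "bdm P Y'" unfolding U_def Y_def Y'_def \<psi>_def \<psi>'_def \<phi>_def by (intro bdm_intros)+
  have split: "S3 n x - real (n - 2) * real (n - 3) * H2 n x = (real (n - 3) * Y x + real (n - 3) * Y' x) + U x" for x
  proof -
    have 1: "(\<Sum>v\<in>distinct_tuples n 4. \<psi> [v!0, v!1, v!3] x) = real (n - 3) * Y x"
      using sum_distinct_tuples_marginal[of "[0, 1, 3]" 4 "\<lambda>u. \<psi> u x" n] by (simp add: Y_def numeral_eq_Suc)
    have 2: "(\<Sum>v\<in>distinct_tuples n 4. \<psi>' [v!0, v!2, v!3] x) = real (n - 3) * Y' x"
      using sum_distinct_tuples_marginal[of "[0, 2, 3]" 4 "\<lambda>u. \<psi>' u x" n] by (simp add: Y'_def numeral_eq_Suc)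
    have 3: "(\<Sum>v\<in>distinct_tuples n 4. a3 (x (v!0)) (x (v!3))) = real (n - 2) * real (n - 3) * H2 n x"
      using sum_distinct_tuples_marginal[of "[0, 3]" 4 "\<lambda>u. a3 (x (u!0)) (x (u!1))" n]
      by (simp add: H2_def numeral_eq_Suc)
    have "S3 n x = (\<Sum>v\<in>distinct_tuples n 4. \<phi> v x + \<psi> [v!0, v!1, v!3] x + \<psi>' [v!0, v!2, v!3] x + a3 (x (v!0)) (x (v!3)))"
      unfolding S3_def by (intro sum.cong) (simp_all add: \<phi>_def \<psi>_def \<psi>'_def)
    then show ?thesis by (simp add: sum.distrib 1 2 3 U_def del: One_nat_def)
  qed
  have "(\<E> x. (Y x)^2) \<le> 108 * (real n ^ 3 * (p * p^3))"
    unfolding Y_def \<psi>_def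
    by (intro path_kernel_second_moment a_rows a2_rows bk_a integral_a integral_a_mult integral_a_power2_weak p_bounds zero_le_power)
  then have Y: "(\<E> x. (Y x)^2) \<le> 108 * (real n ^ 3 * p^4)" by (simp flip: power_Suc)
  have "(\<E> x. (Y' x)^2) \<le> 108 * (real n ^ 3 * (p^3 * p))"
    unfolding Y'_def \<psi>'_def
    by (intro path_kernel_second_moment a_rows a2_rows bk_a integral_a integral_a_mult integral_a_power2_weak p_bounds zero_le_power)
  then have Y': "(\<E> x. (Y' x)^2) \<le> 108 * (real n ^ 3 * p^4)" by (simp flip: power_Suc2)
  have "(\<E> x. (U x)^2) \<le> real (4 ^ 4) * real n ^ 4 * (16 * p^3)"
    unfolding U_def
  proof (rule degenerate_tuples_second_moment, goal_cases)
    case (1 v) show ?case unfolding \<phi>_def by (intro bdm_intros)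
  next
    case (3 v)
    then show ?case
    proof (elim distinct_tuples4E)
      fix i j k l assume v: "v = [i, j, k, l]" "i \<noteq> j" "i \<noteq> k" "i \<noteq> l" "j \<noteq> k" "j \<noteq> l" "k \<noteq> l"
      \<comment> \<open>The path is a tree: peeling off l, k and j in turn costs a factor p
        each.\<close>
      have "(\<E> x. ((a (x i) (x j))^2 * (a (x j) (x k))^2) * (a (x k) (x l))^2)
        \<le> p * (\<E> x. (a (x i) (x j))^2 * (a (x j) (x k))^2)"
        using v by (intro E_peel[where j=l] bdm_intros) (auto simp: integral_a_power2)
      also have "\<dots> \<le> p * (p * p)"
        using v p_bounds by (intro mult_left_mono E_path_power2 a_rows) auto
      finally have "(\<E> x. (\<phi> v x)^2) \<le> 2 * (2 * (p * (p * p)) + 2 * (p * p^3)) + 2 * (4 * (p^3 * p))"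
        unfolding v \<phi>_def
        using E_path_power2[OF a_rows a2_rows, of i j l]
          path_kernel_power2[OF a2_rows a_rows bk_a(3) integral_a_power2_weak(3), of i k l] v p_bounds
        by (intro E_sum_power2 bdm_intros) (auto simp: power_mult_distrib)
      also have "\<dots> \<le> 16 * p^3" using p_power_le[of 3 4]
        by (simp add: power3_eq_cube mult.assoc power_numeral_reduce)
      finally show ?thesis .
    qed
  next
    case (4 v j x y)
    then show ?case by (elim distinct_tuples4E) (auto simp: \<phi>_def)
  next
    case (5 v j x)
    then show ?case
      by (elim distinct_tuples4E) (auto simp: \<phi>_def int_F bdm_intros integral_a_mult integral_a_mult_left
          Bochner_Integration.integral_diff)
  qed (simp add: p_bounds)
  then have U: "(\<E> x. (U x)^2) \<le> 4096 * (real n ^ 4 * p^3)" by simp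
  have scale: "(\<E> x. (real (n - 3) * Z x)^2) \<le> 108 * (real n ^ 5 * p^4)"
    if "(\<E> x. (Z x)^2) \<le> 108 * (real n ^ 3 * p^4)" for Z :: "_ \<Rightarrow> real"
  proof -
    have "(\<E> x. (real (n - 3) * Z x)^2) = (real (n - 3))^2 * (\<E> x. (Z x)^2)"
      by (simp add: power_mult_distrib)
    also have "\<dots> \<le> real n ^ 2 * (108 * (real n ^ 3 * p^4))"
      using that by (intro mult_mono power_mono) auto
    finally show ?thesis by (simp add: numeral_eq_Suc mult_ac)
  qed
  have "real n ^ 4 * p^3 * 1 \<le> real n ^ 4 * p^3 * (real n * p)"
    using assms p_bounds by (intro mult_left_mono) auto
  also have "\<dots> = real n ^ 5 * p^4" by (simp add: numeral_eq_Suc)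
  finally have *: "real n ^ 4 * p^3 \<le> real n ^ 5 * p^4" by simp
  have "(\<E> x. ((real (n - 3) * Y x + real (n - 3) * Y' x) + U x)^2) \<le>
    2 * (2 * (108 * (real n ^ 5 * p^4)) + 2 * (108 * (real n ^ 5 * p^4))) + 2 * (4096 * (real n ^ 4 * p^3))"
    by (intro E_sum_power2 bdm_intros bdm U scale Y Y')
  also have "\<dots> \<le> 17248 * (real n ^ 5 * p^4)"
  proof -
    have "2 * (2 * (108 * u) + 2 * (108 * u)) + 2 * (4096 * v) \<le> 17248 * u" if "v \<le> u" "0 \<le> u" for u v :: real
      using that by simp
    from this[OF *] show ?thesis using p_bounds by simp
  qed
  finally show ?thesis unfolding split by (simp add: mult.assoc)
qed

text \<open>By np \<ge> 1 the projection error n^5 p^4 is below the size n^6 p^5 of the projection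
  itself. The constant is 2 * 17248 + 2 * 4.\<close>

lemma S3_second_moment:
  assumes "real n * p \<ge> 1"
  shows "(\<E> x. (S3 n x)^2) \<le> 34504 * real n ^ 6 * p^5"
proof -
  have "(\<E> x. (real (n - 2) * real (n - 3) * H2 n x)^2) = (real (n - 2) * real (n - 3))^2 * (\<E> x. (H2 n x)^2)"
    by (simp add: power_mult_distrib)
  also have "\<dots> \<le> (real n * real n)^2 * (4 * real n ^ 2 * p^5)"
    using H2_second_moment by (intro mult_mono power_mono) auto
  also have "\<dots> = 4 * (real n ^ 6 * p^5)" by (simp add: numeral_eq_Suc)
  finally have H: "(\<E> x. (real (n - 2) * real (n - 3) * H2 n x)^2) \<le> 4 * (real n ^ 6 * p^5)" .
  have "(\<E> x. ((S3 n x - real (n - 2) * real (n - 3) * H2 n x) + real (n - 2) * real (n - 3) * H2 n x)^2)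
    \<le> 2 * (17248 * real n ^ 5 * p^4) + 2 * (4 * (real n ^ 6 * p^5))"
    by (intro E_sum_power2 bdm_intros bdm_S H S3_projection assms)
  moreover have "real n ^ 5 * p^4 * 1 \<le> real n ^ 5 * p^4 * (real n * p)"
    using assms p_bounds by (intro mult_left_mono) auto
  moreover have "real n ^ 5 * p^4 * (real n * p) = real n ^ 6 * p^5" by (simp add: numeral_eq_Suc)
  ultimately show ?thesis by simp
qed

end

section \<open>Expansion of the test statistic\<close>

context regular_kernel
begin

text \<open>The diagonal is set to 0 explicitly, because \<open>W x x\<close> itself can be
  1.\<close>

definition adj :: "(nat \<Rightarrow> 'b) \<Rightarrow> nat \<Rightarrow> nat \<Rightarrow> real" where
  "adj x i j = (if i \<noteq> j then W (x i) (x j) else 0)"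

lemma W_eq: "W u v = p + a u v"
  by (simp add: a_def cen_def)

definition "R_stat n x = T_stat n (adj x) - real n * (real n - 1) * p * S3 n x"

lemma edge_sum:
  assumes "n \<ge> 4"
  shows "(\<Sum>v\<in>distinct_tuples n 2. adj x (v!0) (v!1)) = real n * (real n - 1) * p + S1 n x"
proof -
  have "(\<Sum>v\<in>distinct_tuples n 2. adj x (v!0) (v!1)) = (\<Sum>v\<in>distinct_tuples n 2. p + a (x (v!0)) (x (v!1)))"
    by (intro sum.cong) (auto elim!: distinct_tuples2E simp: adj_def W_eq)
  then show ?thesis
    using assms by (simp add: sum.distrib S1_def card_distinct_tuples numeral_eq_Suc of_nat_diff algebra_simps)
qed

lemma path2_sum:
  assumes "n \<ge> 4"
  shows "(\<Sum>v\<in>distinct_tuples n 3. adj x (v!0) (v!1) * adj x (v!1) (v!2)) =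
    real n * (real n - 1) * (real n - 2) * p^2 + 2 * p * (real n - 2) * S1 n x + S2 n x"
proof -
  let ?a = "\<lambda>u::nat list. a (x (u!0)) (x (u!1))"
  have m: "(\<Sum>v\<in>distinct_tuples n 3. a (x (v!0)) (x (v!1))) = real (n - 2) * S1 n x"
    "(\<Sum>v\<in>distinct_tuples n 3. a (x (v!1)) (x (v!2))) = real (n - 2) * S1 n x"
    using sum_distinct_tuples_marginal[of "[0, 1]" 3 ?a n] sum_distinct_tuples_marginal[of "[1, 2]" 3 ?a n]
    by (simp_all add: S1_def numeral_eq_Suc)
  have "(\<Sum>v\<in>distinct_tuples n 3. adj x (v!0) (v!1) * adj x (v!1) (v!2)) =
    (\<Sum>v\<in>distinct_tuples n 3. p^2 + p * a (x (v!0)) (x (v!1)) + p * a (x (v!1)) (x (v!2))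
      + a (x (v!0)) (x (v!1)) * a (x (v!1)) (x (v!2)))"
    by (intro sum.cong refl, elim distinct_tuples3E) (auto simp: adj_def W_eq algebra_simps power2_eq_square)
  also have "\<dots> = real n * real (n - 1) * real (n - 2) * p^2 + p * (real (n - 2) * S1 n x) + p * (real (n - 2) * S1 n x) + S2 n x"
    by (simp add: sum.distrib m S2_def card_distinct_tuples del: One_nat_def flip: sum_distrib_left)
       (simp add: numeral_eq_Suc)
  finally show ?thesis
    using assms by (simp add: of_nat_diff algebra_simps)
qed

lemma path3_sum:
  assumes "n \<ge> 4"
  shows "(\<Sum>v\<in>distinct_tuples n 4. adj x (v!0) (v!1) * adj x (v!1) (v!2) * adj x (v!2) (v!3)) =
    real n * (real n - 1) * (real n - 2) * (real n - 3) * p^3 + 3 * p^2 * ((real n - 2) * (real n - 3)) * S1 n x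
      + 2 * p * (real n - 3) * S2 n x + p * S11 n x + S3 n x"
proof -
  let ?a = "\<lambda>u::nat list. a (x (u!0)) (x (u!1))"
  let ?b = "\<lambda>u::nat list. a (x (u!0)) (x (u!1)) * a (x (u!1)) (x (u!2))"
  have m: "(\<Sum>v\<in>distinct_tuples n 4. a (x (v!0)) (x (v!1))) = real (n - 2) * real (n - 3) * S1 n x"
    "(\<Sum>v\<in>distinct_tuples n 4. a (x (v!1)) (x (v!2))) = real (n - 2) * real (n - 3) * S1 n x"
    "(\<Sum>v\<in>distinct_tuples n 4. a (x (v!2)) (x (v!3))) = real (n - 2) * real (n - 3) * S1 n x"
    "(\<Sum>v\<in>distinct_tuples n 4. a (x (v!0)) (x (v!1)) * a (x (v!1)) (x (v!2))) = real (n - 3) * S2 n x"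
    "(\<Sum>v\<in>distinct_tuples n 4. a (x (v!1)) (x (v!2)) * a (x (v!2)) (x (v!3))) = real (n - 3) * S2 n x"
    using sum_distinct_tuples_marginal[of "[0, 1]" 4 ?a n] sum_distinct_tuples_marginal[of "[1, 2]" 4 ?a n]
      sum_distinct_tuples_marginal[of "[2, 3]" 4 ?a n]
      sum_distinct_tuples_marginal[of "[0, 1, 2]" 4 ?b n] sum_distinct_tuples_marginal[of "[1, 2, 3]" 4 ?b n]
    by (simp_all add: S1_def S2_def numeral_eq_Suc)
  have "(\<Sum>v\<in>distinct_tuples n 4. adj x (v!0) (v!1) * adj x (v!1) (v!2) * adj x (v!2) (v!3)) =
    (\<Sum>v\<in>distinct_tuples n 4. p^3 + p^2 * a (x (v!0)) (x (v!1)) + p^2 * a (x (v!1)) (x (v!2)) + p^2 * a (x (v!2)) (x (v!3))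
      + p * (a (x (v!0)) (x (v!1)) * a (x (v!1)) (x (v!2))) + p * (a (x (v!1)) (x (v!2)) * a (x (v!2)) (x (v!3)))
      + p * (a (x (v!0)) (x (v!1)) * a (x (v!2)) (x (v!3)))
      + a (x (v!0)) (x (v!1)) * a (x (v!1)) (x (v!2)) * a (x (v!2)) (x (v!3)))"
    by (intro sum.cong refl, elim distinct_tuples4E) (auto simp: adj_def W_eq algebra_simps power2_eq_square power3_eq_cube)
  also have "\<dots> = real n * real (n - 1) * real (n - 2) * real (n - 3) * p^3
      + p^2 * (real (n - 2) * real (n - 3) * S1 n x) + p^2 * (real (n - 2) * real (n - 3) * S1 n x)
      + p^2 * (real (n - 2) * real (n - 3) * S1 n x)
      + p * (real (n - 3) * S2 n x) + p * (real (n - 3) * S2 n x) + p * S11 n x + S3 n x"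
    by (simp add: sum.distrib m S11_def S3_def card_distinct_tuples del: One_nat_def flip: sum_distrib_left)
       (simp add: numeral_eq_Suc)
  finally show ?thesis
    using assms by (simp add: of_nat_diff algebra_simps)
qed

text \<open>In the difference of the two products, the constant and the coefficients of S1 and S2
  all contain (m - 3) - (m - 2) = -1 and so lose a power of m. This cancellation is what leaves S3
  as the leading term.\<close>

lemma R_stat_expand:
  assumes "n \<ge> 4"
  defines "m \<equiv> real n"
  shows "R_stat n x = - (m^2 * (m-1)^2 * (m-2) * p^4) - 4 * p^3 * (m * (m-1) * (m-2)) * S1 n x
     - 2 * p^2 * (m * (m-1)) * S2 n x + p^2 * (m * (m-1)) * S11 n x - p^2 * ((m-2) * (m+1)) * (S1 n x)^2
     - 2 * p * (m-1) * (S1 n x * S2 n x) + p * (S11 n x * S1 n x) + S3 n x * S1 n x - (S2 n x)^2"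
  unfolding R_stat_def T_stat_def edge_sum[OF assms(1)] path2_sum[OF assms(1)] path3_sum[OF assms(1)] m_def[symmetric]
  by algebra

lemma bdm_adj: "bdm P (\<lambda>x. adj x i j)"
  unfolding adj_def by (cases "i = j") (auto intro: bdm_intros)

lemma bdm_R_stat: "bdm P (R_stat n)"
  unfolding R_stat_def T_stat_def by (intro bdm_intros bdm_S bdm_adj)

text \<open>In L1 each product of two counts splits by Cauchy-Schwarz into second moments already
  known. The term n^5 p^4 is the deterministic part of the expansion.\<close>

lemma R_stat_bound:
  assumes n: "n \<ge> 4" and np: "real n * p \<ge> 1"
  shows "(\<E> x. \<bar>R_stat n x\<bar>) \<le> real n ^ 5 * p^4 + 747 * real n ^ 4 * p^3"
proof -
  define m where "m = real n"
  \<comment> \<open>With the root of p as the variable, half-integer powers of p become polynomial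
    and the final comparison is plain algebra.\<close>
  define \<rho> where "\<rho> = sqrt p"
  have m: "m \<ge> 4" using n by (simp add: m_def)
  have \<rho>: "0 \<le> \<rho>" "\<rho> \<le> 1" "p = \<rho>^2" using p_bounds by (auto simp: \<rho>_def)
  \<comment> \<open>The constants 2, 15, 16 and 186 are the square roots of 4, 224, 256 and 34504,
    rounded up.\<close>
  have L2: "sqrt (\<E> x. (S1 n x)^2) \<le> 2 * m * \<rho>"
    "sqrt (\<E> x. (S2 n x)^2) \<le> 15 * m^2 * \<rho>^3"
    "sqrt (\<E> x. (S11 n x)^2) \<le> 16 * m^2 * \<rho>^2"
    "sqrt (\<E> x. (S3 n x)^2) \<le> 186 * m^3 * \<rho>^5"
  proof -
    have nn: "0 \<le> m ^ k * \<rho> ^ l" for k l using m \<rho> by simp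
    show "sqrt (\<E> x. (S1 n x)^2) \<le> 2 * m * \<rho>"
      using S1_second_moment[of n] \<rho>(1) by (intro real_le_lsqrt) (simp_all add: \<rho>(3) m_def power_mult_distrib)
    show "sqrt (\<E> x. (S2 n x)^2) \<le> 15 * m^2 * \<rho>^3"
      using order_trans[OF S2_second_moment[OF np], of "225 * m^4 * \<rho>^6"] \<rho>(1) nn[of 4 6]
      by (intro real_le_lsqrt) (simp_all add: \<rho>(3) m_def power_mult_distrib flip: power_mult)
    show "sqrt (\<E> x. (S11 n x)^2) \<le> 16 * m^2 * \<rho>^2"
      using S11_second_moment[of n] \<rho>(1) by (intro real_le_lsqrt) (simp_all add: \<rho>(3) m_def power_mult_distrib flip: power_mult)
    show "sqrt (\<E> x. (S3 n x)^2) \<le> 186 * m^3 * \<rho>^5"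
      using order_trans[OF S3_second_moment[OF np], of "34596 * m^6 * \<rho>^10"] \<rho>(1) nn[of 6 10]
      by (intro real_le_lsqrt) (simp_all add: \<rho>(3) m_def power_mult_distrib flip: power_mult)
  qed
  have L1: "(\<E> x. \<bar>S1 n x\<bar>) \<le> 2 * m * \<rho>" "(\<E> x. \<bar>S2 n x\<bar>) \<le> 15 * m^2 * \<rho>^3" "(\<E> x. \<bar>S11 n x\<bar>) \<le> 16 * m^2 * \<rho>^2"
    using P.abs_le_sqrt_second_moment[OF bdm_S(1)[of n]] P.abs_le_sqrt_second_moment[OF bdm_S(2)[of n]]
      P.abs_le_sqrt_second_moment[OF bdm_S(3)[of n]] L2 by linarith+
  have prod: "(\<E> x. \<bar>f x * g x\<bar>) \<le> A * B"
    if "bdm P f" "bdm P g" "sqrt (\<E> x. (f x)^2) \<le> A" "sqrt (\<E> x. (g x)^2) \<le> B" for f g A B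
  proof -
    have "0 \<le> A" by (rule order_trans[OF _ that(3)]) simp
    then have "sqrt (\<E> x. (f x)^2) * sqrt (\<E> x. (g x)^2) \<le> A * B"
      using that by (intro mult_mono) auto
    with P.Cauchy_Schwarz_bdm[OF that(1,2)] show ?thesis by linarith
  qed
  have L11: "(\<E> x. \<bar>S1 n x * S1 n x\<bar>) \<le> (2 * m * \<rho>) * (2 * m * \<rho>)"
    "(\<E> x. \<bar>S1 n x * S2 n x\<bar>) \<le> (2 * m * \<rho>) * (15 * m^2 * \<rho>^3)"
    "(\<E> x. \<bar>S11 n x * S1 n x\<bar>) \<le> (16 * m^2 * \<rho>^2) * (2 * m * \<rho>)"
    "(\<E> x. \<bar>S3 n x * S1 n x\<bar>) \<le> (186 * m^3 * \<rho>^5) * (2 * m * \<rho>)"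
    "(\<E> x. \<bar>S2 n x * S2 n x\<bar>) \<le> (15 * m^2 * \<rho>^3) * (15 * m^2 * \<rho>^3)"
    by (intro prod bdm_S L2)+
  let ?B = "\<lambda>x. m^5 * p^4 + 4 * p^3 * m^3 * \<bar>S1 n x\<bar> + 2 * p^2 * m^2 * \<bar>S2 n x\<bar> + p^2 * m^2 * \<bar>S11 n x\<bar>
      + p^2 * m^2 * \<bar>S1 n x * S1 n x\<bar> + 2 * p * m * \<bar>S1 n x * S2 n x\<bar> + p * \<bar>S11 n x * S1 n x\<bar> + \<bar>S3 n x * S1 n x\<bar>
      + \<bar>S2 n x * S2 n x\<bar>"
  have point: "\<bar>R_stat n x\<bar> \<le> ?B x" for x
  proof -
    have coef: "\<bar>k * l * u\<bar> \<le> k * l' * \<bar>u\<bar>" if "0 \<le> k" "0 \<le> l" "l \<le> l'" for k l l' u :: real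
      using that by (simp add: abs_mult mult_left_mono mult_right_mono)
    have "m^2 * (m-1)^2 * (m-2) \<le> m^2 * m^2 * m" using m by (intro mult_mono power_mono) auto
    then have "m^2 * (m-1)^2 * (m-2) \<le> m^5" by (simp add: numeral_eq_Suc mult.assoc)
    then have c1: "\<bar>m^2 * (m-1)^2 * (m-2) * p^4\<bar> \<le> m^5 * p^4"
      using m p_bounds by (simp add: abs_mult mult_right_mono)
    have "m * (m-1) * (m-2) \<le> m * m * m" using m by (intro mult_mono) auto
    then have le: "m * (m-1) * (m-2) \<le> m^3" "m * (m-1) \<le> m^2" "(m-2) * (m+1) \<le> m^2" "m - 1 \<le> m"
      using m by (simp_all add: power3_eq_cube) (simp_all add: power2_eq_square algebra_simps)
    have nn: "0 \<le> 4 * p^3" "0 \<le> 2 * p^2" "0 \<le> p^2" "0 \<le> 2 * p"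
      "0 \<le> m * (m-1) * (m-2)" "0 \<le> m * (m-1)" "0 \<le> (m-2) * (m+1)" "0 \<le> m - 1"
      using m p_bounds by simp_all
    have c7: "\<bar>p * u\<bar> \<le> p * \<bar>u\<bar>" for u using p_bounds by (simp add: abs_mult)
    note c = c1 coef[OF nn(1,5) le(1)] coef[OF nn(2,6) le(2)] coef[OF nn(3,6) le(2)] coef[OF nn(3,7) le(3)] coef[OF nn(4,8) le(4)] c7
    have tri: "\<bar>- c1 - c2 - c3 + c4 - c5 - c6 + c7 + c8 - c9\<bar> \<le> d1 + d2 + d3 + d4 + d5 + d6 + d7 + d8 + d9"
      if "\<bar>c1\<bar> \<le> d1" "\<bar>c2\<bar> \<le> d2" "\<bar>c3\<bar> \<le> d3" "\<bar>c4\<bar> \<le> d4" "\<bar>c5\<bar> \<le> d5" "\<bar>c6\<bar> \<le> d6" "\<bar>c7\<bar> \<le> d7" "\<bar>c8\<bar> \<le> d8" "\<bar>c9\<bar> \<le> d9"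
      for c1 c2 c3 c4 c5 c6 c7 c8 c9 d1 d2 d3 d4 d5 d6 d7 d8 d9 :: real
      using that unfolding abs_le_iff by (intro conjI) linarith+
    show ?thesis
      unfolding R_stat_expand[OF n] m_def[symmetric] power2_eq_square[of "S1 n x"] power2_eq_square[of "S2 n x"]
      by (rule tri) (rule c order_refl)+
  qed
  have "(\<E> x. \<bar>R_stat n x\<bar>) \<le> (\<E> x. ?B x)"
    using point by (intro integral_mono P.bdm_integrable bdm_intros bdm_S bdm_R_stat)
  also have "\<dots> = m^5 * p^4 + 4 * p^3 * m^3 * (\<E> x. \<bar>S1 n x\<bar>) + 2 * p^2 * m^2 * (\<E> x. \<bar>S2 n x\<bar>)
      + p^2 * m^2 * (\<E> x. \<bar>S11 n x\<bar>)
      + p^2 * m^2 * (\<E> x. \<bar>S1 n x * S1 n x\<bar>) + 2 * p * m * (\<E> x. \<bar>S1 n x * S2 n x\<bar>)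
      + p * (\<E> x. \<bar>S11 n x * S1 n x\<bar>) + (\<E> x. \<bar>S3 n x * S1 n x\<bar>) + (\<E> x. \<bar>S2 n x * S2 n x\<bar>)"
  proof -
    have i: "integrable P (\<lambda>x. \<bar>S1 n x\<bar>)" "integrable P (\<lambda>x. \<bar>S2 n x\<bar>)" "integrable P (\<lambda>x. \<bar>S11 n x\<bar>)"
      "integrable P (\<lambda>x. \<bar>S1 n x * S1 n x\<bar>)" "integrable P (\<lambda>x. \<bar>S1 n x * S2 n x\<bar>)"
      "integrable P (\<lambda>x. \<bar>S11 n x * S1 n x\<bar>)" "integrable P (\<lambda>x. \<bar>S3 n x * S1 n x\<bar>)" "integrable P (\<lambda>x. \<bar>S2 n x * S2 n x\<bar>)"
      by (intro P.bdm_integrable bdm_intros bdm_S)+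
    have "P.prob UNIV = 1" using P.prob_space by simp
    then show ?thesis using i
      by (simp del: abs_mult_self_eq add: Bochner_Integration.integral_add)
  qed
  also have "\<dots> \<le> m^5 * p^4 + 4 * p^3 * m^3 * (2 * m * \<rho>) + 2 * p^2 * m^2 * (15 * m^2 * \<rho>^3)
      + p^2 * m^2 * (16 * m^2 * \<rho>^2)
      + p^2 * m^2 * ((2 * m * \<rho>) * (2 * m * \<rho>)) + 2 * p * m * ((2 * m * \<rho>) * (15 * m^2 * \<rho>^3))
      + p * ((16 * m^2 * \<rho>^2) * (2 * m * \<rho>)) + (186 * m^3 * \<rho>^5) * (2 * m * \<rho>) + (15 * m^2 * \<rho>^3) * (15 * m^2 * \<rho>^3)"
    using m p_bounds by (intro add_mono mult_left_mono L1 L11 order_refl) auto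
  also have "\<dots> = m^5 * p^4 + (38 * (m^4 * \<rho>^7) + 677 * (m^4 * \<rho>^6) + 32 * (m^3 * \<rho>^5))"
    unfolding \<rho>(3) by algebra
  also have "\<dots> \<le> m^5 * p^4 + 747 * m^4 * p^3"
  proof -
    have 1: "m^4 * \<rho>^7 \<le> m^4 * \<rho>^6" using m \<rho> by (intro mult_left_mono power_decreasing) auto
    have "1 \<le> m * \<rho>^2" using np by (simp add: m_def \<rho>(3))
    also have "\<dots> \<le> m * \<rho>" using m \<rho> by (simp add: power2_eq_square mult_left_le)
    finally have "m^3 * \<rho>^5 * 1 \<le> m^3 * \<rho>^5 * (m * \<rho>)" using m \<rho> by (intro mult_left_mono) auto
    then have 2: "m^3 * \<rho>^5 \<le> m^4 * \<rho>^6" by (simp add: numeral_eq_Suc mult_ac)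
    have "38 * A + 677 * B + 32 * C \<le> 747 * B" if "A \<le> B" "C \<le> B" for A B C :: real using that by simp
    from this[OF 1 2] have "38 * (m^4 * \<rho>^7) + 677 * (m^4 * \<rho>^6) + 32 * (m^3 * \<rho>^5) \<le> 747 * (m^4 * \<rho>^6)" .
    moreover have "\<rho>^6 = p^3" by (simp add: \<rho>(3) flip: power_mult)
    ultimately show ?thesis by (simp only: mult.assoc add_left_mono)
  qed
  finally show ?thesis by (simp add: m_def)
qed

end

section \<open>A central limit theorem for the degenerate quadratic form\<close>

context regular_kernel
begin

definition row :: "nat \<Rightarrow> (nat \<Rightarrow> 'b) \<Rightarrow> 'b \<Rightarrow> real" where
  "row k x y = (\<Sum>i\<in>{1..k}. a3 (x i) y)"

text \<open>Summand k is the martingale difference created by the point \<open>Suc k\<close>; it is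
  0 for k = 0. Each unordered pair occurs once, hence half of \<open>H2\<close>.\<close>

definition "Q n x = (\<Sum>k<n. row k x (x (Suc k)))"

lemma H2_eq_Q: "H2 n x = 2 * Q n x"
proof -
  have "H2 n x = (\<Sum>i\<in>{1..n}. \<Sum>j\<in>{1..n} - {i}. a3 (x i) (x j))"
  proof -
    have "distinct_tuples n 0 = {[]}" by (auto simp: distinct_tuples_def)
    then show ?thesis
      unfolding H2_def numeral_2_eq_2 sum_distinct_tuples_Suc by simp
  qed
  also have "\<dots> = (\<Sum>k<n. \<Sum>i\<in>{1..k}. a3 (x i) (x (Suc k)) + a3 (x (Suc k)) (x i))"
  proof (induction n)
    case (Suc n)
    have "(\<Sum>i\<in>{1..Suc n}. \<Sum>j\<in>{1..Suc n} - {i}. a3 (x i) (x j)) =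
      (\<Sum>i\<in>{1..n}. \<Sum>j\<in>{1..Suc n} - {i}. a3 (x i) (x j)) + (\<Sum>j\<in>{1..Suc n} - {Suc n}. a3 (x (Suc n)) (x j))"
      by simp
    also have "(\<Sum>i\<in>{1..n}. \<Sum>j\<in>{1..Suc n} - {i}. a3 (x i) (x j)) =
      (\<Sum>i\<in>{1..n}. (\<Sum>j\<in>{1..n} - {i}. a3 (x i) (x j)) + a3 (x i) (x (Suc n)))"
    proof (intro sum.cong refl)
      fix i assume "i \<in> {1..n}"
      then have "{1..Suc n} - {i} = insert (Suc n) ({1..n} - {i})" by auto
      then show "(\<Sum>j\<in>{1..Suc n} - {i}. a3 (x i) (x j)) = (\<Sum>j\<in>{1..n} - {i}. a3 (x i) (x j)) + a3 (x i) (x (Suc n))"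
        by simp
    qed
    also have "{1..Suc n} - {Suc n} = {1..n}" by auto
    finally show ?case using Suc by (simp add: sum.distrib)
  qed simp
  also have "\<dots> = 2 * Q n x"
    unfolding Q_def row_def sum_distrib_left
    by (intro sum.cong refl) (metis a_sym(3) mult_2)
  finally show ?thesis .
qed

lemma bdm_row: "bdm P (\<lambda>x. row k x (x m))" "bdm F (\<lambda>y. row k x y)"
  unfolding row_def by (intro bdm_intros)+

lemma bdm_Q: "bdm P (Q n)"
  unfolding Q_def by (intro bdm_intros bdm_row)

lemma row_upd: "j > k \<Longrightarrow> row k (x(j := y)) = row k x"
  unfolding row_def by (intro ext sum.cong) auto

lemma Q_upd: "j > n \<Longrightarrow> Q n (x(j := y)) = Q n x"
  unfolding Q_def by (intro sum.cong) (auto simp: row_upd)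

lemma integral_a3_power2': "(\<mu> y. (a3 y u)^2) \<le> p^5"
  using integral_a_power2(3)[of u] by (simp add: a_sym(3)[of _ u])

lemma integral_a3_power4: "(\<mu> y. (a3 y u) ^ 4) \<le> p^9"
proof -
  have "(a3 y u) ^ 4 \<le> p^4 * (a3 y u)^2" for y
  proof -
    have "(a3 y u)^2 \<le> (p^2)^2" using a_bound(1)[of y u] by (rule power2_le_iff_abs_le[THEN iffD2, rotated]) simp
    then have "(a3 y u)^2 * (a3 y u)^2 \<le> (p^2)^2 * (a3 y u)^2" by (intro mult_right_mono) auto
    then show ?thesis by (simp flip: power_add power_mult)
  qed
  then have "(\<mu> y. (a3 y u) ^ 4) \<le> (\<mu> y. p^4 * (a3 y u)^2)"
    by (intro integral_mono int_F bdm_intros)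
  also have "\<dots> \<le> p^4 * p^5"
    unfolding integral_mult_right_zero using integral_a3_power2'[of u] p_bounds by (intro mult_left_mono) auto
  finally show ?thesis by (simp flip: power_add)
qed

text \<open>Induction on J: with x m and the other points fixed, the added summand is centred, so
  terms linear in it disappear. The new mixed term 8 * card J * p^10 is paid for by the growth of 4
  * (card J)^2.\<close>

lemma row_moments:
  assumes "finite J" "m \<notin> J"
  shows "(\<E> x. (\<Sum>i\<in>J. a3 (x i) (x m))^2) \<le> real (card J) * p^5"
    and "(\<E> x. (\<Sum>i\<in>J. a3 (x i) (x m)) ^ 4) \<le> 4 * real (card J) ^ 2 * p^10 + 3 * real (card J) * p^9"
  using assms
proof (induction J)
  case empty
  { case 1 then show ?case by simp }
  { case 2 then show ?case by simp }
next
  case (insert i J)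
  define U where "U x = (\<Sum>i\<in>J. a3 (x i) (x m))" for x
  have bdmU [bdm_intros]: "bdm P U" unfolding U_def by (intro bdm_intros)
  have U: "U (x(i := y)) = U x" if "i \<noteq> m" for x y
    using insert.hyps that unfolding U_def by (intro sum.cong) auto
  have i3: "integrable F (\<lambda>y. a3 y u)" "integrable F (\<lambda>y. (a3 y u)^2)" "integrable F (\<lambda>y. (a3 y u)^4)" for u
    by (intro int_F bdm_intros)+
  { case 1
    then have im: "i \<noteq> m" by auto
    have "(\<E> x. (\<Sum>i\<in>insert i J. a3 (x i) (x m))^2) = (\<E> x. (a3 (x i) (x m) + U x)^2)"
      using insert.hyps by (simp add: U_def)
    also have "\<dots> \<le> (\<E> x. p^5 + (U x)^2)"
    proof (rule E_mono_resample[where j=i])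
      show "bdm P (\<lambda>x. (a3 (x i) (x m) + U x)^2)" "bdm P (\<lambda>x. p^5 + (U x)^2)" by (intro bdm_intros)+
      fix x
      have "(\<mu> y. (a3 y (x m) + U x)^2) = (\<mu> y. (a3 y (x m))^2 + (2 * U x) * a3 y (x m) + (U x)^2)"
        by (simp add: power2_sum algebra_simps)
      also have "\<dots> = (\<mu> y. (a3 y (x m))^2) + (U x)^2"
        using i3 by simp
      finally show "(\<mu> y. (a3 ((x(i := y)) i) ((x(i := y)) m) + U (x(i := y)))^2) \<le> p^5 + (U x)^2"
        using integral_a3_power2' im by (simp add: U)
    qed
    also have "\<dots> = p^5 + (\<E> x. (U x)^2)"
      using P.prob_space by (subst Bochner_Integration.integral_add) (auto intro!: P.bdm_integrable bdm_intros)
    also have "\<dots> \<le> p^5 + real (card J) * p^5" using insert.IH(1) 1 by (simp add: U_def)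
    finally show ?case using insert.hyps by (simp add: algebra_simps) }
  { case 2
    then have im: "i \<noteq> m" by auto
    have "(\<E> x. (\<Sum>i\<in>insert i J. a3 (x i) (x m))^4) = (\<E> x. (a3 (x i) (x m) + U x)^4)"
      using insert.hyps by (simp add: U_def)
    also have "\<dots> \<le> (\<E> x. 3 * p^9 + 8 * p^5 * (U x)^2 + (U x)^4)"
    proof (rule E_mono_resample[where j=i])
      show "bdm P (\<lambda>x. (a3 (x i) (x m) + U x)^4)" "bdm P (\<lambda>x. 3 * p^9 + 8 * p^5 * (U x)^2 + (U x)^4)" by (intro bdm_intros)+
      fix x
      \<comment> \<open>The mixed term 4 h^3 u is at most 2 h^4 + 2 h^2 u^2, while the term linear
        in h stays exact because it integrates to 0.\<close>
      have quartic: "(h + u)^4 \<le> 3 * h^4 + (8 * u^2) * h^2 + (4 * u^3) * h + u^4" for h u :: real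
      proof -
        have "3 * h^4 + (8 * u^2) * h^2 + (4 * u^3) * h + u^4 - (h + u)^4 = 2 * (h * (h - u))^2"
          by (simp add: power_numeral_reduce algebra_simps)
        then show ?thesis using zero_le_power2[of "h * (h - u)"] by linarith
      qed
      have "(\<mu> y. (a3 y (x m) + U x)^4) \<le> (\<mu> y. 3 * (a3 y (x m))^4 + (8 * (U x)^2) * (a3 y (x m))^2
          + (4 * (U x)^3) * a3 y (x m) + (U x)^4)"
        by (intro integral_mono int_F bdm_intros quartic)
      also have "\<dots> = 3 * (\<mu> y. (a3 y (x m))^4) + (8 * (U x)^2) * (\<mu> y. (a3 y (x m))^2) + (U x)^4"
        using i3 by simp
      also have "\<dots> \<le> 3 * p^9 + (8 * (U x)^2) * p^5 + (U x)^4"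
        using integral_a3_power2' integral_a3_power4 by (intro add_mono mult_left_mono) auto
      finally show "(\<mu> y. (a3 ((x(i := y)) i) ((x(i := y)) m) + U (x(i := y)))^4) \<le> 3 * p^9 + 8 * p^5 * (U x)^2 + (U x)^4"
        using im by (simp add: U mult_ac)
    qed
    also have "\<dots> = 3 * p^9 + 8 * p^5 * (\<E> x. (U x)^2) + (\<E> x. (U x)^4)"
    proof -
      have "integrable P (\<lambda>x. (U x)^2)" "integrable P (\<lambda>x. (U x)^4)" by (intro P.bdm_integrable bdm_intros)+
      then show ?thesis using P.prob_space by simp
    qed
    also have "\<dots> \<le> 3 * p^9 + 8 * p^5 * (real (card J) * p^5) + (4 * real (card J) ^ 2 * p^10 + 3 * real (card J) * p^9)"
      using insert.IH 2 p_bounds unfolding U_def by (intro add_mono mult_left_mono) auto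
    also have "\<dots> \<le> 4 * real (card (insert i J)) ^ 2 * p^10 + 3 * real (card (insert i J)) * p^9"
      using insert.hyps p_bounds by (simp add: power_numeral_reduce algebra_simps)
    finally show ?case . }
qed

lemma row_second_moment: "k < m \<Longrightarrow> (\<E> x. (row k x (x m))^2) \<le> real k * p^5"
  using row_moments(1)[of "{1..k}" m] by (simp add: row_def)

text \<open>Interpolates between the second and fourth moments at the scale l = sqrt (n p^5), the
  size of a full row. The condition np \<ge> 1 makes the fourth moment at most 7 l^4, and 4 is 1/2 +
  7/2.\<close>

lemma row_third_moment:
  assumes "k < m" "k \<le> n" "real n * p \<ge> 1"
  shows "(\<E> x. \<bar>row k x (x m)\<bar> ^ 3) \<le> 4 * (real n * p^5 * (sqrt n * sqrt p ^ 5))"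
proof -
  define l where "l = sqrt n * sqrt p ^ 5"
  note np = np_pos[OF assms(3)]
  have l: "l > 0" "l * l = real n * p^5"
  proof -
    show "l > 0" using np by (simp add: l_def)
    have "l = sqrt (real n * p^5)" by (simp add: l_def real_sqrt_mult real_sqrt_power)
    then show "l * l = real n * p^5" using np by simp
  qed
  have cube: "\<bar>u\<bar> ^ 3 \<le> (l/2) * u^2 + (1/(2 * l)) * u^4" for u :: real
  proof -
    have "0 \<le> (\<bar>u\<bar> * (\<bar>u\<bar> - l))^2" by simp
    also have "\<dots> = u^4 + l^2 * u^2 - 2 * l * \<bar>u\<bar>^3"
    proof -
      have "(w * (w - l))^2 = w^4 + l^2 * w^2 - 2 * l * w^3" for w :: real
        by (simp add: power_numeral_reduce algebra_simps)
      from this[of "\<bar>u\<bar>"] show ?thesis by simp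
    qed
    finally have "2 * l * \<bar>u\<bar>^3 \<le> u^4 + l^2 * u^2" by simp
    then show ?thesis using l(1) by (simp add: field_simps power2_eq_square)
  qed
  have i: "integrable P (\<lambda>x. (row k x (x m))^2)" "integrable P (\<lambda>x. (row k x (x m))^4)"
    by (intro P.bdm_integrable bdm_intros bdm_row)+
  have "(\<E> x. \<bar>row k x (x m)\<bar> ^ 3) \<le> (\<E> x. (l/2) * (row k x (x m))^2 + (1/(2 * l)) * (row k x (x m))^4)"
    by (intro integral_mono cube P.bdm_integrable bdm_intros bdm_row)
  also have "\<dots> = (l/2) * (\<E> x. (row k x (x m))^2) + (1/(2 * l)) * (\<E> x. (row k x (x m))^4)"
    using i by simp
  also have "\<dots> \<le> (l/2) * (l * l) + (1/(2 * l)) * (7 * ((l * l) * (l * l)))"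
  proof (intro add_mono mult_left_mono)
    have "(\<E> x. (row k x (x m))^2) \<le> real k * p^5" using assms by (intro row_second_moment)
    also have "\<dots> \<le> l * l" using assms np by (simp add: l mult_right_mono)
    finally show "(\<E> x. (row k x (x m))^2) \<le> l * l" .
    have "(\<E> x. (row k x (x m))^4) \<le> 4 * real k ^ 2 * p^10 + 3 * real k * p^9"
      using row_moments(2)[of "{1..k}" m] assms by (simp add: row_def)
    also have "\<dots> \<le> 4 * real n ^ 2 * p^10 + 3 * real n * p^9"
      using assms np by (intro add_mono mult_right_mono mult_left_mono power_mono) auto
    also have "real n * p^9 * 1 \<le> real n * p^9 * (real n * p)"
      using assms np by (intro mult_left_mono) auto
    then have "4 * real n ^ 2 * p^10 + 3 * real n * p^9 \<le> 7 * ((l * l) * (l * l))"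
      unfolding l by (simp add: numeral_eq_Suc mult_ac)
    finally show "(\<E> x. (row k x (x m))^4) \<le> 7 * ((l * l) * (l * l))" .
  qed (use l in auto)
  also have "\<dots> = 4 * (l * l * l)" using l(1) by (simp add: field_simps)
  finally show ?thesis unfolding l(2) by (simp add: l_def)
qed

section \<open>Conditional variances of the martingale differences\<close>

definition "cvar k x = (\<mu> y. (row k x y)^2)"

text \<open>The mean of a6 on the diagonal, which is also the mean square of a3: each point adds
  this much to the expected conditional variance.\<close>

definition "q = q6 - p^6"

lemma q_bounds: "\<bar>q\<bar> \<le> p^5"
proof -
  have "p^6 \<le> p^5" using p_power_le[of 5 6] by simp
  moreover have "0 \<le> p^6" using p_bounds by simp
  ultimately show ?thesis using q6_bounds unfolding q_def abs_le_iff by linarith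
qed

lemma cvar_eq: "cvar k x = (\<Sum>i\<in>{1..k}. \<Sum>j\<in>{1..k}. a6 (x i) (x j))"
proof -
  have "cvar k x = (\<mu> y. (\<Sum>i\<in>{1..k}. \<Sum>j\<in>{1..k}. a3 (x i) y * a3 y (x j)))"
    unfolding cvar_def row_def power2_eq_square sum_product by (simp add: a_sym(3))
  also have "\<dots> = (\<Sum>i\<in>{1..k}. \<Sum>j\<in>{1..k}. a6 (x i) (x j))"
    by (simp add: Bochner_Integration.integral_sum int_F bdm_intros integral_a_mult)
  finally show ?thesis .
qed

lemma bdm_cvar: "bdm P (cvar k)"
  unfolding cvar_eq[abs_def] by (intro bdm_intros)

text \<open>Off the diagonal the double sum of a6 is degenerate with second moment of order n^2
  p^11; on the diagonal it is a centred sum of n independent terms bounded by 2 p^5. Against n p^5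
  these are relative errors sqrt p and 1/sqrt n.\<close>

lemma cvar_concentration:
  assumes "k \<le> n"
  shows "(\<E> x. \<bar>cvar k x - real k * q\<bar>) \<le> 2 * p^5 * (real n * sqrt p + sqrt n)"
proof -
  define A where "A x = (\<Sum>v\<in>distinct_tuples k 2. a6 (x (v!0)) (x (v!1)))" for x
  \<comment> \<open>Writing the diagonal over tuples of length one lets the same degenerate bound
    apply to it.\<close>
  define B where "B x = (\<Sum>v\<in>distinct_tuples k 1. a6 (x (v!0)) (x (v!0)) - q)" for x :: "nat \<Rightarrow> 'b"
  have bdm: "bdm P A" "bdm P B" unfolding A_def B_def by (intro bdm_intros)+
  have dt0: "distinct_tuples k 0 = {[]}" by (auto simp: distinct_tuples_def)
  have split: "cvar k x - real k * q = A x + B x" for x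
  proof -
    have "A x = (\<Sum>i\<in>{1..k}. \<Sum>j\<in>{1..k} - {i}. a6 (x i) (x j))"
      unfolding A_def numeral_2_eq_2 sum_distinct_tuples_Suc dt0 by simp
    moreover have "B x = (\<Sum>i\<in>{1..k}. a6 (x i) (x i)) - real k * q"
      unfolding B_def One_nat_def sum_distinct_tuples_Suc dt0 by (simp add: sum_subtractf)
    moreover have "(\<Sum>j\<in>{1..k}. a6 (x i) (x j)) = (\<Sum>j\<in>{1..k} - {i}. a6 (x i) (x j)) + a6 (x i) (x i)" if "i \<in> {1..k}" for i
      using that by (simp add: sum.remove)
    ultimately show ?thesis by (simp add: cvar_eq sum.distrib)
  qed
  have "(\<E> x. (A x)^2) \<le> 4 * real k ^ 2 * p^11"
    unfolding A_def by (intro degenerate_pairs_second_moment bk_a integral_a E_a_power2 p_bounds zero_le_power)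
  also have "\<dots> \<le> 4 * real n ^ 2 * p^11"
    using assms p_bounds by (intro mult_right_mono mult_left_mono power_mono) auto
  also have "\<dots> = (2 * p^5 * (real n * sqrt p))^2"
    using p_bounds by (simp add: power_mult_distrib) (simp add: numeral_eq_Suc)
  finally have A2: "sqrt (\<E> x. (A x)^2) \<le> 2 * p^5 * (real n * sqrt p)"
    using p_bounds by (intro real_le_lsqrt) auto
  have "(\<E> x. (B x)^2) \<le> real (1 ^ 1) * real k ^ 1 * (4 * p^10)"
    unfolding B_def
  proof (rule degenerate_tuples_second_moment, goal_cases)
    case (1 v) show ?case by (intro bdm_intros)
  next
    case (3 v)
    have "(a6 u u - q)^2 \<le> 4 * p^10" for u
    proof -
      have "\<bar>a6 u u - q\<bar> \<le> 2 * p^5" using a_bound(2)[of u u] q_bounds by linarith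
      then have "(a6 u u - q)^2 \<le> (2 * p^5)^2" using p_bounds by (subst power2_le_iff_abs_le) auto
      then show ?thesis by (simp add: power_mult_distrib flip: power_mult)
    qed
    then show ?case by (intro P.integral_le_const P.bdm_integrable bdm_intros) auto
  next
    case (4 v j x y)
    then show ?case by (auto simp: distinct_tuples_def length_Suc_conv)
  next
    case (5 v j x)
    have "(\<mu> y. a6 y y - q) = 0"
      using integral_a6_diag by (simp add: int_F bdm_intros q_def)
    with 5 show ?case by (auto simp: distinct_tuples_def length_Suc_conv)
  qed (use p_bounds in simp)
  also have "\<dots> \<le> real n * (4 * p^10)"
    using assms p_bounds by (simp add: mult_right_mono)
  also have "\<dots> = (2 * p^5 * sqrt n)^2"
    by (simp add: power_mult_distrib flip: power_mult)
  finally have B2: "sqrt (\<E> x. (B x)^2) \<le> 2 * p^5 * sqrt n"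
    using p_bounds by (intro real_le_lsqrt) auto
  have "(\<E> x. \<bar>A x + B x\<bar>) \<le> (\<E> x. \<bar>A x\<bar> + \<bar>B x\<bar>)"
    by (intro integral_mono P.bdm_integrable bdm_intros bdm abs_triangle_ineq)
  also have "\<dots> = (\<E> x. \<bar>A x\<bar>) + (\<E> x. \<bar>B x\<bar>)"
    by (intro Bochner_Integration.integral_add P.bdm_integrable bdm_intros bdm)
  also have "\<dots> \<le> 2 * p^5 * (real n * sqrt p) + 2 * p^5 * sqrt n"
    using P.abs_le_sqrt_second_moment[OF bdm(1)] P.abs_le_sqrt_second_moment[OF bdm(2)] A2 B2 by linarith
  finally show ?thesis by (simp add: split algebra_simps)
qed

text \<open>Conditionally on the first \<open>k\<close> points the new row sum is centred with variance \<open>cvar\<close>,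
  so the characteristic function picks up the factor \<open>1 - \<tau>\<^sup>2 cvar / 2\<close> up to a third moment.\<close>

lemma char_step:
  "cmod ((\<E> x. iexp (\<tau> * Q (Suc k) x)) - (1 - \<tau>\<^sup>2 * (real k * q) / 2) * (\<E> x. iexp (\<tau> * Q k x)))
    \<le> \<tau>^2 / 2 * (\<E> x. \<bar>cvar k x - real k * q\<bar>) + \<bar>\<tau>\<bar>^3 / 6 * (\<E> x. \<bar>row k x (x (Suc k))\<bar> ^ 3)"
proof -
  let ?e = "\<lambda>x. iexp (\<tau> * Q k x)" and ?I = "\<lambda>x. \<integral>y. iexp (\<tau> * row k x y) \<partial>F"
    and ?c = "\<lambda>x. complex_of_real (1 - \<tau>\<^sup>2 * cvar k x / 2)"
    and ?d = "\<lambda>x. complex_of_real (- (\<tau>^2 / 2) * (cvar k x - real k * q))"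
    and ?\<Phi> = "\<integral>x. iexp (\<tau> * Q (Suc k) x) \<partial>P" and ?m = "1 - \<tau>\<^sup>2 * (real k * q) / 2"
  have bdme: "bdm P ?e" by (intro bdm_intros bdm_Q)
  have bdmi: "bdm P (\<lambda>x. \<integral>y. iexp (\<tau> * row k x y) \<partial>F)"
  proof -
    have "bdm P (\<lambda>x. iexp (\<tau> * row k x (x (Suc k))))" by (intro bdm_intros bdm_row)
    from bdm_resample_integral[OF this, of "Suc k"] show ?thesis by (simp add: row_upd)
  qed
  have bdm3: "bdm P (\<lambda>x. \<integral>y. \<bar>row k x y\<bar> ^ 3 \<partial>F)"
  proof -
    have "bdm P (\<lambda>x. \<bar>row k x (x (Suc k))\<bar> ^ 3)" by (intro bdm_intros bdm_row)
    from bdm_resample_integral[OF this, of "Suc k"] show ?thesis by (simp add: row_upd)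
  qed
  have "?\<Phi> = (\<E> x. ?e x * iexp (\<tau> * row k x (x (Suc k))))"
    by (simp add: Q_def algebra_simps flip: exp_add)
  \<comment> \<open>\<open>Q k\<close> and the coefficients of the row do not involve coordinate
    \<open>Suc k\<close>, so redrawing it amounts to conditioning on the past.\<close>
  also have "\<dots> = (\<E> x. (\<mu> y. ?e x * iexp (\<tau> * row k x y)))"
  proof -
    have "bdm P (\<lambda>x. ?e x * iexp (\<tau> * row k x (x (Suc k))))" by (intro bdm_intros bdm_Q bdm_row)
    from resample[OF this, of "Suc k"] show ?thesis by (simp add: row_upd Q_upd)
  qed
  also have "\<dots> = (\<E> x. ?e x * ?I x)"
    by simp
  finally have 1: "?\<Phi> = (\<E> x. ?e x * ?I x)" .
  have inner: "cmod (?I x - (1 - \<tau>\<^sup>2 * cvar k x / 2)) \<le> \<bar>\<tau>\<bar>^3 / 6 * (\<mu> y. \<bar>row k x y\<bar> ^ 3)" for x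
  proof -
    let ?f = "\<lambda>y. 1 + \<i> * of_real (\<tau> * row k x y) - of_real (\<tau>^2 * (row k x y)^2 / 2)"
    have i: "integrable F (\<lambda>y. complex_of_real (row k x y))" "integrable F (\<lambda>y. complex_of_real ((row k x y)^2))"
      by (intro F.bdm_integrable bdm_intros bdm_row)+
    have z: "(\<mu> y. row k x y) = 0"
      unfolding row_def by (simp add: Bochner_Integration.integral_sum int_F bdm_intros)
    have "(\<mu> y. ?f y) = 1 + \<i> * of_real \<tau> * of_real (\<mu> y. row k x y) - of_real (\<tau>^2 / 2) * of_real (cvar k x)"
    proof -
      have "?f = (\<lambda>y. 1 + (\<i> * of_real \<tau>) * of_real (row k x y) - of_real (\<tau>^2 / 2) * of_real ((row k x y)^2))"
        by (auto simp: fun_eq_iff)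
      then show ?thesis using i by (simp add: cvar_def del: of_real_mult of_real_power of_real_divide)
    qed
    then have f: "(\<mu> y. ?f y) = 1 - \<tau>\<^sup>2 * cvar k x / 2" using z by simp
    have bf: "bdm F ?f"
    proof -
      have "bdm F (\<lambda>y. 1 + \<i> * of_real (\<tau> * row k x y) - of_real ((\<tau>^2/2) * (row k x y)^2))"
        by (intro bdm_intros bdm_row)
      then show ?thesis by simp
    qed
    have be: "bdm F (\<lambda>y. iexp (\<tau> * row k x y))" by (intro bdm_intros bdm_row)
    have "cmod (?I x - (\<mu> y. ?f y)) = cmod (\<mu> y. iexp (\<tau> * row k x y) - ?f y)"
      by (subst Bochner_Integration.integral_diff) (intro F.bdm_integrable be bf refl)+
    also have "\<dots> \<le> (\<mu> y. cmod (iexp (\<tau> * row k x y) - ?f y))"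
      by (rule integral_norm_bound)
    also have "\<dots> \<le> (\<mu> y. \<bar>\<tau>\<bar>^3 / 6 * \<bar>row k x y\<bar> ^ 3)"
    proof (intro integral_mono F.bdm_integrable bdm_intros bdm_row be bf)
      fix y
      have "cmod (iexp u - (1 + \<i> * of_real u - of_real (u^2 / 2))) \<le> \<bar>u\<bar>^3 / 6" for u :: real
      proof -
        have "(\<Sum>j\<le>2. (\<i> * of_real u) ^ j / fact j) = 1 + \<i> * complex_of_real u - of_real (u^2 / 2)"
          by (simp add: numeral_eq_Suc power_mult_distrib)
        then show ?thesis using iexp_approx1[of u 2] by (simp add: fact_numeral)
      qed
      from this[of "\<tau> * row k x y"]
      show "cmod (iexp (\<tau> * row k x y) - ?f y) \<le> \<bar>\<tau>\<bar>^3 / 6 * \<bar>row k x y\<bar> ^ 3"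
        by (simp add: abs_mult power_mult_distrib)
    qed
    finally show ?thesis using f by simp
  qed
  have bc: "bdm P (\<lambda>x. ?c x)"
  proof -
    have "bdm P (\<lambda>x. complex_of_real (1 - (\<tau>^2 / 2) * cvar k x))" by (intro bdm_intros bdm_cvar)
    then show ?thesis by simp
  qed
  \<comment> \<open>Two errors are kept apart: the Taylor remainder relative to the actual
    conditional variance, and the deviation of that variance from its mean k * q.\<close>
  have diff: "?\<Phi> - ?m * (\<E> x. ?e x) =
    (\<E> x. ?e x * (?I x - ?c x))
     + (\<E> x. ?e x * ?d x)"
  proof -
    have "(\<E> x. ?e x * (?I x - ?c x))
     + (\<E> x. ?e x * ?d x)
     = (\<E> x. ?e x * ?I x - ?m * ?e x)"
    proof (subst Bochner_Integration.integral_add[symmetric])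
      show "integrable P (\<lambda>x. ?e x * (?I x - ?c x))"
        by (intro P.bdm_integrable bdm_mult bdm_diff bdme bdmi bc)
      show "integrable P (\<lambda>x. ?e x * ?d x)"
        by (intro P.bdm_integrable bdm_intros bdm_cvar bdm_Q)
    qed (intro Bochner_Integration.integral_cong refl, simp add: algebra_simps)
    also have "\<dots> = (\<E> x. ?e x * ?I x) - ?m * (\<E> x. ?e x)"
    proof (subst Bochner_Integration.integral_diff)
      show "integrable P (\<lambda>x. ?e x * ?I x)"
        by (intro P.bdm_integrable bdm_mult bdme bdmi)
      show "integrable P (\<lambda>x. ?m * ?e x)"
        by (intro P.bdm_integrable bdm_mult bdm_const bdme)
    qed (simp only: integral_mult_right_zero)
    finally show ?thesis using 1 by simp
  qed
  have "cmod (\<E> x. ?e x * (?I x - ?c x))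
    \<le> (\<E> x. cmod (?e x * (?I x - ?c x)))"
    by (rule integral_norm_bound)
  also have "\<dots> \<le> (\<E> x. \<bar>\<tau>\<bar>^3 / 6 * (\<mu> y. \<bar>row k x y\<bar> ^ 3))"
  proof (intro integral_mono P.bdm_integrable)
    show "bdm P (\<lambda>x. cmod (?e x * (?I x - ?c x)))"
      by (intro bdm_norm bdm_mult bdm_diff bdme bdmi bc)
    show "bdm P (\<lambda>x. \<bar>\<tau>\<bar>^3 / 6 * (\<mu> y. \<bar>row k x y\<bar> ^ 3))"
      by (intro bdm_mult bdm_const bdm3)
  qed (use inner in \<open>simp add: norm_mult\<close>)
  also have "\<dots> = \<bar>\<tau>\<bar>^3 / 6 * (\<E> x. \<bar>row k x (x (Suc k))\<bar> ^ 3)"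
  proof -
    have "bdm P (\<lambda>x. \<bar>row k x (x (Suc k))\<bar> ^ 3)" by (intro bdm_intros bdm_row)
    from resample[OF this, of "Suc k"] show ?thesis by (simp add: row_upd)
  qed
  finally have a: "cmod (\<E> x. ?e x * (?I x - ?c x))
    \<le> \<bar>\<tau>\<bar>^3 / 6 * (\<E> x. \<bar>row k x (x (Suc k))\<bar> ^ 3)" .
  have "cmod (\<E> x. ?e x * ?d x)
    \<le> (\<E> x. cmod (?e x * ?d x))"
    by (rule integral_norm_bound)
  also have "\<dots> = (\<E> x. \<tau>^2 / 2 * \<bar>cvar k x - real k * q\<bar>)"
    by (simp only: norm_mult norm_exp_i_times norm_of_real abs_mult abs_minus) simp
  finally have b: "cmod (\<E> x. ?e x * ?d x)
    \<le> \<tau>^2 / 2 * (\<E> x. \<bar>cvar k x - real k * q\<bar>)" by simp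
  show ?thesis unfolding diff using norm_triangle_mono[OF a b] by (simp add: add.commute)
qed

text \<open>Squeezes exp (- u) between 1 - u and 1 / (1 + u); the product used for the last
  comparison equals 1 + u^3.\<close>

lemma exp_minus_approx:
  assumes "0 \<le> (u::real)" shows "\<bar>(1 - u) - exp (- u)\<bar> \<le> u^2"
proof -
  have 1: "1 - u \<le> exp (- u)" using exp_ge_add_one_self[of "-u"] by simp
  have "exp (- u) \<le> 1 / (1 + u)"
    using exp_ge_add_one_self[of u] assms by (simp add: exp_minus field_simps)
  also have "\<dots> \<le> 1 - u + u^2"
  proof -
    have "1 \<le> (1 - u + u^2) * (1 + u)"
      using assms by (simp add: algebra_simps power2_eq_square)
    then show ?thesis using assms by (simp add: divide_le_eq)
  qed
  finally show ?thesis using 1 by (simp add: abs_le_iff)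
qed

text \<open>Passing from k to k + 1 multiplies the previous error by exp (- w) \<le> 1, so the
  errors of the n steps merely add up; q \<ge> 0 is what makes this a contraction. The bound
  \<theta> measures \<tau> against the inverse of n p^(5/2), the size of Q.\<close>

theorem char_Q:
  assumes np: "real n * p \<ge> 1" and q: "q \<ge> 0" and \<theta>: "\<bar>\<tau>\<bar> * (real n * sqrt p ^ 5) \<le> \<theta>"
  shows "cmod ((\<E> x. iexp (\<tau> * Q n x)) - exp (- \<tau>\<^sup>2 * q * (real n * (real n - 1)) / 4))
    \<le> \<theta>^2 * sqrt p + (\<theta>^2 + \<theta>^3 + \<theta>^4) / sqrt n"
proof -
  note pos = np_pos[OF np]
  then have n1: "real n \<ge> 1" by simp
  define s where "s = sqrt (real n)"
  define r where "r = sqrt p"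
  define u where "u = \<bar>\<tau>\<bar>"
  have s: "s > 0" "real n = s^2" "s \<ge> 1" and r: "r > 0" "p = r^2" using pos n1 by (auto simp: s_def r_def)
  have u0: "u \<ge> 0" "\<tau>^2 = u^2" by (auto simp: u_def)
  have ub: "u * (s^2 * r^5) \<le> \<theta>" using \<theta> by (simp add: u_def s(2)[symmetric] r_def)
  have \<theta>0: "0 \<le> \<theta>" by (rule order_trans[OF _ ub]) (use u0 s r in simp)
  \<comment> \<open>The three summands pay for the fluctuation of the conditional variance, the
    third moment of the row, and the replacement of 1 - w by exp (- w).\<close>
  define e where "e = u^2 / 2 * (2 * p^5 * (real n * r + s)) + u^3 / 6 * (4 * (real n * p^5 * (s * r^5))) + (u^2 * (real n * p^5))^2 / 4"
  have e0: "e \<ge> 0" using u0 s r pos by (simp add: e_def)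
  have ind: "cmod ((\<E> x. iexp (\<tau> * Q k x)) - exp (- \<tau>\<^sup>2 * q * (real k * (real k - 1)) / 4)) \<le> real k * e" if "k \<le> n" for k
    using that
  proof (induction k)
    case 0
    show ?case using P.prob_space by (simp add: Q_def)
  next
    case (Suc k)
    define w where "w = \<tau>^2 * (real k * q) / 2"
    have w: "0 \<le> w" using q by (simp add: w_def)
    let ?\<phi> = "\<lambda>k. \<integral>x. iexp (\<tau> * Q k x) \<partial>P"
    let ?E = "\<lambda>k. exp (- \<tau>\<^sup>2 * q * (real k * (real k - 1)) / 4)"
    have E: "?E (Suc k) = exp (- w) * ?E k"
      by (simp add: w_def field_simps flip: exp_add)
    have 1: "cmod (?\<phi> (Suc k) - complex_of_real (1 - w) * ?\<phi> k) \<le> u^2 / 2 * (2 * p^5 * (real n * r + s)) + u^3 / 6 * (4 * (real n * p^5 * (s * r^5)))"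
    proof -
      have "cmod (?\<phi> (Suc k) - complex_of_real (1 - w) * ?\<phi> k) \<le>
        \<tau>^2 / 2 * (\<E> x. \<bar>cvar k x - real k * q\<bar>) + \<bar>\<tau>\<bar>^3 / 6 * (\<E> x. \<bar>row k x (x (Suc k))\<bar> ^ 3)"
        using char_step[of \<tau> k] by (simp add: w_def)
      also have "\<dots> \<le> \<tau>^2 / 2 * (2 * p^5 * (real n * sqrt p + sqrt n)) + \<bar>\<tau>\<bar>^3 / 6 * (4 * (real n * p^5 * (sqrt n * sqrt p ^ 5)))"
        using Suc.prems np by (intro add_mono mult_left_mono cvar_concentration row_third_moment) auto
      finally show ?thesis by (simp add: u_def s_def r_def)
    qed
    have phi1: "cmod (?\<phi> k) \<le> 1"
    proof -
      have "cmod (?\<phi> k) \<le> (\<E> x. cmod (iexp (\<tau> * Q k x)))" by (rule integral_norm_bound)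
      then show ?thesis using P.prob_space by simp
    qed
    have 2: "cmod (complex_of_real ((1 - w) - exp (- w)) * ?\<phi> k) \<le> (u^2 * (real n * p^5))^2 / 4"
    proof -
      have "cmod (complex_of_real ((1 - w) - exp (- w)) * ?\<phi> k) = \<bar>(1 - w) - exp (- w)\<bar> * cmod (?\<phi> k)"
        by (simp only: norm_mult norm_of_real)
      also have "\<dots> \<le> w^2 * 1" using exp_minus_approx[OF w] phi1 by (intro mult_mono) auto
      also have "w^2 \<le> ((u^2 * (real n * p^5)) / 2)^2"
      proof (rule power_mono[OF _ w])
        have "real k * q \<le> real n * p^5"
          using Suc.prems q q_bounds by (intro mult_mono) auto
        then show "w \<le> (u^2 * (real n * p^5)) / 2"
          unfolding w_def u0(2) by (intro divide_right_mono mult_left_mono) auto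
      qed
      finally show ?thesis by (simp add: power_divide)
    qed
    have 3: "cmod (exp (- complex_of_real w) * (?\<phi> k - ?E k)) \<le> real k * e"
    proof -
      have "cmod (exp (- complex_of_real w)) \<le> 1" using w by (simp add: norm_exp_eq_Re)
      then have "cmod (exp (- complex_of_real w) * (?\<phi> k - ?E k)) \<le> 1 * (real k * e)"
        unfolding norm_mult using Suc e0 by (intro mult_mono) auto
      then show ?thesis by simp
    qed
    have "?\<phi> (Suc k) - ?E (Suc k) = (?\<phi> (Suc k) - complex_of_real (1 - w) * ?\<phi> k) +
      complex_of_real ((1 - w) - exp (- w)) * ?\<phi> k + exp (- complex_of_real w) * (?\<phi> k - ?E k)"
      unfolding E by (simp add: algebra_simps exp_of_real[symmetric])
    then have "cmod (?\<phi> (Suc k) - ?E (Suc k)) \<le> e + real k * e"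
      using norm_triangle_mono[OF norm_triangle_mono[OF 1 2] 3] by (simp only: e_def)
    also have "\<dots> = real (Suc k) * e" by (simp add: algebra_simps)
    finally show ?case .
  qed
  have "real n * e \<le> \<theta>^2 * r + (\<theta>^2 + \<theta>^3 + \<theta>^4) / s"
  proof -
    define z where "z = u * (s^2 * r^5)"
    have z: "0 \<le> z" "z \<le> \<theta>" using ub u0 s r by (auto simp: z_def)
    have "real n * e = z^2 * r + z^2 / s + (2/3) * (z^3 / s) + z^4 / (4 * s^2)"
      unfolding e_def s(2) r(2) z_def using s(1) by (simp add: field_simps power_numeral_reduce)
    also have "\<dots> \<le> \<theta>^2 * r + \<theta>^2 / s + (\<theta>^3 / s) + \<theta>^4 / s"
    proof (intro add_mono mult_right_mono divide_right_mono power_mono z)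
      have "z^3 \<le> \<theta>^3" using z by (intro power_mono) auto
      then have "2/3 * z^3 \<le> \<theta>^3" using zero_le_power[OF z(1), of 3] by linarith
      then show "2/3 * (z^3 / s) \<le> \<theta>^3 / s" using s(1) by (simp add: field_simps)
      have "z^4 \<le> \<theta>^4" using z by (intro power_mono) auto
      moreover have "s \<le> 4 * s^2" using s(3) by (simp add: power2_eq_square)
      ultimately show "z^4 / (4 * s^2) \<le> \<theta>^4 / s" using s z by (intro frac_le) auto
    qed (use s r in auto)
    finally show ?thesis by (simp add: add_divide_distrib)
  qed
  with ind[of n] show ?thesis by (simp add: s_def r_def)
qed

end

section \<open>Concentration of the 6-cycle count\<close>

lemma sum_distinct_tuples_1: "(\<Sum>v\<in>distinct_tuples n (Suc 0). f v) = (\<Sum>i\<in>{1..n}. f [i])"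
proof -
  have "distinct_tuples n 0 = {[]}" by (auto simp: distinct_tuples_def)
  then show ?thesis unfolding sum_distinct_tuples_Suc by simp
qed

context regular_kernel
begin

definition cyc :: "nat list \<Rightarrow> (nat \<Rightarrow> 'b) \<Rightarrow> real" where
  "cyc v x = W (x (v!0)) (x (v!1)) * W (x (v!1)) (x (v!2)) * W (x (v!2)) (x (v!3)) *
     W (x (v!3)) (x (v!4)) * W (x (v!4)) (x (v!5)) * W (x (v!5)) (x (v!0))"

definition "C6 n x = (\<Sum>v\<in>distinct_tuples n 6. cyc v x)"

lemma bdm_cyc: "bdm P (cyc v)"
  unfolding cyc_def by (intro bdm_intros)

lemma bdm_C6: "bdm P (C6 n)"
  unfolding C6_def by (intro bdm_intros bdm_cyc)

text \<open>The neighbours i and k of the integrated vertex may coincide; this is how a cycle closes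
  into a diagonal value.\<close>

lemma E_kcomp:
  assumes "bk K" "bk L" "bdm P Y" "\<And>x y. Y (x(j := y)) = Y x" "i \<noteq> j" "k \<noteq> j"
  shows "(\<E> x. Y x * (K (x i) (x j) * L (x j) (x k))) = (\<E> x. Y x * kcomp K L (x i) (x k))"
  using resample[of "\<lambda>x. Y x * (K (x i) (x j) * L (x j) (x k))" j] assms
  by (simp add: kcomp_def bdm_mult bk_sections)

lemma cyc_bounds: "0 \<le> cyc v x" "cyc v x \<le> 1"
  using W_bounds unfolding cyc_def by (auto intro!: mult_nonneg_nonneg mult_le_one)

lemma cyc_upd: "length v = 6 \<Longrightarrow> j \<notin> set v \<Longrightarrow> cyc v (x(j := y)) = cyc v x"
proof -
  assume a: "length v = 6" "j \<notin> set v"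
  then have "v ! i \<noteq> j" if "i < 6" for i using that by (metis nth_mem)
  then show ?thesis by (simp add: cyc_def)
qed

text \<open>Integrating out the vertices 1, 2, 4, 5, 3 in this order turns the cycle into two 3-paths
  with common end points, and then into a diagonal value of \<open>w6\<close>.\<close>

lemma E_cyc:
  assumes v: "length v = 6" "distinct v" and Z: "bdm P Z" "\<And>j x y. j \<in> set v \<Longrightarrow> Z (x(j := y)) = Z x"
  shows "(\<E> x. Z x * cyc v x) = q6 * (\<E> x. Z x)"
proof -
  obtain a b c d e f where vv: "v = [a, b, c, d, e, f]"
    using v(1) by (auto simp: numeral_eq_Suc length_Suc_conv)
  have Zu: "Z (x(a := y)) = Z x" "Z (x(b := y)) = Z x" "Z (x(c := y)) = Z x" "Z (x(d := y)) = Z x"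
    "Z (x(e := y)) = Z x" "Z (x(f := y)) = Z x" for x y
    using Z(2) by (auto simp: vv)
  have ne: "a \<noteq> b" "a \<noteq> c" "a \<noteq> d" "a \<noteq> e" "a \<noteq> f" "b \<noteq> c" "b \<noteq> d" "b \<noteq> e" "b \<noteq> f"
    "c \<noteq> d" "c \<noteq> e" "c \<noteq> f" "d \<noteq> e" "d \<noteq> f" "e \<noteq> f"
    using v(2) by (auto simp: vv)
  note ne' = ne ne[symmetric]
  \<comment> \<open>Each of these products collects the factors that do not contain the vertex to be
    integrated next.\<close>
  define Z1 where "Z1 x = Z x * W (x c) (x d) * W (x d) (x e) * W (x e) (x f) * W (x f) (x a)" for x
  define Z2 where "Z2 x = Z x * W (x d) (x e) * W (x e) (x f) * W (x f) (x a)" for x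
  define Z4 where "Z4 x = Z x * w3 (x a) (x d) * W (x f) (x a)" for x
  define Z5 where "Z5 x = Z x * w3 (x a) (x d)" for x
  have bdm: "bdm P Z1" "bdm P Z2" "bdm P Z4" "bdm P Z5"
    unfolding Z1_def Z2_def Z4_def Z5_def by (intro bdm_intros Z(1))+
  have upd: "Z1 (x(b := y)) = Z1 x" "Z2 (x(c := y)) = Z2 x" "Z4 (x(e := y)) = Z4 x" "Z5 (x(f := y)) = Z5 x" for x y
    using ne' by (simp_all add: Z1_def Z2_def Z4_def Z5_def Zu)
  have "(\<E> x. Z x * cyc v x) = (\<E> x. Z1 x * (W (x a) (x b) * W (x b) (x c)))"
    by (simp add: vv cyc_def Z1_def mult_ac)
  also have "\<dots> = (\<E> x. Z1 x * w2 (x a) (x c))"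
    unfolding w2_def by (rule E_kcomp) (use ne' in \<open>simp_all add: upd bdm bk_W\<close>)
  also have "\<dots> = (\<E> x. Z2 x * (w2 (x a) (x c) * W (x c) (x d)))"
    by (simp add: Z1_def Z2_def mult_ac)
  also have "\<dots> = (\<E> x. Z2 x * w3 (x a) (x d))"
    unfolding w3_alt by (rule E_kcomp) (use ne' in \<open>simp_all add: upd bdm bk_W bk_w2\<close>)
  also have "\<dots> = (\<E> x. Z4 x * (W (x d) (x e) * W (x e) (x f)))"
    by (simp add: Z2_def Z4_def mult_ac)
  also have "\<dots> = (\<E> x. Z4 x * w2 (x d) (x f))"
    unfolding w2_def by (rule E_kcomp) (use ne' in \<open>simp_all add: upd bdm bk_W\<close>)
  also have "\<dots> = (\<E> x. Z5 x * (w2 (x d) (x f) * W (x f) (x a)))"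
    by (simp add: Z4_def Z5_def mult_ac)
  also have "\<dots> = (\<E> x. Z5 x * w3 (x d) (x a))"
    unfolding w3_alt by (rule E_kcomp) (use ne' in \<open>simp_all add: upd bdm bk_W bk_w2\<close>)
  also have "\<dots> = (\<E> x. Z x * (w3 (x a) (x d) * w3 (x d) (x a)))"
    by (simp add: Z5_def mult_ac)
  also have "\<dots> = (\<E> x. Z x * w6 (x a) (x a))"
    unfolding w6_def by (rule E_kcomp) (use ne' in \<open>simp_all add: Zu Z(1) bk_w3\<close>)
  also have "\<dots> = (\<E> x. (\<mu> y. Z x * w6 y y))"
    using resample[of "\<lambda>x. Z x * w6 (x a) (x a)" a] by (simp add: Zu Z(1) bdm_intros)
  finally show ?thesis by (simp add: q6_def)
qed

text \<open>Revealing the path vertex by vertex: a new vertex either is one of the \<open>card D\<close> vertices on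
  which \<open>Z\<close> depends, or it is fresh and costs a factor \<open>p\<close>.\<close>

lemma path_growth:
  fixes Z :: "(nat \<Rightarrow> 'b) \<Rightarrow> real"
  assumes D: "finite D" and Z: "bdm P Z" "\<And>x. 0 \<le> Z x" "\<And>j x y. j \<notin> D \<Longrightarrow> Z (x(j := y)) = Z x"
  shows "(\<Sum>v\<in>distinct_tuples n (Suc t). if v!0 \<in> D then \<integral>x. Z x * (\<Prod>i<t. W (x (v!i)) (x (v!(Suc i)))) \<partial>P else 0)
    \<le> real (card D) * (real (card D) + real n * p) ^ t * (\<E> x. Z x)"
proof (induction t)
  case 0
  have E0: "0 \<le> (\<E> x. Z x)" using Z(2) by simp
  have "(\<Sum>v\<in>distinct_tuples n (Suc 0). if v!0 \<in> D then \<integral>x. Z x \<partial>P else 0) = real (card ({1..n} \<inter> D)) * (\<E> x. Z x)"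
    unfolding sum_distinct_tuples_1 by (simp add: sum.If_cases)
  also have "\<dots> \<le> real (card D) * (\<E> x. Z x)"
    using D E0 by (intro mult_right_mono) (auto intro: card_mono)
  finally show ?case by (simp cong: if_cong)
next
  case (Suc t)
  let ?p = "\<lambda>t v x. \<Prod>i<t. W (x (v!i)) (x (v!(Suc i)))"
  let ?J = "\<lambda>u. \<Sum>j\<in>{1..n} - set u. if (u @ [j])!0 \<in> D then \<integral>x. Z x * ?p (Suc t) (u @ [j]) x \<partial>P else 0"
  have p0: "0 \<le> ?p t v x" for t v and x :: "nat \<Rightarrow> 'b" using W_bounds by (intro prod_nonneg) auto
  have "(\<Sum>v\<in>distinct_tuples n (Suc (Suc t)). if v!0 \<in> D then \<integral>x. Z x * ?p (Suc t) v x \<partial>P else 0) =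
    (\<Sum>u\<in>distinct_tuples n (Suc t). ?J u)"
    by (rule sum_distinct_tuples_Suc)
  also have "\<dots> \<le> (\<Sum>u\<in>distinct_tuples n (Suc t). (real (card D) + real n * p) * (if u!0 \<in> D then \<integral>x. Z x * ?p t u x \<partial>P else 0))"
  proof (rule sum_mono)
    fix u assume u: "u \<in> distinct_tuples n (Suc t)"
    then have lu: "length u = Suc t" "distinct u" by (auto simp: distinct_tuples_def)
    let ?I = "\<integral>x. Z x * ?p t u x \<partial>P"
    have bY: "bdm P (\<lambda>x. Z x * ?p t u x)" by (intro bdm_intros Z)
    have I0: "0 \<le> ?I" using Z(2) p0 by (intro Bochner_Integration.integral_nonneg) auto
    show "?J u
      \<le> (real (card D) + real n * p) * (if u!0 \<in> D then ?I else 0)"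
    proof (cases "u!0 \<in> D")
      case False
      then show ?thesis using lu by (simp add: nth_append)
    next
      case True
      have pe: "?p (Suc t) (u @ [j]) x = ?p t u x * W (x (u!t)) (x j)" for j and x :: "nat \<Rightarrow> 'b"
        using lu by (simp add: nth_append)
      have *: "(\<E> x. Z x * ?p (Suc t) (u @ [j]) x) \<le> (if j \<in> D then ?I else 0) + p * ?I" if j: "j \<in> {1..n} - set u" for j
      proof (cases "j \<in> D")
        case True
        have "(\<E> x. Z x * ?p (Suc t) (u @ [j]) x) \<le> ?I"
          unfolding pe
        proof (intro integral_mono P.bdm_integrable bdm_intros Z)
          fix x show "Z x * (?p t u x * W (x (u!t)) (x j)) \<le> Z x * ?p t u x"
            using Z(2) p0[of x u t] W_bounds by (intro mult_left_mono mult_right_le_one_le) auto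
        qed
        with mult_nonneg_nonneg[OF p_bounds(1) I0] show ?thesis unfolding if_P[OF True] by linarith
      next
        case False
        have "(\<E> x. Z x * ?p (Suc t) (u @ [j]) x) = (\<E> x. (Z x * ?p t u x) * W (x (u!t)) (x j))"
          unfolding pe by (simp add: mult.assoc)
        also have "\<dots> \<le> p * ?I"
        proof (rule E_peel[where j=j])
          have uj: "u ! i \<noteq> j" if "i < Suc t" for i using that j lu by (metis Diff_iff nth_mem)
          show "Z (x(j := y)) * ?p t u (x(j := y)) = Z x * ?p t u x" for x y
            using uj by (simp add: Z(3)[OF False])
          show "(\<mu> y. W ((x(j := y)) (u!t)) ((x(j := y)) j)) \<le> p" for x
            using uj[of t] W_mass by simp
        qed (use Z(2) p0 in \<open>auto intro!: bY bdm_kernels\<close>)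
        finally show ?thesis using False by simp
      qed
      have "?J u
        \<le> (\<Sum>j\<in>{1..n} - set u. (if j \<in> D then ?I else 0) + p * ?I)"
        using True lu * by (intro sum_mono) (simp add: nth_append)
      also have "\<dots> \<le> (\<Sum>j\<in>{1..n}. (if j \<in> D then ?I else 0) + p * ?I)"
        using I0 p_bounds by (intro sum_mono2) auto
      also have "\<dots> = real (card ({1..n} \<inter> D)) * ?I + real n * p * ?I"
        by (simp add: sum.distrib sum.If_cases mult.assoc)
      also have "\<dots> \<le> real (card D) * ?I + real n * p * ?I"
        using D I0 by (intro add_right_mono mult_right_mono) (auto intro: card_mono)
      finally show ?thesis using True by (simp add: algebra_simps)
    qed
  qed
  also have "\<dots> = (real (card D) + real n * p) * (\<Sum>u\<in>distinct_tuples n (Suc t). if u!0 \<in> D then \<integral>x. Z x * ?p t u x \<partial>P else 0)"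
    by (simp only: sum_distrib_left)
  also have "\<dots> \<le> (real (card D) + real n * p) * (real (card D) * (real (card D) + real n * p) ^ t * (\<E> x. Z x))"
    using Suc p_bounds by (intro mult_left_mono) auto
  finally show ?case by (simp add: mult_ac)
qed

text \<open>A cycle that meets v is rotated until a shared vertex comes first and then loses its
  closing edge, so that it becomes a path grown out of \<open>set v\<close>. In 36 = 6 * 6 one
  factor counts rotations and the other the vertices of v.\<close>

lemma cyc_pairs_sum:
  assumes v: "v \<in> distinct_tuples n 6"
  shows "(\<Sum>w\<in>distinct_tuples n 6. if set v \<inter> set w \<noteq> {} then \<integral>x. cyc v x * cyc w x \<partial>P else 0)
    \<le> 36 * (6 + real n * p) ^ 5 * q6"
proof -
  have lv: "length v = 6" "distinct v" using v by (auto simp: distinct_tuples_def)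
  have cv: "card (set v) = 6" using lv by (simp add: distinct_card)
  let ?I = "\<lambda>w. \<integral>x. cyc v x * cyc w x \<partial>P"
  have I0: "0 \<le> ?I w" for w using cyc_bounds by (intro Bochner_Integration.integral_nonneg) auto
  have Ev: "(\<E> x. cyc v x) = q6"
    using E_cyc[OF lv, of "\<lambda>_. 1"] P.prob_space by (simp add: bdm_intros)
  define f where "f w = (if w!0 \<in> set v then ?I w else 0)" for w
  have rot: "(\<Sum>w\<in>distinct_tuples n 6. if w!s \<in> set v then ?I w else 0) = (\<Sum>w\<in>distinct_tuples n 6. f w)" if "s < 6" for s
  proof -
    \<comment> \<open>Reading w cyclically from position s leaves the product over the cycle
      unchanged, so each position can serve as the first.\<close>
    define qs where "qs = map (\<lambda>i. (s + i) mod 6) [0..<6]"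
    have six: "[0..<6] = [0, 1, 2, 3, 4, 5]" by (simp add: upt_rec)
    from \<open>s < 6\<close> consider "s = 0" | "s = 1" | "s = 2" | "s = 3" | "s = 4" | "s = 5" by linarith
    then have "distinct qs \<and> set qs = {..<6} \<and> (\<forall>w. f (map ((!) w) qs) = (if w!s \<in> set v then ?I w else 0))"
      by cases (auto simp: qs_def six f_def cyc_def mult_ac numeral_2_eq_2[symmetric] simp del: One_nat_def)
    then show ?thesis using sum_distinct_tuples_permute[of qs 6 f n] by simp
  qed
  have "(\<Sum>w\<in>distinct_tuples n 6. f w) \<le>
    (\<Sum>w\<in>distinct_tuples n (Suc 5). if w!0 \<in> set v then \<integral>x. cyc v x * (\<Prod>i<5. W (x (w!i)) (x (w!(Suc i)))) \<partial>P else 0)"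
  proof -
    have "?I w \<le> (\<E> x. cyc v x * (\<Prod>i<5. W (x (w!i)) (x (w!(Suc i)))))" for w
    proof (intro integral_mono P.bdm_integrable bdm_intros bdm_cyc)
      fix x
      have "cyc w x = (\<Prod>i<5. W (x (w!i)) (x (w!(Suc i)))) * W (x (w!5)) (x (w!0))"
        by (simp add: cyc_def numeral_eq_Suc)
      also have "\<dots> \<le> (\<Prod>i<5. W (x (w!i)) (x (w!(Suc i))))"
        using W_bounds by (intro mult_right_le_one_le prod_nonneg) auto
      finally show "cyc v x * cyc w x \<le> cyc v x * (\<Prod>i<5. W (x (w!i)) (x (w!(Suc i))))"
        using cyc_bounds by (intro mult_left_mono) auto
    qed
    then show ?thesis unfolding f_def by (auto intro!: sum_mono)
  qed
  also have "\<dots> \<le> real (card (set v)) * (real (card (set v)) + real n * p) ^ 5 * (\<E> x. cyc v x)"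
    by (rule path_growth) (auto simp: bdm_cyc cyc_bounds cyc_upd lv)
  finally have f: "(\<Sum>w\<in>distinct_tuples n 6. f w) \<le> 6 * (6 + real n * p) ^ 5 * q6"
    by (simp add: cv Ev)
  have "(\<Sum>w\<in>distinct_tuples n 6. if set v \<inter> set w \<noteq> {} then ?I w else 0) \<le>
    (\<Sum>w\<in>distinct_tuples n 6. \<Sum>s<6. if w!s \<in> set v then ?I w else 0)"
  proof (rule sum_mono)
    fix w assume w: "w \<in> distinct_tuples n 6"
    show "(if set v \<inter> set w \<noteq> {} then ?I w else 0) \<le> (\<Sum>s<6. if w!s \<in> set v then ?I w else 0)"
    proof (cases "set v \<inter> set w = {}")
      case False
      then obtain z where z: "z \<in> set v" "z \<in> set w" by auto
      from z(2) obtain s where "s < length w" "w!s = z" by (auto simp: in_set_conv_nth)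
      with z(1) w have s: "s < 6" "w!s \<in> set v" by (auto simp: distinct_tuples_def)
      then have "?I w = (if w!s \<in> set v then ?I w else 0)" by simp
      also have "\<dots> \<le> (\<Sum>s<6. if w!s \<in> set v then ?I w else 0)"
        using s I0 by (intro member_le_sum) auto
      finally show ?thesis using False by simp
    qed (auto intro!: sum_nonneg I0)
  qed
  also have "\<dots> = (\<Sum>s<6. \<Sum>w\<in>distinct_tuples n 6. if w!s \<in> set v then ?I w else 0)"
    by (rule sum.swap)
  also have "\<dots> = (\<Sum>s<(6::nat). \<Sum>w\<in>distinct_tuples n 6. f w)"
    by (intro sum.cong rot refl) simp
  also have "\<dots> \<le> 6 * (6 * (6 + real n * p) ^ 5 * q6)" using f by (simp add: mult_ac)
  finally show ?thesis by simp
qed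

text \<open>Cycles on disjoint vertex sets are uncorrelated, so only pairs with a common vertex
  count. If q6 has order p^5, the bound is of order 1/n relative to the squared mean. The constant
  is 36 * 7^5.\<close>

theorem C6_variance:
  assumes np: "real n * p \<ge> 1"
  shows "(\<E> x. (C6 n x - real (card (distinct_tuples n 6)) * q6)^2) \<le> 605052 * real n ^ 11 * p^5 * q6"
proof -
  let ?D = "distinct_tuples n 6"
  have pt: "length v = 6" "distinct v" if "v \<in> ?D" for v using that by (auto simp: distinct_tuples_def)
  have E1: "(\<E> x. cyc v x) = q6" if "v \<in> ?D" for v
    using E_cyc[OF pt[OF that], of "\<lambda>_. 1"] P.prob_space by (simp add: bdm_intros)
  have i: "integrable P (cyc v)" "integrable P (\<lambda>x. cyc v x * cyc w x)" for v w
    by (intro P.bdm_integrable bdm_intros bdm_cyc)+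
  have cov: "(\<E> x. (cyc v x - q6) * (cyc w x - q6)) \<le> (if set v \<inter> set w \<noteq> {} then \<integral>x. cyc v x * cyc w x \<partial>P else 0)"
    if vw: "v \<in> ?D" "w \<in> ?D" for v w
  proof -
    have "(\<E> x. (cyc v x - q6) * (cyc w x - q6)) = (\<E> x. cyc v x * cyc w x - q6 * cyc v x - q6 * cyc w x + q6 * q6)"
      by (simp add: algebra_simps)
    also have "\<dots> = (\<E> x. cyc v x * cyc w x) - q6 * q6"
      using i E1[OF vw(1)] E1[OF vw(2)] P.prob_space by simp
    finally have eq: "(\<E> x. (cyc v x - q6) * (cyc w x - q6)) = (\<E> x. cyc v x * cyc w x) - q6 * q6" .
    show ?thesis
    proof (cases "set v \<inter> set w = {}")
      case True
      have "(\<E> x. cyc v x * cyc w x) = q6 * (\<E> x. cyc v x)"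
        using True by (intro E_cyc pt vw bdm_cyc cyc_upd) auto
      then show ?thesis using eq E1[OF vw(1)] True by simp
    next
      case False
      then show ?thesis using eq by simp
    qed
  qed
  have "(\<E> x. (C6 n x - real (card ?D) * q6)^2) = (\<E> x. (\<Sum>v\<in>?D. \<Sum>w\<in>?D. (cyc v x - q6) * (cyc w x - q6)))"
    by (simp add: C6_def power2_eq_square sum_product[symmetric] sum_subtractf)
  also have "\<dots> = (\<Sum>v\<in>?D. \<Sum>w\<in>?D. \<integral>x. (cyc v x - q6) * (cyc w x - q6) \<partial>P)"
    by (simp add: Bochner_Integration.integral_sum P.bdm_integrable bdm_intros bdm_cyc)
  also have "\<dots> \<le> (\<Sum>v\<in>?D. \<Sum>w\<in>?D. if set v \<inter> set w \<noteq> {} then \<integral>x. cyc v x * cyc w x \<partial>P else 0)"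
    by (intro sum_mono cov)
  also have "\<dots> \<le> (\<Sum>v\<in>?D. 36 * (6 + real n * p) ^ 5 * q6)"
    by (intro sum_mono cyc_pairs_sum)
  also have "\<dots> = real (card ?D) * (36 * (6 + real n * p) ^ 5 * q6)" by simp
  also have "\<dots> \<le> real n ^ 6 * (36 * (7 * (real n * p)) ^ 5 * q6)"
  proof -
    \<comment> \<open>Here np \<ge> 1 turns the number of old vertices into a multiple of
      np.\<close>
    have "6 + real n * p \<le> 7 * (real n * p)" using np by linarith
    then show ?thesis
      using np p_bounds q6_bounds card_distinct_tuples_le[of n 6]
      by (intro mult_mono power_mono mult_nonneg_nonneg) simp_all
  qed
  also have "\<dots> = 605052 * real n ^ 11 * p^5 * q6"
    by (simp add: power_mult_distrib flip: power_add)
  finally show ?thesis .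
qed

end

section \<open>Convergence in probability along varying spaces\<close>

definition conv_prob :: "(nat \<Rightarrow> 'x measure) \<Rightarrow> (nat \<Rightarrow> 'x \<Rightarrow> real) \<Rightarrow> real \<Rightarrow> bool" where
  "conv_prob N f c \<longleftrightarrow> (\<forall>\<epsilon>>0. (\<lambda>n. measure (N n) {x \<in> space (N n). \<epsilon> \<le> \<bar>f n x - c\<bar>}) \<longlonglongrightarrow> 0)"

text \<open>Allows an arbitrary fixed slack e beside a vanishing majorant, the form in which
  truncation arguments deliver their bounds.\<close>

lemma tendsto_0_by_majorants:
  fixes f :: "nat \<Rightarrow> 'c::real_normed_vector"
  assumes "\<And>e::real. e > 0 \<Longrightarrow> \<exists>g. (g \<longlonglongrightarrow> 0) \<and> (\<forall>\<^sub>F n in sequentially. norm (f n) \<le> e + g n)"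
  shows "f \<longlonglongrightarrow> 0"
proof (rule tendstoI)
  fix e :: real assume "e > 0"
  then obtain g where g: "g \<longlonglongrightarrow> 0" "\<forall>\<^sub>F n in sequentially. norm (f n) \<le> e/2 + g n"
    using assms[of "e/2"] by auto
  from order_tendstoD(2)[OF g(1), of "e/2"] \<open>e > 0\<close> have "\<forall>\<^sub>F n in sequentially. g n < e/2" by simp
  with g(2) show "\<forall>\<^sub>F n in sequentially. dist (f n) 0 < e" by eventually_elim simp
qed

lemma conv_probI_L1:
  assumes N: "\<And>n. prob_space (N n)" and f: "\<And>n. bdm (N n) (f n)"
    and lim: "(\<lambda>n. \<integral>x. \<bar>f n x - c\<bar> \<partial>N n) \<longlonglongrightarrow> 0"
  shows "conv_prob N f c"
  unfolding conv_prob_def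
proof (intro allI impI)
  fix e :: real assume e: "e > 0"
  have le: "measure (N n) {x \<in> space (N n). e \<le> \<bar>f n x - c\<bar>} \<le> (\<integral>x. \<bar>f n x - c\<bar> \<partial>N n) / e" for n
  proof -
    interpret prob_space "N n" by (rule N)
    have "integrable (N n) (\<lambda>x. \<bar>f n x - c\<bar>)" by (intro bdm_integrable bdm_intros f)
    from integral_Markov_inequality_measure[OF this sets.empty_sets, of e] e
    show ?thesis by simp
  qed
  show "(\<lambda>n. measure (N n) {x \<in> space (N n). e \<le> \<bar>f n x - c\<bar>}) \<longlonglongrightarrow> 0"
  proof (rule tendsto_sandwich[OF _ _ tendsto_const])
    show "(\<lambda>n. (\<integral>x. \<bar>f n x - c\<bar> \<partial>N n) / e) \<longlonglongrightarrow> 0" using tendsto_divide_zero[OF lim] .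
  qed (use le in auto)
qed

text \<open>Since the limits are constants, the two sequences converge jointly, and continuity at
  that one point is enough. It is applied to 1 / (u * sqrt v), which is singular elsewhere.\<close>

lemma conv_prob_isCont:
  assumes N: "\<And>n. prob_space (N n)"
    and [measurable]: "\<And>n. f n \<in> borel_measurable (N n)" "\<And>n. g n \<in> borel_measurable (N n)"
    and f: "conv_prob N f a" and g: "conv_prob N g b" and h: "isCont h (a, b)"
  shows "conv_prob N (\<lambda>n x. h (f n x, g n x)) (h (a, b))"
  unfolding conv_prob_def
proof (intro allI impI)
  fix e :: real assume e: "e > 0"
  from h e obtain d where d: "d > 0" "\<And>z. dist z (a, b) < d \<Longrightarrow> dist (h z) (h (a, b)) < e"
    by (metis continuous_at_eps_delta)
  let ?H = "\<lambda>n. {x \<in> space (N n). e \<le> \<bar>h (f n x, g n x) - h (a, b)\<bar>}"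
  let ?A = "\<lambda>n. {x \<in> space (N n). d/2 \<le> \<bar>f n x - a\<bar>}" and ?B = "\<lambda>n. {x \<in> space (N n). d/2 \<le> \<bar>g n x - b\<bar>}"
  have le: "measure (N n) (?H n) \<le>
     measure (N n) (?A n) + measure (N n) (?B n)" for n
  proof -
    interpret prob_space "N n" by (rule N)
    have dst: "dist (u, v) (a, b) < d" if "\<bar>u - a\<bar> < d/2" "\<bar>v - b\<bar> < d/2" for u v
    proof -
      have "dist (u, v) (a, b) \<le> dist u a + dist v b"
        unfolding dist_Pair_Pair by (rule sqrt_sum_squares_le_sum) auto
      then show ?thesis using that by (simp add: dist_real_def)
    qed
    have sub: "(?H n) \<subseteq>
      (?A n) \<union> (?B n)"
    proof -
      have "\<bar>h (f n x, g n x) - h (a, b)\<bar> < e" if "\<bar>f n x - a\<bar> < d/2" "\<bar>g n x - b\<bar> < d/2" for x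
        using d(2)[OF dst[OF that]] by (simp only: dist_real_def)
      then show ?thesis by (intro subsetI) (simp only: mem_Collect_eq Un_iff not_le[symmetric], blast)
    qed
    \<comment> \<open>A set outside the sigma-algebra has measure 0, so monotonicity asks for
      measurability of the larger set alone and h may be arbitrary away from the limit.\<close>
    have "measure (N n) (?H n) \<le>
      measure (N n) ((?A n) \<union> (?B n))"
      by (rule finite_measure_mono[OF sub]) measurable
    also have "\<dots> \<le> measure (N n) (?A n) + measure (N n) (?B n)"
      by (rule measure_Un_le) measurable
    finally show ?thesis .
  qed
  have lim: "(\<lambda>n. measure (N n) (?A n) + measure (N n) (?B n)) \<longlonglongrightarrow> 0 + 0"
    using f[unfolded conv_prob_def, rule_format, OF half_gt_zero[OF d(1)]]
      g[unfolded conv_prob_def, rule_format, OF half_gt_zero[OF d(1)]]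
    by (rule tendsto_add)
  show "(\<lambda>n. measure (N n) (?H n)) \<longlonglongrightarrow> 0"
    by (rule tendsto_sandwich[OF always_eventually always_eventually tendsto_const lim[unfolded add_0]])
      (intro allI measure_nonneg le)+
qed

text \<open>Slutsky's argument: an L1 bound makes X tight, and a tight factor times U - 1 vanishes
  in probability. U enters only through convergence in probability, so it may be unbounded.\<close>

lemma conv_prob_mult_tight:
  assumes N: "\<And>n. prob_space (N n)"
    and X: "\<And>n. bdm (N n) (X n)" and [measurable]: "\<And>n. U n \<in> borel_measurable (N n)"
    and B: "\<forall>\<^sub>F n in sequentially. (\<integral>x. \<bar>X n x\<bar> \<partial>N n) \<le> B" and U: "conv_prob N U 1"
  shows "conv_prob N (\<lambda>n x. X n x * U n x - X n x) 0"
  unfolding conv_prob_def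
proof (intro allI impI, rule tendsto_0_by_majorants)
  fix e d :: real assume e: "e > 0" and d: "d > 0"
  have [measurable]: "X n \<in> borel_measurable (N n)" for n using X by (rule bdm_measurable)
  \<comment> \<open>Markov's inequality then bounds the probability of \<bar>X\<bar> \<ge> K by d;
    the absolute value and the + 1 keep K positive.\<close>
  define K where "K = (\<bar>B\<bar> + 1) / d"
  have K: "K > 0" using d by (simp add: K_def)
  let ?g = "\<lambda>n. measure (N n) {x \<in> space (N n). e / K \<le> \<bar>U n x - 1\<bar>}"
  have "?g \<longlonglongrightarrow> 0" using U e K unfolding conv_prob_def by simp
  moreover have "\<forall>\<^sub>F n in sequentially. norm (measure (N n) {x \<in> space (N n). e \<le> \<bar>X n x * U n x - X n x - 0\<bar>}) \<le> d + ?g n"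
    using B
  proof eventually_elim
    case (elim n)
    interpret prob_space "N n" by (rule N)
    have "\<bar>X n x * U n x - X n x\<bar> < e" if "\<bar>X n x\<bar> < K" "\<bar>U n x - 1\<bar> < e / K" for x
    proof -
      have "\<bar>X n x * U n x - X n x\<bar> = \<bar>X n x\<bar> * \<bar>U n x - 1\<bar>" by (simp add: abs_mult[symmetric] algebra_simps)
      also have "\<dots> < K * (e / K)" using that by (intro mult_strict_mono) auto
      finally show ?thesis using K by simp
    qed
    then have sub: "{x \<in> space (N n). e \<le> \<bar>X n x * U n x - X n x - 0\<bar>} \<subseteq>
      {x \<in> space (N n). K \<le> \<bar>X n x\<bar>} \<union> {x \<in> space (N n). e / K \<le> \<bar>U n x - 1\<bar>}"
      by (intro subsetI) (simp only: mem_Collect_eq Un_iff not_le[symmetric] diff_0_right, blast)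
    have "measure (N n) {x \<in> space (N n). e \<le> \<bar>X n x * U n x - X n x - 0\<bar>} \<le>
      measure (N n) ({x \<in> space (N n). K \<le> \<bar>X n x\<bar>} \<union> {x \<in> space (N n). e / K \<le> \<bar>U n x - 1\<bar>})"
      by (rule finite_measure_mono[OF sub]) measurable
    also have "\<dots> \<le> measure (N n) {x \<in> space (N n). K \<le> \<bar>X n x\<bar>} + ?g n"
      by (rule measure_Un_le) measurable
    also have "measure (N n) {x \<in> space (N n). K \<le> \<bar>X n x\<bar>} \<le> d"
    proof -
      have "integrable (N n) (\<lambda>x. \<bar>X n x\<bar>)" by (intro bdm_integrable bdm_intros X)
      from integral_Markov_inequality_measure[OF this sets.empty_sets, of K] K
      have "measure (N n) {x \<in> space (N n). K \<le> \<bar>X n x\<bar>} \<le> (\<integral>x. \<bar>X n x\<bar> \<partial>N n) / K" by simp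
      also have "\<dots> \<le> (\<bar>B\<bar> + 1) / K" using elim K by (intro divide_right_mono) auto
      also have "\<dots> = d" using d by (simp add: K_def add_nonneg_eq_0_iff)
      finally show ?thesis .
    qed
    finally show ?case by simp
  qed
  ultimately show "\<exists>g. g \<longlonglongrightarrow> 0 \<and> (\<forall>\<^sub>F n in sequentially.
      norm (measure (N n) {x \<in> space (N n). e \<le> \<bar>X n x * U n x - X n x - 0\<bar>}) \<le> d + g n)"
    by blast
qed

lemma iexp_diff_le: "cmod (iexp a - iexp b) \<le> \<bar>a - b\<bar>"
proof -
  have "iexp a - iexp b = iexp b * (iexp (a - b) - 1)"
    by (simp add: algebra_simps flip: exp_add)
  then have "cmod (iexp a - iexp b) = cmod (iexp (a - b) - 1)" by (simp add: norm_mult)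
  then show ?thesis using iexp_approx1[of "a - b" 0] by simp
qed

text \<open>The exponential is Lipschitz in the exponent and has modulus 1, so a small difference
  costs little and a large one at most 2, on an event of vanishing probability.\<close>

lemma char_conv_prob:
  fixes X Y :: "nat \<Rightarrow> 'x \<Rightarrow> real"
  assumes N: "\<And>n. prob_space (N n)"
    and [measurable]: "\<And>n. X n \<in> borel_measurable (N n)" "\<And>n. Y n \<in> borel_measurable (N n)"
    and diff: "conv_prob N (\<lambda>n x. Y n x - X n x) 0"
    and X: "(\<lambda>n. \<integral>x. iexp (t * X n x) \<partial>N n) \<longlonglongrightarrow> L"
  shows "(\<lambda>n. \<integral>x. iexp (t * Y n x) \<partial>N n) \<longlonglongrightarrow> L"
proof -
  let ?X = "\<lambda>n. \<integral>x. iexp (t * X n x) \<partial>N n" and ?Y = "\<lambda>n. \<integral>x. iexp (t * Y n x) \<partial>N n"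
  have "(\<lambda>n. ?Y n - ?X n) \<longlonglongrightarrow> 0"
  proof (rule tendsto_0_by_majorants)
    fix e :: real assume e: "e > 0"
    \<comment> \<open>The + 1 covers t = 0.\<close>
    define d where "d = e / (\<bar>t\<bar> + 1)"
    have d: "d > 0" using e by (simp add: d_def)
    define g where "g n = 2 * measure (N n) {x \<in> space (N n). d \<le> \<bar>Y n x - X n x - 0\<bar>}" for n
    have "g \<longlonglongrightarrow> 0" unfolding g_def using diff d unfolding conv_prob_def by (intro tendsto_mult_right_zero) auto
    moreover have "norm (?Y n - ?X n) \<le> e + g n" for n
    proof -
      interpret prob_space "N n" by (rule N)
      let ?A = "{x \<in> space (N n). d \<le> \<bar>Y n x - X n x - 0\<bar>}"
      have i: "integrable (N n) (\<lambda>x. iexp (t * Y n x))" "integrable (N n) (\<lambda>x. iexp (t * X n x))"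
        by (intro bdm_integrable bdmI[where B=1]; simp)+
      have "cmod (?Y n - ?X n) = cmod (\<integral>x. iexp (t * Y n x) - iexp (t * X n x) \<partial>N n)"
        using i by (subst Bochner_Integration.integral_diff) simp_all
      also have "\<dots> \<le> (\<integral>x. cmod (iexp (t * Y n x) - iexp (t * X n x)) \<partial>N n)"
        by (rule integral_norm_bound)
      also have "\<dots> \<le> (\<integral>x. e + 2 * indicator ?A x \<partial>N n)"
      proof (rule integral_mono)
        show "integrable (N n) (\<lambda>x. cmod (iexp (t * Y n x) - iexp (t * X n x)))" using i by (intro integrable_norm Bochner_Integration.integrable_diff)
        have "?A \<in> sets (N n)" by measurable
        moreover have "integrable (N n) (indicator B :: _ \<Rightarrow> real)" if "B \<in> sets (N n)" for B
          using that by (intro integrable_real_indicator) (auto simp: less_top[symmetric])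
        ultimately have "integrable (N n) (indicator ?A :: _ \<Rightarrow> real)" by blast
        then show "integrable (N n) (\<lambda>x. e + 2 * indicator ?A x)"
          by (intro Bochner_Integration.integrable_add integrable_const integrable_mult_right)
        fix x assume x: "x \<in> space (N n)"
        show "cmod (iexp (t * Y n x) - iexp (t * X n x)) \<le> e + 2 * indicator ?A x"
        proof (cases "x \<in> ?A")
          case True
          have "cmod (iexp (t * Y n x) - iexp (t * X n x)) \<le> cmod (iexp (t * Y n x)) + cmod (iexp (t * X n x))"
            by (rule norm_triangle_ineq4)
          then show ?thesis using True e by simp
        next
          case False
          then have "\<bar>Y n x - X n x\<bar> \<le> d" using x by simp
          then have "\<bar>t\<bar> * \<bar>Y n x - X n x\<bar> \<le> \<bar>t\<bar> * d" by (intro mult_left_mono) auto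
          also have "\<dots> \<le> e" using e by (simp add: d_def field_simps)
          finally have "\<bar>t * Y n x - t * X n x\<bar> \<le> e" by (simp add: abs_mult[symmetric] algebra_simps)
          then show ?thesis using iexp_diff_le[of "t * Y n x" "t * X n x"] False by simp
        qed
      qed
      also have "\<dots> = e + g n"
      proof -
        have "?A \<in> sets (N n)" by measurable
        moreover have "integrable (N n) (indicator B :: _ \<Rightarrow> real)" "(\<integral>x. indicator B x \<partial>N n) = measure (N n) B" if "B \<in> sets (N n)" for B
          using that by (auto simp: less_top[symmetric] intro!: integrable_real_indicator)
        ultimately show ?thesis using prob_space unfolding g_def by (subst Bochner_Integration.integral_add) simp_all
      qed
      finally show ?thesis .
    qed
    ultimately show "\<exists>g. g \<longlonglongrightarrow> 0 \<and> (\<forall>\<^sub>F n in sequentially.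
        norm (?Y n - ?X n) \<le> e + g n)"
      by (intro exI[of _ g] conjI always_eventually allI)
  qed
  from tendsto_add[OF this X] show ?thesis by simp
qed

section \<open>Asymptotics of the normalised statistic\<close>

text \<open>On samples without an edge or without a 6-cycle the denominator is 0 and the quotient is
  0; their probability vanishes in the limit.\<close>

definition normalised_stat :: "nat \<Rightarrow> (nat \<Rightarrow> nat \<Rightarrow> real) \<Rightarrow> real" where
  "normalised_stat n A = sqrt 2 * T_stat n A / (real n ^ 5 * A_bar n A * sigma_hat2 n A)"

context regular_kernel
begin

text \<open>Q has variance q * n * (n - 1) / 2, and q is asymptotically q6, so this factor brings
  the variance to 1 in the limit.\<close>

definition "scaled_form n x = sqrt 2 / (real n * sqrt q6) * Q n x"

text \<open>The random normalisers are replaced by what they estimate: \<open>A_bar\<close> by p and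
  \<open>sigma_hat2\<close> by 2 * sqrt q6.\<close>

definition "scaled_stat n x = sqrt 2 / (real n ^ 5 * p * (2 * sqrt q6)) * T_stat n (adj x)"

definition "edge_ratio n x = 1 / p * A_bar n (adj x)"

definition "cycle_ratio n x = 1 / (real n ^ 6 * q6) * C6 n x"

lemma bdm_scaled: "bdm P (scaled_form n)" "bdm P (scaled_stat n)" "bdm P (edge_ratio n)" "bdm P (cycle_ratio n)"
  unfolding scaled_form_def scaled_stat_def edge_ratio_def cycle_ratio_def T_stat_def A_bar_def
  by (intro bdm_intros bdm_Q bdm_C6 bdm_adj)+

lemma sigma_hat2_adj:
  assumes "q6 > 0" "n > 0"
  shows "sigma_hat2 n (adj x) = 2 * sqrt q6 * sqrt (cycle_ratio n x)"
proof -
  have "(\<Sum>v\<in>distinct_tuples n 6. adj x (v!0) (v!1) * adj x (v!1) (v!2) * adj x (v!2) (v!3) *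
       adj x (v!3) (v!4) * adj x (v!4) (v!5) * adj x (v!5) (v!0)) = C6 n x"
    unfolding C6_def
  proof (intro sum.cong refl)
    fix v assume "v \<in> distinct_tuples n 6"
    then have "v ! i \<noteq> v ! j" if "i \<noteq> j" "i < 6" "j < 6" for i j
      using that by (simp add: distinct_tuples_def nth_eq_iff_index_eq)
    then show "adj x (v!0) (v!1) * adj x (v!1) (v!2) * adj x (v!2) (v!3) *
       adj x (v!3) (v!4) * adj x (v!4) (v!5) * adj x (v!5) (v!0) = cyc v x"
      by (simp add: adj_def cyc_def)
  qed
  then have "sigma_hat2 n (adj x) = sqrt (4 * q6 * cycle_ratio n x)"
    using assms by (simp add: sigma_hat2_def cycle_ratio_def)
  then show ?thesis by (simp add: real_sqrt_mult)
qed

lemma normalised_stat_factor: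
  assumes "q6 > 0" "n > 0" "p > 0"
  shows "normalised_stat n (adj x) = scaled_stat n x * (1 / (edge_ratio n x * sqrt (cycle_ratio n x)))"
  using assms unfolding normalised_stat_def sigma_hat2_adj[OF assms(1,2)] scaled_stat_def edge_ratio_def
  by (simp add: field_simps)

lemma measurable_normalised_stat: "(\<lambda>x. normalised_stat n (adj x)) \<in> borel_measurable P"
proof -
  have [measurable]: "(\<lambda>x. adj x i j) \<in> borel_measurable P" for i j
    using bdm_adj by (rule bdm_measurable)
  show ?thesis unfolding normalised_stat_def T_stat_def A_bar_def sigma_hat2_def by measurable
qed

lemma q6_lower_sqrt:
  assumes "c > 0" "c * p^5 \<le> q6" "p > 0"
  shows "q6 > 0" "sqrt c * sqrt p ^ 5 \<le> sqrt q6"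
proof -
  have "c * p^5 > 0" using assms by simp
  then show "q6 > 0" using assms(2) by linarith
  have "sqrt c * sqrt p ^ 5 = sqrt (c * p^5)" by (simp add: real_sqrt_mult real_sqrt_power)
  also have "\<dots> \<le> sqrt q6" using assms by simp
  finally show "sqrt c * sqrt p ^ 5 \<le> sqrt q6" .
qed

lemma Q_abs_moment: "(\<E> x. \<bar>Q n x\<bar>) \<le> real n * sqrt p ^ 5"
proof -
  have "(\<E> x. (H2 n x)^2) = 4 * (\<E> x. (Q n x)^2)"
    unfolding H2_eq_Q by (simp add: power_mult_distrib)
  then have "(\<E> x. (Q n x)^2) \<le> real n ^ 2 * p^5" using H2_second_moment[of n] by simp
  also have "\<dots> = (real n * sqrt p ^ 5)^2"
  proof -
    have "(sqrt p ^ 5)^2 = ((sqrt p)^2) ^ 5" by (simp flip: power_mult)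
    then show ?thesis using p_bounds by (simp add: power_mult_distrib)
  qed
  finally have "sqrt (\<E> x. (Q n x)^2) \<le> real n * sqrt p ^ 5"
    using p_bounds by (intro real_le_lsqrt) auto
  then show ?thesis using P.abs_le_sqrt_second_moment[OF bdm_Q[of n]] by linarith
qed

lemma scaled_form_abs_moment:
  assumes c: "c > 0" "c * p^5 \<le> q6" and np: "real n * p \<ge> 1"
  shows "(\<E> x. \<bar>scaled_form n x\<bar>) \<le> sqrt 2 / sqrt c"
proof -
  note pos = np_pos[OF np]
  note q6 = q6_lower_sqrt[OF c pos(1)]
  have "(\<E> x. \<bar>scaled_form n x\<bar>) = sqrt 2 / (real n * sqrt q6) * (\<E> x. \<bar>Q n x\<bar>)"
    using pos q6 by (simp add: scaled_form_def abs_mult)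
  also have "\<dots> \<le> sqrt 2 / (real n * (sqrt c * sqrt p ^ 5)) * (real n * sqrt p ^ 5)"
    using pos q6 c by (intro mult_mono divide_left_mono mult_left_mono Q_abs_moment mult_pos_pos) auto
  also have "\<dots> = sqrt 2 / sqrt c" using pos by simp
  finally show ?thesis .
qed

text \<open>Three errors arise: the falling factorial in the coefficient of Q, the part D of the
  3-path count beyond its end-point projection, and the remainder \<open>R_stat\<close>. After
  scaling they have orders 1/n, 1/sqrt(np), and sqrt p + 1/(n sqrt p).\<close>

lemma scaled_stat_approx:
  assumes c: "c > 0" "c * p^5 \<le> q6" and np: "real n * p \<ge> 1" and n: "n \<ge> 4"
  shows "(\<E> x. \<bar>scaled_stat n x - scaled_form n x\<bar>) \<le> sqrt 2 / sqrt c * (446 / sqrt (real n * p) + sqrt p)"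
proof -
  note pos = np_pos[OF np]
  note q6 = q6_lower_sqrt[OF c pos(1)]
  define m where "m = real n"
  define s where "s = sqrt m"
  define r where "r = sqrt p"
  have m: "m \<ge> 4" using n by (simp add: m_def)
  have s: "s > 0" "m = s^2" and r: "r > 0" "r \<le> 1" "p = r^2" using pos m p_bounds by (auto simp: s_def r_def)
  have sr: "s * r \<ge> 1" "sqrt (real n * p) = s * r"
    using np by (auto simp: s_def r_def m_def real_sqrt_mult[symmetric])
  define D where "D x = S3 n x - real (n - 2) * real (n - 3) * H2 n x" for x
  have bD: "bdm P D" unfolding D_def by (intro bdm_intros bdm_S)
  have ED: "(\<E> x. \<bar>D x\<bar>) \<le> 132 * (s^5 * r^4)"
  proof -
    have "(\<E> x. (D x)^2) \<le> 17248 * real n ^ 5 * p^4"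
      unfolding D_def by (rule S3_projection[OF np])
    \<comment> \<open>17424 = 132^2 is the first square above 17248.\<close>
    also have "\<dots> \<le> 17424 * real n ^ 5 * p^4" using pos by simp
    also have "\<dots> = (132 * (s^5 * r^4))^2"
      unfolding m_def[symmetric] s(2) r(3) by (simp add: power_mult_distrib flip: power_mult)
    finally have "sqrt (\<E> x. (D x)^2) \<le> 132 * (s^5 * r^4)"
      using s r by (intro real_le_lsqrt) auto
    then show ?thesis using P.abs_le_sqrt_second_moment[OF bD] by linarith
  qed
  define k where "k = sqrt 2 / (m ^ 5 * p * (2 * sqrt q6))"
  have k: "k \<ge> 0" using pos q6 by (simp add: k_def m_def)
  have k_le: "k \<le> sqrt 2 / sqrt c * (1 / (2 * s^10 * r^7))"
  proof -
    have "k \<le> sqrt 2 / (m ^ 5 * p * (2 * (sqrt c * r ^ 5)))"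
      unfolding k_def using q6 pos m c r unfolding r_def
      by (intro divide_left_mono mult_left_mono mult_pos_pos) auto
    also have "\<dots> = sqrt 2 / sqrt c * (1 / (2 * s^10 * r^7))"
      unfolding s(2) r(3) by (simp add: field_simps flip: power_add power_mult)
    finally show ?thesis .
  qed
  have split: "scaled_stat n x - scaled_form n x =
    k * (2 * m * p * ((m-1) * (m-2) * (m-3) - m^3) * Q n x + m * (m - 1) * p * D x + R_stat n x)" for x
  proof -
    have T: "T_stat n (adj x) = m * (m - 1) * p * S3 n x + R_stat n x" by (simp add: R_stat_def m_def)
    have S3: "S3 n x = D x + 2 * (m - 2) * (m - 3) * Q n x"
      using n by (simp add: D_def H2_eq_Q m_def of_nat_diff)
    have "scaled_form n x = k * (2 * m * p * m^3 * Q n x)"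
      using pos q6 by (simp add: scaled_form_def k_def m_def numeral_eq_Suc)
    moreover have "scaled_stat n x = k * T_stat n (adj x)" by (simp add: scaled_stat_def k_def m_def)
    ultimately show ?thesis unfolding T S3 by (simp add: algebra_simps)
  qed
  have "(\<E> x. \<bar>scaled_stat n x - scaled_form n x\<bar>) \<le>
    (\<E> x. k * (12 * m^3 * p * \<bar>Q n x\<bar> + m^2 * p * \<bar>D x\<bar> + \<bar>R_stat n x\<bar>))"
  proof (intro integral_mono P.bdm_integrable bdm_intros bdm_Q bD bdm_R_stat bdm_scaled)
    fix x
    have e1: "\<bar>(m-1) * (m-2) * (m-3) - m^3\<bar> \<le> 6 * m^2"
    proof -
      have "(m-1) * (m-2) * (m-3) - m^3 = - 6 * m^2 + 11 * m - 6" by (simp add: power2_eq_square power3_eq_cube algebra_simps)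
      moreover have "11 * m \<le> 6 * m^2" using m by (simp add: power2_eq_square)
      ultimately show ?thesis using m zero_le_power2[of m] by (simp add: abs_le_iff)
    qed
    have "\<bar>2 * m * p * ((m-1) * (m-2) * (m-3) - m^3) * Q n x\<bar> = 2 * m * p * \<bar>(m-1) * (m-2) * (m-3) - m^3\<bar> * \<bar>Q n x\<bar>"
      using m pos by (simp add: abs_mult)
    also have "\<dots> \<le> 2 * m * p * (6 * m^2) * \<bar>Q n x\<bar>"
      using e1 m pos by (intro mult_right_mono mult_left_mono) auto
    also have "\<dots> = 12 * m^3 * p * \<bar>Q n x\<bar>" by (simp add: power2_eq_square power3_eq_cube)
    finally have t1: "\<bar>2 * m * p * ((m-1) * (m-2) * (m-3) - m^3) * Q n x\<bar> \<le> 12 * m^3 * p * \<bar>Q n x\<bar>" .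
    have "\<bar>m * (m - 1) * p * D x\<bar> = m * (m - 1) * p * \<bar>D x\<bar>" using m pos by (simp add: abs_mult)
    also have "\<dots> \<le> m^2 * p * \<bar>D x\<bar>" using m pos by (intro mult_right_mono) (auto simp: power2_eq_square)
    finally have t2: "\<bar>m * (m - 1) * p * D x\<bar> \<le> m^2 * p * \<bar>D x\<bar>" .
    have "\<bar>2 * m * p * ((m-1) * (m-2) * (m-3) - m^3) * Q n x + m * (m - 1) * p * D x + R_stat n x\<bar> \<le>
      12 * m^3 * p * \<bar>Q n x\<bar> + m^2 * p * \<bar>D x\<bar> + \<bar>R_stat n x\<bar>" using t1 t2 by linarith
    then show "\<bar>scaled_stat n x - scaled_form n x\<bar> \<le> k * (12 * m^3 * p * \<bar>Q n x\<bar> + m^2 * p * \<bar>D x\<bar> + \<bar>R_stat n x\<bar>)"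
      unfolding split abs_mult[of k] using k by (simp add: mult_left_mono)
  qed
  also have "\<dots> = k * (12 * m^3 * p * (\<E> x. \<bar>Q n x\<bar>) + m^2 * p * (\<E> x. \<bar>D x\<bar>) + (\<E> x. \<bar>R_stat n x\<bar>))"
  proof -
    have "integrable P (\<lambda>x. \<bar>Q n x\<bar>)" "integrable P (\<lambda>x. \<bar>D x\<bar>)" "integrable P (\<lambda>x. \<bar>R_stat n x\<bar>)"
      by (intro P.bdm_integrable bdm_intros bdm_Q bD bdm_R_stat)+
    then show ?thesis by simp
  qed
  also have "\<dots> \<le> (sqrt 2 / sqrt c * (1 / (2 * s^10 * r^7))) *
    (12 * m^3 * p * (m * r ^ 5) + m^2 * p * (132 * (s^5 * r^4)) + (m ^ 5 * p^4 + 747 * m ^ 4 * p^3))"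
  proof (intro mult_mono k_le add_mono mult_left_mono ED)
    show "(\<E> x. \<bar>Q n x\<bar>) \<le> m * r^5" using Q_abs_moment[of n] by (simp add: m_def r_def)
    show "(\<E> x. \<bar>R_stat n x\<bar>) \<le> m ^ 5 * p^4 + 747 * m ^ 4 * p^3" using R_stat_bound[OF n np] by (simp add: m_def)
  qed (use m pos c s r in \<open>auto intro!: add_nonneg_nonneg mult_nonneg_nonneg\<close>)
  also have "\<dots> = sqrt 2 / sqrt c * (6 * (1 / s^2) + 66 * (1 / (s * r)) + r / 2 + 747/2 * (1 / (s^2 * r)))"
    unfolding s(2) r(3) using s(1) r(1) c by (simp add: field_simps power_numeral_reduce)
  \<comment> \<open>Both 1/n and 1/(n sqrt p) are at most 1/sqrt(np), and 6 + 66 + 747/2 \<le>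
    446.\<close>
  also have "\<dots> \<le> sqrt 2 / sqrt c * (446 / (s * r) + r)"
  proof (rule mult_left_mono)
    have s1: "s \<ge> 1"
    proof -
      have "1 \<le> s * r" by (rule sr)
      also have "\<dots> \<le> s * 1" using s r by (intro mult_left_mono) auto
      finally show ?thesis by simp
    qed
    have a: "1 / s^2 \<le> 1 / (s * r)"
    proof (rule divide_left_mono)
      have "s * r \<le> s * 1" using s r by (intro mult_left_mono) auto
      also have "\<dots> \<le> s * s" using s s1 by (intro mult_left_mono) auto
      finally show "s * r \<le> s^2" by (simp add: power2_eq_square)
    qed (use s r in auto)
    have b: "1 / (s^2 * r) \<le> 1 / (s * r)"
    proof (rule divide_left_mono)
      have "1 * (s * r) \<le> s * (s * r)" using s r s1 by (intro mult_right_mono) auto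
      then show "s * r \<le> s^2 * r" by (simp add: power2_eq_square mult.assoc)
    qed (use s r in auto)
    have "6 * A + 66 * B + R / 2 + 747/2 * C \<le> 446 * B + R"
      if "A \<le> B" "C \<le> B" "0 \<le> B" "0 \<le> R" for A B C R :: real
      using that by linarith
    from this[OF a b, of r]
    show "6 * (1 / s^2) + 66 * (1 / (s * r)) + r / 2 + 747/2 * (1 / (s^2 * r)) \<le> 446 / (s * r) + r"
      using s(1) r(1) by simp
  qed (use c in auto)
  finally show ?thesis by (simp add: sr(2) r_def[symmetric])
qed

lemma edge_ratio_moment:
  assumes np: "real n * p \<ge> 1" and n: "n \<ge> 4"
  shows "(\<E> x. \<bar>edge_ratio n x - 1\<bar>) \<le> 4 / sqrt (real n * p)"
proof -
  note pos = np_pos[OF np]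
  define m where "m = real n"
  define s where "s = sqrt m"
  define r where "r = sqrt p"
  have m: "m \<ge> 4" using n by (simp add: m_def)
  have s: "s > 0" "m = s^2" "s \<ge> 1" and r: "r > 0" "r \<le> 1" "p = r^2" using pos m p_bounds by (auto simp: s_def r_def)
  have sr: "sqrt (real n * p) = s * r"
    by (auto simp: s_def r_def m_def real_sqrt_mult[symmetric])
  have eq: "edge_ratio n x - 1 = 1 / (m * (m - 1) * p) * S1 n x" for x
    unfolding edge_ratio_def A_bar_def edge_sum[OF n] m_def[symmetric] using m pos by (simp add: field_simps)
  have "(\<E> x. (S1 n x)^2) \<le> (2 * m * r)^2"
    using S1_second_moment[of n] pos by (simp add: m_def r_def power_mult_distrib)
  then have "sqrt (\<E> x. (S1 n x)^2) \<le> 2 * m * r" using m r by (intro real_le_lsqrt) auto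
  then have E: "(\<E> x. \<bar>S1 n x\<bar>) \<le> 2 * m * r"
    using P.abs_le_sqrt_second_moment[OF bdm_S(1)[of n]] by linarith
  have "(\<E> x. \<bar>edge_ratio n x - 1\<bar>) = 1 / (m * (m - 1) * p) * (\<E> x. \<bar>S1 n x\<bar>)"
    unfolding eq using m pos by (simp add: abs_mult)
  also have "\<dots> \<le> 1 / (m * (m / 2) * p) * (2 * m * r)"
    using E m pos r by (intro mult_mono divide_left_mono mult_right_mono mult_left_mono) auto
  also have "\<dots> = 4 / (m * r)" using m r(1) unfolding r(3) by (simp add: field_simps power2_eq_square)
  \<comment> \<open>The order 1/(n sqrt p) is weakened to 1/sqrt(np), which is known to vanish
    directly from the growth of np.\<close>
  also have "\<dots> \<le> 4 / (s * r)"
  proof (rule divide_left_mono)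
    have "1 * s \<le> s * s" using s by (intro mult_right_mono) auto
    then show "s * r \<le> m * r" using r unfolding s(2) by (intro mult_right_mono) (auto simp: power2_eq_square)
  qed (use s r m in auto)
  finally show ?thesis by (simp add: sr)
qed

text \<open>The random error comes from the variance of the cycle count, where c bounds p^5 / q6;
  the deterministic one from n^6 standing in for the number of tuples.\<close>

lemma cycle_ratio_moment:
  assumes c: "c > 0" "c * p^5 \<le> q6" and np: "real n * p \<ge> 1"
  shows "(\<E> x. \<bar>cycle_ratio n x - 1\<bar>) \<le> sqrt (605052 / (c * real n)) + \<bar>real (card (distinct_tuples n 6)) / real n ^ 6 - 1\<bar>"
proof -
  note pos = np_pos[OF np]
  note q6 = q6_lower_sqrt[OF c pos(1)]
  let ?N = "real (card (distinct_tuples n 6))"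
  define k where "k = 1 / (real n ^ 6 * q6)"
  have k: "k > 0" using pos q6 by (simp add: k_def)
  define d where "d = \<bar>?N / real n ^ 6 - 1\<bar>"
  define Y where "Y x = C6 n x - ?N * q6" for x
  have bY: "bdm P Y" unfolding Y_def by (intro bdm_intros bdm_C6)
  have "(\<E> x. \<bar>cycle_ratio n x - 1\<bar>) \<le> (\<E> x. k * \<bar>Y x\<bar> + d)"
  proof (intro integral_mono P.bdm_integrable bdm_intros bdm_scaled bY)
    fix x
    have "cycle_ratio n x - 1 = k * Y x + (?N / real n ^ 6 - 1)"
      using pos q6 by (simp add: cycle_ratio_def k_def Y_def field_simps)
    then have "\<bar>cycle_ratio n x - 1\<bar> \<le> \<bar>k * Y x\<bar> + d" unfolding d_def by linarith
    then show "\<bar>cycle_ratio n x - 1\<bar> \<le> k * \<bar>Y x\<bar> + d" using k by (simp add: abs_mult)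
  qed
  also have "\<dots> = k * (\<E> x. \<bar>Y x\<bar>) + d"
    using P.prob_space by (subst Bochner_Integration.integral_add) (auto intro!: P.bdm_integrable bdm_intros bY)
  also have "k * (\<E> x. \<bar>Y x\<bar>) \<le> sqrt (605052 / (c * real n))"
  proof -
    have "k * (\<E> x. \<bar>Y x\<bar>) \<le> k * sqrt (\<E> x. (Y x)^2)"
      using k P.abs_le_sqrt_second_moment[OF bY] by (intro mult_left_mono) auto
    also have "\<dots> \<le> k * sqrt (605052 * real n ^ 11 * p^5 * q6)"
      using k C6_variance[OF np] unfolding Y_def by (intro mult_left_mono real_sqrt_le_mono) auto
    also have "\<dots> = sqrt (k^2 * (605052 * real n ^ 11 * p^5 * q6))"
      using k by (simp add: real_sqrt_mult)
    also have "\<dots> \<le> sqrt (605052 / (c * real n))"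
    proof (rule real_sqrt_le_mono)
      have "k^2 * (605052 * real n ^ 11 * p^5 * q6) = 605052 / real n * (p^5 / q6)"
        using pos q6 by (simp add: k_def power_divide field_simps power_numeral_reduce)
      also have "\<dots> \<le> 605052 / real n * (1 / c)"
        using c pos q6 by (intro mult_left_mono) (auto simp: field_simps)
      finally show "k^2 * (605052 * real n ^ 11 * p^5 * q6) \<le> 605052 / (c * real n)" by (simp add: mult.commute)
    qed
    finally show ?thesis .
  qed
  finally show ?thesis by (simp add: d_def)
qed

end

lemma card_distinct_tuples_ratio: "(\<lambda>n. real (card (distinct_tuples n t)) / real n ^ t) \<longlonglongrightarrow> 1"
proof -
  have "(\<lambda>n. real (n - i) / real n) \<longlonglongrightarrow> 1" for i
  proof -
    have "(\<lambda>n. 1 - real i / real n) \<longlonglongrightarrow> 1 - 0"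
      by (intro tendsto_intros lim_const_over_n)
    moreover have "\<forall>\<^sub>F n in sequentially. 1 - real i / real n = real (n - i) / real n"
      using eventually_gt_at_top[of i] by eventually_elim (simp add: of_nat_diff field_simps)
    ultimately show ?thesis by (simp add: Lim_transform_eventually)
  qed
  then have "(\<lambda>n. \<Prod>i<t. real (n - i) / real n) \<longlonglongrightarrow> (\<Prod>i<t. 1)" by (intro tendsto_prod)
  then show ?thesis by (simp add: card_distinct_tuples prod_dividef)
qed

text \<open>The statistic with deterministic normalisers is compared in L1 with the quadratic form.
  The random denominator is attached last, as a factor tending to 1 in probability, so that no
  moment of its inverse is ever required.\<close>

theorem regular_kernel_clt:
  fixes F :: "nat \<Rightarrow> 'b measure" and W :: "nat \<Rightarrow> 'b \<Rightarrow> 'b \<Rightarrow> real" and p :: "nat \<Rightarrow> real"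
  assumes rk: "\<And>n. regular_kernel (F n) (W n) (p n)"
    and p: "p \<longlonglongrightarrow> 0" and np: "filterlim (\<lambda>n. real n * p n) at_top sequentially"
    and c: "c > 0" "\<And>n. c * p n ^ 5 \<le> regular_kernel.q6 (F n) (W n)"
  shows "(\<lambda>n. \<integral>x. iexp (t * normalised_stat n (regular_kernel.adj (W n) x)) \<partial>iid_sample.P (F n))
    \<longlonglongrightarrow> complex_of_real (exp (- (t^2) / 2))"
proof -
  let ?L = "complex_of_real (exp (- (t^2) / 2))"
  interpret rk: regular_kernel "F n" "W n" "p n" for n by (rule rk)
  have P: "prob_space (rk.P n)" for n by unfold_locales
  let ?Z = "\<lambda>n. rk.scaled_form n n" and ?X = "\<lambda>n. rk.scaled_stat n n"
  have bdm: "bdm (rk.P n) (?Z n)" "bdm (rk.P n) (?X n)" "bdm (rk.P n) (rk.edge_ratio n n)" "bdm (rk.P n) (rk.cycle_ratio n n)" for n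
    by (rule rk.bdm_scaled)+
  note meas [measurable] = bdm[THEN bdm_measurable]
  have large: "\<forall>\<^sub>F n in sequentially. n \<ge> 4 \<and> real n * p n \<ge> 1 \<and> p n > 0 \<and> rk.q6 n > 0"
  proof -
    have "\<forall>\<^sub>F n in sequentially. real n * p n \<ge> 1" using np unfolding filterlim_at_top by blast
    with eventually_ge_at_top[of 4] show ?thesis
    proof eventually_elim
      case (elim n)
      then have "p n > 0" using rk.p_bounds[of n] by (cases "p n = 0") auto
      with elim show ?case using rk.q6_lower_sqrt[OF c(1) c(2)] by blast
    qed
  qed
  have inv_np: "(\<lambda>n. 1 / sqrt (real n * p n)) \<longlonglongrightarrow> 0"
    by (intro real_tendsto_divide_at_top[OF tendsto_const] filterlim_compose[OF sqrt_at_top np])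
  have inv_n: "(\<lambda>n. 1 / sqrt (real n)) \<longlonglongrightarrow> 0"
    by (intro real_tendsto_divide_at_top[OF tendsto_const] filterlim_compose[OF sqrt_at_top filterlim_real_sequentially])
  have sqrt_p: "(\<lambda>n. sqrt (p n)) \<longlonglongrightarrow> 0" using tendsto_real_sqrt[OF p] by simp

  \<comment> \<open>q and q6 differ by p^6, and p^6 / q6 \<le> p / c. The limit 1 also yields the
    eventual sign condition of \<open>char_Q\<close>.\<close>
  have ratio: "(\<lambda>n. rk.q n / rk.q6 n) \<longlonglongrightarrow> 1" and q_pos: "\<forall>\<^sub>F n in sequentially. rk.q n \<ge> 0"
  proof -
    have le: "\<forall>\<^sub>F n in sequentially. \<bar>rk.q n / rk.q6 n - 1\<bar> \<le> p n / c"
      using large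
    proof eventually_elim
      case (elim n)
      have "\<bar>rk.q n / rk.q6 n - 1\<bar> = p n ^ 6 / rk.q6 n" using elim by (simp add: rk.q_def field_simps)
      also have "\<dots> \<le> p n ^ 6 / (c * p n ^ 5)"
        using elim c by (intro divide_left_mono mult_pos_pos) auto
      also have "\<dots> = p n / c" using elim by (simp add: power_numeral_reduce)
      finally show ?case .
    qed
    have "(\<lambda>n. rk.q n / rk.q6 n - 1) \<longlonglongrightarrow> 0"
      using le by (intro Lim_null_comparison[OF _ tendsto_divide_zero[OF p, of c]]) simp
    then show lim: "(\<lambda>n. rk.q n / rk.q6 n) \<longlonglongrightarrow> 1" by (simp add: LIM_zero_iff)
    have "\<forall>\<^sub>F n in sequentially. rk.q n / rk.q6 n > 0" using order_tendstoD(1)[OF lim, of 0] by simp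
    with large show "\<forall>\<^sub>F n in sequentially. rk.q n \<ge> 0"
      by eventually_elim (auto simp: zero_less_divide_iff)
  qed

  have char_Z: "(\<lambda>n. \<integral>x. iexp (t * ?Z n x) \<partial>rk.P n) \<longlonglongrightarrow> ?L"
  proof -
    define \<theta> where "\<theta> = sqrt 2 * \<bar>t\<bar> / sqrt c"
    \<comment> \<open>Chosen so that t times the scaled form is \<tau> n times Q; the lower bound c
      p^5 for q6 then makes \<theta> independent of n.\<close>
    define \<tau> where "\<tau> n = t * sqrt 2 / (real n * sqrt (rk.q6 n))" for n
    define E where "E n = exp (- (\<tau> n)\<^sup>2 * rk.q n * (real n * (real n - 1)) / 4)" for n
    have close: "\<forall>\<^sub>F n in sequentially. norm ((\<integral>x. iexp (t * ?Z n x) \<partial>rk.P n) - complex_of_real (E n))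
      \<le> \<theta>^2 * sqrt (p n) + (\<theta>^2 + \<theta>^3 + \<theta>^4) * (1 / sqrt (real n))"
      using large q_pos
    proof eventually_elim
      case (elim n)
      have "\<bar>\<tau> n\<bar> * (real n * sqrt (p n) ^ 5) = sqrt 2 * \<bar>t\<bar> * (sqrt (p n) ^ 5 / sqrt (rk.q6 n))"
        using elim by (simp add: \<tau>_def abs_mult)
      also have "\<dots> \<le> sqrt 2 * \<bar>t\<bar> * (1 / sqrt c)"
        using rk.q6_lower_sqrt(2)[OF c, of n] elim c(1)
        by (intro mult_left_mono) (auto simp: field_simps)
      finally have \<theta>: "\<bar>\<tau> n\<bar> * (real n * sqrt (p n) ^ 5) \<le> \<theta>" by (simp add: \<theta>_def)
      have "t * ?Z n x = \<tau> n * rk.Q n n x" for x by (simp add: rk.scaled_form_def \<tau>_def)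
      then show ?case using rk.char_Q[OF _ _ \<theta>] elim by (simp add: E_def del: of_real_mult)
    qed
    have "(\<lambda>n. \<theta>^2 * sqrt (p n) + (\<theta>^2 + \<theta>^3 + \<theta>^4) * (1 / sqrt (real n))) \<longlonglongrightarrow> 0"
      by (intro tendsto_mult_right_zero tendsto_add_zero inv_n sqrt_p)
    from Lim_null_comparison[OF close this]
    have 1: "(\<lambda>n. (\<integral>x. iexp (t * ?Z n x) \<partial>rk.P n) - complex_of_real (E n)) \<longlonglongrightarrow> 0" .
    have "(\<lambda>n. exp (- (t^2 / 2) * (rk.q n / rk.q6 n) * (1 - 1 / real n))) \<longlonglongrightarrow> exp (- (t^2 / 2) * 1 * (1 - 0))"
      by (intro tendsto_intros ratio lim_const_over_n)
    moreover have "\<forall>\<^sub>F n in sequentially. exp (- (t^2 / 2) * (rk.q n / rk.q6 n) * (1 - 1 / real n)) = E n"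
      using large
    proof eventually_elim
      case (elim n)
      have \<tau>2: "(\<tau> n)^2 = 2 * t^2 / ((real n)^2 * rk.q6 n)" using elim by (simp add: \<tau>_def power_divide power_mult_distrib)
      have "- (\<tau> n)\<^sup>2 * rk.q n * (real n * (real n - 1)) / 4 = - (t^2 / 2) * (rk.q n / rk.q6 n) * (1 - 1 / real n)"
        unfolding \<tau>2 using elim by (simp add: field_simps power2_eq_square)
      then show ?case by (simp add: E_def)
    qed
    ultimately have "E \<longlonglongrightarrow> exp (- (t^2) / 2)" by (simp add: Lim_transform_eventually)
    then have "(\<lambda>n. complex_of_real (E n)) \<longlonglongrightarrow> ?L" by (rule tendsto_of_real)
    from tendsto_add[OF 1 this] show ?thesis by simp
  qed

  let ?B = "\<lambda>n. sqrt 2 / sqrt c * (446 * (1 / sqrt (real n * p n)) + sqrt (p n))"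
  have B: "?B \<longlonglongrightarrow> 0"
    by (intro tendsto_mult_right_zero tendsto_add_zero inv_np sqrt_p)
  have XZ: "\<forall>\<^sub>F n in sequentially. (\<integral>x. \<bar>?X n x - ?Z n x\<bar> \<partial>rk.P n) \<le> ?B n"
    using large
  proof eventually_elim
    case (elim n)
    then show ?case using rk.scaled_stat_approx[OF c(1) c(2)[of n], of n] by simp
  qed
  have conv_XZ: "conv_prob rk.P (\<lambda>n x. ?X n x - ?Z n x) 0"
  proof (rule conv_probI_L1[OF P])
    show "bdm (rk.P n) (\<lambda>x. ?X n x - ?Z n x)" for n by (intro bdm_diff bdm)
    have "\<forall>\<^sub>F n in sequentially. norm (\<integral>x. \<bar>?X n x - ?Z n x - 0\<bar> \<partial>rk.P n) \<le> ?B n"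
      using XZ by eventually_elim simp
    then show "(\<lambda>n. \<integral>x. \<bar>?X n x - ?Z n x - 0\<bar> \<partial>rk.P n) \<longlonglongrightarrow> 0" by (rule Lim_null_comparison) (rule B)
  qed
  have char_X: "(\<lambda>n. \<integral>x. iexp (t * ?X n x) \<partial>rk.P n) \<longlonglongrightarrow> ?L"
    by (rule char_conv_prob[OF P meas(1) meas(2) conv_XZ char_Z])

  have edge: "conv_prob rk.P (\<lambda>n. rk.edge_ratio n n) 1"
  proof (rule conv_probI_L1[OF P bdm(3)])
    have "\<forall>\<^sub>F n in sequentially. norm (\<integral>x. \<bar>rk.edge_ratio n n x - 1\<bar> \<partial>rk.P n) \<le> 4 * (1 / sqrt (real n * p n))"
      using large
    proof eventually_elim
      case (elim n)
      then show ?case using rk.edge_ratio_moment[of n n] by simp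
    qed
    then show "(\<lambda>n. \<integral>x. \<bar>rk.edge_ratio n n x - 1\<bar> \<partial>rk.P n) \<longlonglongrightarrow> 0"
      by (rule Lim_null_comparison) (rule tendsto_mult_right_zero[OF inv_np])
  qed
  have cycle: "conv_prob rk.P (\<lambda>n. rk.cycle_ratio n n) 1"
  proof (rule conv_probI_L1[OF P bdm(4)])
    let ?b = "\<lambda>n. sqrt (605052 / c) * (1 / sqrt (real n)) + \<bar>real (card (distinct_tuples n 6)) / real n ^ 6 - 1\<bar>"
    have "\<forall>\<^sub>F n in sequentially. norm (\<integral>x. \<bar>rk.cycle_ratio n n x - 1\<bar> \<partial>rk.P n) \<le> ?b n"
      using large
    proof eventually_elim
      case (elim n)
      then show ?case using rk.cycle_ratio_moment[OF c(1) c(2)[of n], of n]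
        by (simp add: real_sqrt_divide real_sqrt_mult)
    qed
    moreover have "?b \<longlonglongrightarrow> 0"
    proof -
      have "(\<lambda>n. \<bar>real (card (distinct_tuples n 6)) / real n ^ 6 - 1\<bar>) \<longlonglongrightarrow> \<bar>1 - 1\<bar>"
        by (intro tendsto_intros card_distinct_tuples_ratio)
      then have "(\<lambda>n. \<bar>real (card (distinct_tuples n 6)) / real n ^ 6 - 1\<bar>) \<longlonglongrightarrow> 0" by simp
      then show ?thesis by (intro tendsto_add_zero tendsto_mult_right_zero inv_n)
    qed
    ultimately show "(\<lambda>n. \<integral>x. \<bar>rk.cycle_ratio n n x - 1\<bar> \<partial>rk.P n) \<longlonglongrightarrow> 0"
      by (rule Lim_null_comparison)
  qed
  let ?U = "\<lambda>n x. 1 / (rk.edge_ratio n n x * sqrt (rk.cycle_ratio n n x))"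
  have U: "conv_prob rk.P ?U 1"
  proof -
    have "isCont (\<lambda>z::real \<times> real. 1 / (fst z * sqrt (snd z))) (1, 1)"
      by (intro continuous_intros) auto
    from conv_prob_isCont[OF P meas(3) meas(4) edge cycle this] show ?thesis by simp
  qed
  \<comment> \<open>This L1 bound is the tightness that allows multiplication by the random
    factor.\<close>
  have tight: "\<forall>\<^sub>F n in sequentially. (\<integral>x. \<bar>?X n x\<bar> \<partial>rk.P n) \<le> sqrt 2 / sqrt c + 1"
  proof -
    have "\<forall>\<^sub>F n in sequentially. ?B n < 1" using order_tendstoD(2)[OF B, of 1] by simp
    with large XZ show ?thesis
    proof eventually_elim
      case (elim n)
      have "(\<integral>x. \<bar>?X n x\<bar> \<partial>rk.P n) \<le> (\<integral>x. \<bar>?Z n x\<bar> + \<bar>?X n x - ?Z n x\<bar> \<partial>rk.P n)"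
        by (intro integral_mono prob_space.bdm_integrable[OF P] bdm_intros bdm) linarith
      also have "\<dots> = (\<integral>x. \<bar>?Z n x\<bar> \<partial>rk.P n) + (\<integral>x. \<bar>?X n x - ?Z n x\<bar> \<partial>rk.P n)"
        by (intro Bochner_Integration.integral_add prob_space.bdm_integrable[OF P] bdm_intros bdm)
      also have "\<dots> \<le> sqrt 2 / sqrt c + 1"
        using elim rk.scaled_form_abs_moment[OF c(1) c(2)[of n], of n] by linarith
      finally show ?case .
    qed
  qed
  have meas_U: "?U n \<in> borel_measurable (rk.P n)" for n by measurable
  have conv: "conv_prob rk.P (\<lambda>n x. ?X n x * ?U n x - ?X n x) 0"
    by (rule conv_prob_mult_tight[OF P bdm(2) meas_U tight U])
  have "(\<lambda>n. \<integral>x. iexp (t * (?X n x * ?U n x)) \<partial>rk.P n) \<longlonglongrightarrow> ?L"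
    by (rule char_conv_prob[OF P meas(2) _ conv char_X]) measurable
  moreover have "\<forall>\<^sub>F n in sequentially. (\<integral>x. iexp (t * (?X n x * ?U n x)) \<partial>rk.P n) =
    (\<integral>x. iexp (t * normalised_stat n (rk.adj n x)) \<partial>rk.P n)"
    using large
  proof eventually_elim
    case (elim n)
    then have "?X n x * ?U n x = normalised_stat n (rk.adj n x)" for x
      using rk.normalised_stat_factor[of n n x] by simp
    then show ?case by (simp only:)
  qed
  ultimately show ?thesis by (rule Lim_transform_eventually)
qed

section \<open>The torus kernel\<close>

text \<open>V is meant to be adjacency at half the radius. Points with a common V-neighbour v are
  both W-adjacent to the whole V-ball of v, so w2 \<ge> p' there. Another integration over a V-ball
  gives w3 \<ge> p'^2 on V-adjacent pairs, and squaring and integrating over one more V-ball gives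
  p'^5.\<close>

lemma (in regular_kernel) q6_lower:
  assumes V: "regular_kernel F V p'" and tri: "\<And>x y z. V x y = 1 \<Longrightarrow> V x z = 1 \<Longrightarrow> W y z = 1"
    and refl: "\<And>x. V x x = 1"
  shows "p' ^ 5 \<le> q6"
proof -
  interpret V: regular_kernel F V p' by (rule V)
  have VW: "V x y = 1 \<Longrightarrow> W x y = 1" for x y using tri[OF refl] .
  have V01: "V x y = 0 \<or> V x y = 1" for x y using V.W_01[of x y] by auto
  have w2: "p' \<le> w2 x y" if "V v x = 1" "V v y = 1" for v x y
  proof -
    have "p' = (\<integral>z. V v z \<partial>F)" by (simp add: V.W_mass)
    also have "\<dots> \<le> (\<integral>z. W x z * W z y \<partial>F)"
    proof (intro integral_mono F.bdm_integrable bdm_intros V.bdm_kernels)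
      fix z
      show "V v z \<le> W x z * W z y"
        using V01[of v z] tri[of v x z] tri[of v z y] that W_bounds by (auto intro!: mult_nonneg_nonneg)
    qed
    finally show ?thesis by (simp add: w2_def kcomp_def)
  qed
  have w3: "V x y * p' ^ 2 \<le> w3 x y" for x y
  proof (cases "V x y = 1")
    case True
    have "V x y * p' ^ 2 = (\<integral>z. V x z * p' \<partial>F)" using True by (simp add: V.W_mass power2_eq_square)
    also have "\<dots> \<le> (\<integral>z. W x z * w2 z y \<partial>F)"
    proof (intro integral_mono F.bdm_integrable bdm_intros V.bdm_kernels)
      fix z
      show "V x z * p' \<le> W x z * w2 z y"
        using V01[of x z] VW[of x z] w2[of x z y] True W_bounds regD(2)[OF reg_w2] by (auto intro!: mult_nonneg_nonneg)
    qed
    finally show ?thesis by (simp add: w3_def kcomp_def)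
  next
    case False
    then show ?thesis using V01[of x y] regD(2)[OF reg_w3] by simp
  qed
  have "p' ^ 5 = (\<integral>x. (\<integral>y. V x y * p' ^ 4 \<partial>F) \<partial>F)"
    by (simp add: V.W_mass numeral_eq_Suc)
  also have "\<dots> \<le> (\<integral>x. w6 x x \<partial>F)"
  proof (intro integral_mono F.bdm_integrable)
    show "bdm F (\<lambda>x. \<integral>y. V x y * p' ^ 4 \<partial>F)" by (simp add: V.W_mass bdm_const)
    show "bdm F (\<lambda>x. w6 x x)" by (intro bdm_intros)
    fix x
    have "(\<integral>y. V x y * p' ^ 4 \<partial>F) \<le> (\<integral>y. w3 x y * w3 y x \<partial>F)"
    proof (intro integral_mono F.bdm_integrable bdm_intros V.bdm_kernels)
      fix y
      have "V x y * p' ^ 4 = (V x y * p' ^ 2) * (V x y * p' ^ 2)"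
        using V.W_bounds(3)[of x y] by (simp add: algebra_simps numeral_eq_Suc)
      also have "\<dots> \<le> w3 x y * w3 x y"
        using w3[of x y] V.W_bounds V.p_bounds regD(2)[OF reg_w3] by (intro mult_mono) auto
      finally show "V x y * p' ^ 4 \<le> w3 x y * w3 y x" using regD(4)[OF reg_w3] by metis
    qed
    then show "(\<integral>y. V x y * p' ^ 4 \<partial>F) \<le> w6 x x" by (simp add: w6_def kcomp_def)
  qed
  finally show ?thesis by (simp add: q6_def)
qed

section \<open>Arcs, boxes and the uniform measure on the cube\<close>

abbreviation circle_dist :: "real \<Rightarrow> real \<Rightarrow> real" where
  "circle_dist s t \<equiv> min \<bar>s - t\<bar> (1 - \<bar>s - t\<bar>)"

text \<open>Near an end of the unit interval the arc wraps around and splits into two intervals. The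
  radius below 1/2 keeps them disjoint, so the length does not depend on the centre.\<close>

lemma circle_ball_measure:
  assumes u: "0 \<le> u" "u \<le> 1" and \<rho>: "0 < \<rho>" "\<rho> < 1/2"
  shows "emeasure lborel {t. 0 \<le> t \<and> t \<le> 1 \<and> circle_dist u t \<le> \<rho>} = ennreal (2 * \<rho>)"
proof -
  have two: "emeasure lborel ({x..y} \<union> {z..w}) = ennreal ((y - x) + (w - z))"
    if "x \<le> y" "y < z" "z \<le> w" for x y z w :: real
  proof -
    have "emeasure lborel ({x..y} \<union> {z..w}) = emeasure lborel {x..y} + emeasure lborel {z..w}"
      using that by (intro plus_emeasure[symmetric]) auto
    then show ?thesis using that by (simp add: ennreal_plus[symmetric] del: ennreal_plus)
  qed
  consider "u \<le> \<rho>" | "1 - \<rho> \<le> u" | "\<rho> < u" "u < 1 - \<rho>" by linarith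
  then show ?thesis
  proof cases
    case 1
    have "{t. 0 \<le> t \<and> t \<le> 1 \<and> circle_dist u t \<le> \<rho>} = {0..u + \<rho>} \<union> {u + 1 - \<rho>..1}"
      using 1 u \<rho> by (auto simp: min_def abs_if split: if_splits)
    then show ?thesis using two[of 0 "u + \<rho>" "u + 1 - \<rho>" 1] 1 u \<rho> by simp
  next
    case 2
    have "{t. 0 \<le> t \<and> t \<le> 1 \<and> circle_dist u t \<le> \<rho>} = {0..u - 1 + \<rho>} \<union> {u - \<rho>..1}"
      using 2 u \<rho> by (auto simp: min_def abs_if split: if_splits)
    then show ?thesis using two[of 0 "u - 1 + \<rho>" "u - \<rho>" 1] 2 u \<rho> by simp
  next
    case 3
    have "{t. 0 \<le> t \<and> t \<le> 1 \<and> circle_dist u t \<le> \<rho>} = {u - \<rho>..u + \<rho>}"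
      using 3 u \<rho> by (auto simp: min_def abs_if split: if_splits)
    then show ?thesis using \<rho> by simp
  qed
qed

lemma circle_dist_triangle:
  assumes "circle_dist s t \<le> \<rho> / 2" "circle_dist s v \<le> \<rho> / 2"
    and "0 \<le> t" "t \<le> 1" "0 \<le> v" "v \<le> 1" "0 \<le> s" "s \<le> 1"
  shows "circle_dist t v \<le> \<rho>"
  using assms by (simp add: min_def abs_if split: if_splits)

lemma torus_dist_le_iff:
  fixes x y :: "real ^ 'm"
  shows "torus_dist x y \<le> \<rho> \<longleftrightarrow> (\<forall>k. circle_dist (x $ k) (y $ k) \<le> \<rho>)"
  unfolding torus_dist_def by (subst Max_le_iff) auto

lemma all_Basis_vec: "(\<forall>b\<in>Basis. P (x \<bullet> b) (y \<bullet> b)) \<longleftrightarrow> (\<forall>k. P (x $ k) (y $ k))" for x y :: "real ^ 'm"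
  by (auto simp: Basis_vec_def inner_axis)

text \<open>The indicator of a box is a product of one-dimensional indicators, so its volume
  factors.\<close>

lemma emeasure_lborel_product:
  fixes A :: "'a::euclidean_space \<Rightarrow> real set"
  assumes [measurable]: "\<And>b. A b \<in> sets borel"
  shows "emeasure lborel {x. \<forall>b\<in>Basis. x \<bullet> b \<in> A b} = (\<Prod>b\<in>Basis. emeasure lborel (A b))"
proof -
  have [measurable]: "{x. \<forall>b\<in>Basis. x \<bullet> b \<in> A b} \<in> sets borel" by measurable
  have "emeasure lborel {x. \<forall>b\<in>Basis. x \<bullet> b \<in> A b} = (\<integral>\<^sup>+x. indicator {x. \<forall>b\<in>Basis. x \<bullet> b \<in> A b} x \<partial>lborel)"
    by simp
  also have "\<dots> = (\<integral>\<^sup>+x. (\<Prod>b\<in>Basis. indicator (A b) (x \<bullet> b)) \<partial>lborel)"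
  proof (rule nn_integral_cong)
    fix x :: 'a
    show "indicator {x. \<forall>b\<in>Basis. x \<bullet> b \<in> A b} x = (\<Prod>b\<in>Basis. indicator (A b) (x \<bullet> b) :: ennreal)"
    proof (cases "\<forall>b\<in>Basis. x \<bullet> b \<in> A b")
      case False
      then obtain b where "b \<in> Basis" "x \<bullet> b \<notin> A b" by auto
      then have "(\<Prod>b\<in>Basis. indicator (A b) (x \<bullet> b) :: ennreal) = 0" by (intro prod_zero bexI[of _ b]) auto
      with False show ?thesis by simp
    qed simp
  qed
  also have "\<dots> = (\<Prod>b\<in>Basis. emeasure lborel (A b))"
    by (subst nn_integral_lborel_prod) simp_all
  finally show ?thesis .
qed

lemma unit_cube_Basis: "(unit_cube :: (real ^ 'm) set) = {x. \<forall>b\<in>Basis. x \<bullet> b \<in> {0..1}}"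
  unfolding unit_cube_def using all_Basis_vec[of "\<lambda>u _. u \<in> {0..1}"] by (auto simp del: atLeastAtMost_iff) (auto)

lemma unit_cube_borel [measurable]: "(unit_cube :: (real ^ 'm) set) \<in> sets borel"
  unfolding unit_cube_Basis by measurable

lemma emeasure_unit_cube: "emeasure lborel (unit_cube :: (real ^ 'm) set) = 1"
  unfolding unit_cube_Basis by (subst emeasure_lborel_product) auto

definition cube_proj :: "real ^ 'm \<Rightarrow> real ^ 'm" where
  "cube_proj x = (if x \<in> unit_cube then x else 0)"

text \<open>Points outside the cube are null, but there \<open>torus_dist\<close> can be negative; moving them to the
  origin makes every point of the space have exactly the same degree.\<close>

definition torus_kernel :: "real \<Rightarrow> real ^ 'm \<Rightarrow> real ^ 'm \<Rightarrow> real" where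
  "torus_kernel \<rho> x y = (if torus_dist (cube_proj x) (cube_proj y) \<le> \<rho> then 1 else 0)"

lemma cube_proj_bounds: "0 \<le> cube_proj x $ k" "cube_proj x $ k \<le> 1"
  by (auto simp: cube_proj_def unit_cube_def)

lemma cube_proj_measurable [measurable]: "cube_proj \<in> borel_measurable borel"
  unfolding cube_proj_def by measurable

lemma torus_dist_le_measurable:
  assumes [measurable]: "f \<in> borel_measurable N" "g \<in> borel_measurable N"
  shows "Measurable.pred N (\<lambda>x. torus_dist (f x) (g x :: real ^ 'm) \<le> \<rho>)"
  unfolding torus_dist_le_iff all_Basis_vec[of "\<lambda>s t. circle_dist s t \<le> \<rho>", symmetric] by measurable

lemma regular_kernel_torus:
  assumes \<rho>: "0 < \<rho>" "\<rho> < 1/2"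
  shows "regular_kernel (uniform_measure lborel unit_cube) (torus_kernel \<rho> :: real ^ 'm \<Rightarrow> _) ((2 * \<rho>) ^ CARD('m))"
proof -
  let ?F = "uniform_measure lborel unit_cube :: (real ^ 'm) measure"
  interpret F: prob_space ?F
    by (rule prob_space_uniform_measure) (simp_all add: emeasure_unit_cube)
  show ?thesis
  proof
    show "space ?F = UNIV" by simp
    show "(\<lambda>(x, y). torus_kernel \<rho> x y) \<in> borel_measurable (?F \<Otimes>\<^sub>M ?F)"
    proof -
      have "Measurable.pred (borel \<Otimes>\<^sub>M borel) (\<lambda>z. torus_dist (cube_proj (fst z)) (cube_proj (snd z) :: real ^ 'm) \<le> \<rho>)"
        by (intro torus_dist_le_measurable) measurable
      then have "(\<lambda>z. torus_kernel \<rho> (fst z) (snd z :: real ^ 'm)) \<in> borel_measurable (borel \<Otimes>\<^sub>M borel)"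
        unfolding torus_kernel_def by measurable
      moreover have "sets (?F \<Otimes>\<^sub>M ?F) = sets (borel \<Otimes>\<^sub>M borel)" by (intro sets_pair_measure_cong) simp_all
      ultimately show ?thesis by (simp add: split_beta' cong: measurable_cong_sets)
    qed
    show "torus_kernel \<rho> x y \<in> {0, 1}" for x y :: "real ^ 'm" by (simp add: torus_kernel_def)
    show "torus_kernel \<rho> x y = torus_kernel \<rho> y x" for x y :: "real ^ 'm"
      by (simp add: torus_kernel_def torus_dist_le_iff abs_minus_commute)
    show "(\<integral>y. torus_kernel \<rho> x y \<partial>?F) = (2 * \<rho>) ^ CARD('m)" for x :: "real ^ 'm"
    proof -
      define x' where "x' = cube_proj x"
      let ?A = "{y. torus_dist x' (cube_proj y) \<le> \<rho>}"
      have A: "?A \<in> sets borel"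
        using torus_dist_le_measurable[of "\<lambda>_. x'" borel cube_proj \<rho>] by simp
      have "(\<integral>y. torus_kernel \<rho> x y \<partial>?F) = (\<integral>y. indicator ?A y \<partial>?F)"
        by (intro Bochner_Integration.integral_cong) (auto simp: torus_kernel_def x'_def indicator_def)
      also have "\<dots> = measure ?F ?A" by simp
      also have "emeasure ?F ?A = emeasure lborel (unit_cube \<inter> ?A)"
        using A by (subst emeasure_uniform_measure) (auto simp: emeasure_unit_cube divide_ennreal_def)
      then have "measure ?F ?A = measure lborel (unit_cube \<inter> ?A)" by (simp add: measure_def)
      \<comment> \<open>On the cube the projection is the identity, and the ball becomes a product
        of arcs.\<close>
      also have "unit_cube \<inter> ?A = {y. \<forall>b\<in>Basis. y \<bullet> b \<in> {t. 0 \<le> t \<and> t \<le> 1 \<and> circle_dist (x' \<bullet> b) t \<le> \<rho>}}"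
        unfolding mem_Collect_eq all_Basis_vec[of "\<lambda>s t. 0 \<le> t \<and> t \<le> 1 \<and> circle_dist s t \<le> \<rho>"]
        by (auto simp: unit_cube_def cube_proj_def torus_dist_le_iff)
      also have "measure lborel \<dots> = (2 * \<rho>) ^ CARD('m)"
      proof -
        have *: "emeasure lborel {t. 0 \<le> t \<and> t \<le> 1 \<and> circle_dist (x' \<bullet> b) t \<le> \<rho>} = ennreal (2 * \<rho>)" if "b \<in> Basis" for b
        proof -
          have "\<forall>b\<in>Basis. 0 \<le> x' \<bullet> b \<and> x' \<bullet> b \<le> 1"
            using all_Basis_vec[of "\<lambda>s _. 0 \<le> s \<and> s \<le> 1" x' x'] cube_proj_bounds[of x] by (simp add: x'_def)
          then show ?thesis using that by (intro circle_ball_measure \<rho>) auto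
        qed
        have "emeasure lborel {y. \<forall>b\<in>Basis. y \<bullet> b \<in> {t. 0 \<le> t \<and> t \<le> 1 \<and> circle_dist (x' \<bullet> b) t \<le> \<rho>}}
          = (\<Prod>b\<in>(Basis :: (real ^ 'm) set). ennreal (2 * \<rho>))"
          by (subst emeasure_lborel_product) (use * in \<open>auto intro!: prod.cong\<close>)
        also have "\<dots> = ennreal ((2 * \<rho>) ^ CARD('m))" using \<rho> by (simp add: ennreal_power)
        finally show ?thesis using \<rho> by (simp add: measure_def)
      qed
      finally show ?thesis .
    qed
  qed
qed

text \<open>Halving the radius divides the degree by 2^m; the fifth power of this loss is the
  constant.\<close>

lemma torus_kernel_q6:
  fixes F :: "(real ^ 'm) measure"
  assumes \<rho>: "0 < \<rho>" "\<rho> < 1/2" and F: "F = uniform_measure lborel unit_cube"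
  shows "(1 / 2 ^ CARD('m)) ^ 5 * ((2 * \<rho>) ^ CARD('m)) ^ 5 \<le> regular_kernel.q6 F (torus_kernel \<rho>)"
proof -
  interpret regular_kernel F "torus_kernel \<rho>" "(2 * \<rho>) ^ CARD('m)"
    unfolding F by (rule regular_kernel_torus[OF \<rho>])
  have "((2 * (\<rho> / 2)) ^ CARD('m)) ^ 5 \<le> q6"
  proof (rule q6_lower)
    show "regular_kernel F (torus_kernel (\<rho> / 2)) ((2 * (\<rho> / 2)) ^ CARD('m))"
      unfolding F by (rule regular_kernel_torus) (use \<rho> in auto)
    show "torus_kernel (\<rho> / 2) x x = 1" for x :: "real ^ 'm"
    proof -
      have "torus_dist (cube_proj x) (cube_proj x) \<le> \<rho> / 2" unfolding torus_dist_le_iff using \<rho> by simp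
      then show ?thesis by (simp only: torus_kernel_def if_True)
    qed
    show "torus_kernel \<rho> y z = 1" if "torus_kernel (\<rho> / 2) x y = 1" "torus_kernel (\<rho> / 2) x z = 1" for x y z :: "real ^ 'm"
    proof -
      have "torus_dist (cube_proj x) (cube_proj y) \<le> \<rho> / 2" "torus_dist (cube_proj x) (cube_proj z) \<le> \<rho> / 2"
        using that by (auto simp: torus_kernel_def split: if_splits)
      then have "circle_dist (cube_proj x $ k) (cube_proj y $ k) \<le> \<rho> / 2" "circle_dist (cube_proj x $ k) (cube_proj z $ k) \<le> \<rho> / 2" for k
        unfolding torus_dist_le_iff by blast+
      then have "circle_dist (cube_proj y $ k) (cube_proj z $ k) \<le> \<rho>" for k
        by (rule circle_dist_triangle) (rule cube_proj_bounds)+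
      then show ?thesis by (simp add: torus_kernel_def torus_dist_le_iff)
    qed
  qed
  then show ?thesis by (simp add: power_mult_distrib power_divide)
qed

section \<open>Transfer from the random graph to the product space\<close>

lemma normalised_stat_cong:
  assumes "\<And>i j. i \<in> {1..n} \<Longrightarrow> j \<in> {1..n} \<Longrightarrow> A i j = B i j"
  shows "normalised_stat n A = normalised_stat n B"
proof -
  have *: "A (v!i) (v!j) = B (v!i) (v!j)" if "v \<in> distinct_tuples n t" "i < t" "j < t" for v t i j
  proof -
    from that have "v ! i \<in> set v" "v ! j \<in> set v" "set v \<subseteq> {1..n}" by (auto simp: distinct_tuples_def)
    then show ?thesis by (intro assms) blast+
  qed
  have "(\<Sum>v\<in>distinct_tuples n 2. A (v!0) (v!1)) = (\<Sum>v\<in>distinct_tuples n 2. B (v!0) (v!1))"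
    "(\<Sum>v\<in>distinct_tuples n 3. A (v!0) (v!1) * A (v!1) (v!2)) = (\<Sum>v\<in>distinct_tuples n 3. B (v!0) (v!1) * B (v!1) (v!2))"
    "(\<Sum>v\<in>distinct_tuples n 4. A (v!0) (v!1) * A (v!1) (v!2) * A (v!2) (v!3)) =
     (\<Sum>v\<in>distinct_tuples n 4. B (v!0) (v!1) * B (v!1) (v!2) * B (v!2) (v!3))"
    "(\<Sum>v\<in>distinct_tuples n 6. A (v!0) (v!1) * A (v!1) (v!2) * A (v!2) (v!3) * A (v!3) (v!4) * A (v!4) (v!5) * A (v!5) (v!0)) =
     (\<Sum>v\<in>distinct_tuples n 6. B (v!0) (v!1) * B (v!1) (v!2) * B (v!2) (v!3) * B (v!3) (v!4) * B (v!4) (v!5) * B (v!5) (v!0))"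
    by (intro sum.cong refl arg_cong2[where f="(*)"] *[where t=2] *[where t=3] *[where t=4] *[where t=6]; simp)+
  then show ?thesis by (simp only: normalised_stat_def T_stat_def A_bar_def sigma_hat2_def)
qed

lemma measurable_normalised_stat_rgg:
  fixes X :: "nat \<Rightarrow> 'a \<Rightarrow> real ^ 'm"
  assumes "random_geometric_graph M F n r X"
  shows "(\<lambda>\<omega>. normalised_stat n (rgg_adjacency r X \<omega>)) \<in> borel_measurable M"
proof -
  interpret random_geometric_graph M F n r X by fact
  \<comment> \<open>Only the points with index in {1..n} are known to be measurable, so all other
    entries are replaced by 0; the statistic never reads them.\<close>
  define B where "B i j \<omega> = (if i \<in> {1..n} \<and> j \<in> {1..n} then rgg_adjacency r X \<omega> i j else 0)" for i j \<omega>
  have [measurable]: "B i j \<in> borel_measurable M" for i j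
  proof (cases "i \<in> {1..n} \<and> j \<in> {1..n}")
    case True
    then have "X i \<in> borel_measurable M" "X j \<in> borel_measurable M"
      using indep unfolding indep_vars_def by auto
    then have [measurable]: "Measurable.pred M (\<lambda>\<omega>. torus_dist (X i \<omega>) (X j \<omega>) \<le> r)"
      by (rule torus_dist_le_measurable)
    show ?thesis using True unfolding B_def rgg_adjacency_def by simp
  next
    case False
    then have "B i j = (\<lambda>\<omega>. 0)" by (auto simp: B_def fun_eq_iff)
    then show ?thesis by simp
  qed
  have "normalised_stat n (rgg_adjacency r X \<omega>) = normalised_stat n (\<lambda>i j. B i j \<omega>)" for \<omega>
    by (rule normalised_stat_cong) (simp add: B_def)
  moreover have "(\<lambda>\<omega>. normalised_stat n (\<lambda>i j. B i j \<omega>)) \<in> borel_measurable M"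
    unfolding normalised_stat_def T_stat_def A_bar_def sigma_hat2_def by measurable
  ultimately show ?thesis by simp
qed

text \<open>The statistic is a function of the first n points, whose joint law is a finite product
  of copies of F. That product is reached from the graph by independence and from the infinite
  product by restriction.\<close>

lemma char_normalised_stat_rgg:
  fixes X :: "nat \<Rightarrow> 'a \<Rightarrow> real ^ 'm"
  assumes rgg: "random_geometric_graph M F n r X" and n: "n > 0" and F: "F = uniform_measure lborel unit_cube"
  shows "(\<integral>\<omega>. iexp (t * normalised_stat n (rgg_adjacency r X \<omega>)) \<partial>M) =
    (\<integral>x. iexp (t * normalised_stat n (regular_kernel.adj (torus_kernel r) x)) \<partial>iid_sample.P F)"
proof -
  interpret R: random_geometric_graph M F n r X by (rule rgg)
  interpret regular_kernel F "torus_kernel r" "(2 * r) ^ CARD('m)"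
    unfolding F by (rule regular_kernel_torus) (use R.radius in auto)
  let ?I = "{1..n}" and ?s = "\<lambda>\<omega>. normalised_stat n (rgg_adjacency r X \<omega>)"
  let ?B = "\<Pi>\<^sub>M i\<in>?I. (borel :: (real ^ 'm) measure)"
  define g where "g x = iexp (t * normalised_stat n (adj x))" for x
  \<comment> \<open>Pads a finite tuple to a sequence; the filler 0 is invisible to the statistic,
    which reads indices in {1..n} only.\<close>
  define emb where "emb x i = (if i \<in> ?I then x i else 0)" for x :: "nat \<Rightarrow> real ^ 'm" and i
  have g_meas [measurable]: "g \<in> borel_measurable P"
  proof -
    have [measurable]: "(\<lambda>x. normalised_stat n (adj x)) \<in> borel_measurable P" by (rule measurable_normalised_stat)
    show ?thesis unfolding g_def by measurable
  qed
  have X_meas: "X i \<in> borel_measurable M" if "i \<in> ?I" for i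
    using R.indep that unfolding R.indep_vars_def by auto
  have sP: "sets P = sets (\<Pi>\<^sub>M i\<in>UNIV. (borel :: (real ^ 'm) measure))"
    unfolding sets_P by (intro sets_PiM_cong) (simp_all add: R.sets_F)
  have sI: "sets (\<Pi>\<^sub>M i\<in>?I. F) = sets ?B"
    by (intro sets_PiM_cong) (simp_all add: R.sets_F)
  have emb_meas: "emb \<in> measurable ?B P"
  proof -
    have "emb \<in> measurable ?B (\<Pi>\<^sub>M i\<in>UNIV. (borel :: (real ^ 'm) measure))"
    proof (rule measurable_PiM_single')
      fix i show "(\<lambda>x. emb x i) \<in> borel_measurable ?B"
      proof (cases "i \<in> ?I")
        case True
        then have "(\<lambda>x. emb x i) = (\<lambda>x. x i)" by (auto simp: emb_def)
        then show ?thesis using True by (simp only:) (rule measurable_component_singleton)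
      next
        case False
        then have "(\<lambda>x. emb x i) = (\<lambda>x. 0)" by (auto simp: emb_def fun_eq_iff)
        then show ?thesis by (simp only: measurable_const UNIV_I space_borel)
      qed
    qed (auto simp: PiE_def)
    then show ?thesis by (simp add: sP cong: measurable_cong_sets)
  qed
  have emb_meas': "emb \<in> measurable (\<Pi>\<^sub>M i\<in>?I. F) P"
    using emb_meas by (simp only: measurable_cong_sets[OF sI refl])
  have g_emb: "g (emb x) = g y" if "\<And>i. i \<in> ?I \<Longrightarrow> x i = y i" for x y
    unfolding g_def using that by (intro arg_cong[of _ _ "\<lambda>u. iexp (t * u)"] normalised_stat_cong) (simp add: adj_def emb_def)
  \<comment> \<open>Almost surely all points lie in the cube, where \<open>cube_proj\<close> is the
    identity and the graph agrees with the kernel.\<close>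
  have ae: "AE \<omega> in M. \<forall>i\<in>?I. X i \<omega> \<in> unit_cube"
  proof (rule AE_finite_allI)
    fix i assume i: "i \<in> ?I"
    have "AE x in distr M borel (X i). x \<in> unit_cube" unfolding R.distr[OF i] by (rule R.F_unit_cube)
    then show "AE \<omega> in M. X i \<omega> \<in> unit_cube" using X_meas[OF i] by (subst (asm) AE_distr_iff) auto
  qed simp
  let ?L = "\<lambda>\<omega>. \<lambda>i\<in>?I. X i \<omega>"
  have L_meas: "?L \<in> measurable M ?B"
    by (intro measurable_restrict X_meas)
  have "(\<integral>\<omega>. iexp (t * ?s \<omega>) \<partial>M) = (\<integral>\<omega>. g (emb (?L \<omega>)) \<partial>M)"
  proof (rule integral_cong_AE)
    have [measurable]: "(\<lambda>\<omega>. ?s \<omega>) \<in> borel_measurable M"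
      by (rule measurable_normalised_stat_rgg[OF rgg])
    show "(\<lambda>\<omega>. iexp (t * ?s \<omega>)) \<in> borel_measurable M" by measurable
    show "(\<lambda>\<omega>. g (emb (?L \<omega>))) \<in> borel_measurable M"
      using measurable_compose[OF measurable_compose[OF L_meas emb_meas] g_meas] .
    show "AE \<omega> in M. iexp (t * ?s \<omega>) = g (emb (?L \<omega>))"
      using ae
    proof eventually_elim
      case (elim \<omega>)
      have "?s \<omega> = normalised_stat n (adj (emb (?L \<omega>)))"
        using elim by (intro normalised_stat_cong)
          (auto simp: rgg_adjacency_def adj_def torus_kernel_def cube_proj_def emb_def)
      then show ?case by (simp add: g_def)
    qed
  qed
  also have "\<dots> = (\<integral>y. g (emb y) \<partial>distr M ?B ?L)"
    by (rule integral_distr[symmetric]) (rule L_meas, rule measurable_compose[OF emb_meas g_meas])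
  also have "distr M ?B ?L = (\<Pi>\<^sub>M i\<in>?I. F)"
  proof -
    \<comment> \<open>Independence is read off the joint law for a nonempty index set, which n > 0
      provides.\<close>
    have "distr M ?B ?L = (\<Pi>\<^sub>M i\<in>?I. distr M borel (X i))"
      using R.indep_vars_iff_distr_eq_PiM'[of ?I X "\<lambda>_. borel"] R.indep X_meas n by simp
    also have "\<dots> = (\<Pi>\<^sub>M i\<in>?I. F)" by (intro PiM_cong refl R.distr)
    finally show ?thesis .
  qed
  also have "(\<Pi>\<^sub>M i\<in>?I. F) = distr P (\<Pi>\<^sub>M i\<in>?I. F) (\<lambda>x. restrict x ?I)"
  proof -
    interpret PF: product_prob_space "\<lambda>_::nat. F" UNIV
      by (intro product_prob_spaceI R.F.prob_space_axioms)
    show ?thesis using PF.distr_PiM_restrict_finite[of ?I] by (simp add: P_def)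
  qed
  also have "(\<integral>y. g (emb y) \<partial>\<dots>) = (\<integral>x. g (emb (restrict x ?I)) \<partial>P)"
  proof (rule integral_distr)
    show "(\<lambda>x. restrict x ?I) \<in> measurable P (\<Pi>\<^sub>M i\<in>?I. F)"
      unfolding P_def by (rule measurable_restrict_subset) simp
    show "(\<lambda>y. g (emb y)) \<in> borel_measurable (\<Pi>\<^sub>M i\<in>?I. F)"
      by (rule measurable_compose[OF emb_meas' g_meas])
  qed
  also have "\<dots> = (\<integral>x. g x \<partial>P)"
    by (intro Bochner_Integration.integral_cong refl g_emb) simp
  finally show ?thesis by (simp add: g_def)
qed

theorem theorem3p2:
  fixes M :: "nat \<Rightarrow> 'a measure"
    and F :: "(real ^ 'm) measure"
    and r :: "nat \<Rightarrow> real"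
    and X :: "nat \<Rightarrow> nat \<Rightarrow> 'a \<Rightarrow> real ^ 'm"
    and A :: "nat \<Rightarrow> 'a \<Rightarrow> nat \<Rightarrow> nat \<Rightarrow> real"
  assumes "\<And>n. random_geometric_graph (M n) F n (r n) (X n)"
    and "\<And>n \<omega>. A n \<omega> = rgg_adjacency (r n) (X n) \<omega>"
    and "r \<in> o(\<lambda>_. 1)"
    and "(\<lambda>n. real n * r n ^ CARD('m)) \<in> \<omega>(\<lambda>_. 1)"
    and H0: "F = uniform_measure lborel unit_cube"
  shows "weak_conv_m
           (\<lambda>n. distr (M n) borel
              (\<lambda>\<omega>. sqrt 2 * T_stat n (A n \<omega>)
                     / (real n ^ 5 * A_bar n (A n \<omega>) * sigma_hat2 n (A n \<omega>))))
           std_normal_distribution"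
proof -
  define f where "f n \<omega> = normalised_stat n (rgg_adjacency (r n) (X n) \<omega>)" for n \<omega>
  have f_eq: "(\<lambda>\<omega>. sqrt 2 * T_stat n (A n \<omega>) / (real n ^ 5 * A_bar n (A n \<omega>) * sigma_hat2 n (A n \<omega>))) = f n" for n
    by (simp add: f_def normalised_stat_def assms(2) fun_eq_iff)
  have rad: "0 < r n" "r n < 1/2" for n using random_geometric_graph.radius[OF assms(1)] by auto
  have f_meas [measurable]: "f n \<in> borel_measurable (M n)" for n
    unfolding f_def[abs_def] by (rule measurable_normalised_stat_rgg[OF assms(1)])
  define p where "p n = (2 * r n) ^ CARD('m)" for n
  have rk: "regular_kernel F (torus_kernel (r n)) (p n)" for n
    unfolding H0 p_def by (rule regular_kernel_torus[OF rad])
  have r0: "r \<longlonglongrightarrow> 0" using smalloD_tendsto[OF assms(3)] by simp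
  have p0: "p \<longlonglongrightarrow> 0"
  proof -
    have "p \<longlonglongrightarrow> (2 * 0) ^ CARD('m)" unfolding p_def by (intro tendsto_intros r0)
    then show ?thesis by (simp add: zero_power)
  qed
  have np: "filterlim (\<lambda>n. real n * p n) at_top sequentially"
    unfolding filterlim_at_top
  proof
    \<comment> \<open>The growth condition is used with the constant \<bar>Z\<bar> + 1, which is
      positive and exceeds Z.\<close>
    fix Z :: real
    have "\<forall>\<^sub>F n in sequentially. norm (real n * r n ^ CARD('m)) \<ge> (\<bar>Z\<bar> + 1) * norm (1::real)"
      using landau_omega.smallD[OF assms(4), of "\<bar>Z\<bar> + 1"] by simp
    then show "\<forall>\<^sub>F n in sequentially. Z \<le> real n * p n"
    proof eventually_elim
      case (elim n)
      have "Z \<le> real n * r n ^ CARD('m)" using elim rad(1)[of n] by simp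
      also have "\<dots> \<le> real n * p n"
        unfolding p_def using rad(1)[of n] by (intro mult_left_mono power_mono) auto
      finally show ?case .
    qed
  qed
  have q6: "(1 / 2 ^ CARD('m)) ^ 5 * p n ^ 5 \<le> regular_kernel.q6 F (torus_kernel (r n))" for n
    unfolding p_def by (rule torus_kernel_q6[OF rad H0])
  have char: "char (distr (M n) borel (f n)) t = (\<integral>\<omega>. iexp (t * f n \<omega>) \<partial>M n)" for n t
    unfolding char_def by (rule integral_distr) measurable
  have "weak_conv_m (\<lambda>n. distr (M n) borel (f n)) std_normal_distribution"
  proof (rule levy_continuity)
    show "real_distribution (distr (M n) borel (f n))" for n
    proof -
      interpret random_geometric_graph "M n" F n "r n" "X n" by (rule assms(1))
      show ?thesis by (rule real_distribution_distr) measurable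
    qed
    show "real_distribution std_normal_distribution" by (rule real_dist_normal_dist)
    fix t
    have "(\<lambda>n. \<integral>x. iexp (t * normalised_stat n (regular_kernel.adj (torus_kernel (r n)) x)) \<partial>iid_sample.P F)
      \<longlonglongrightarrow> complex_of_real (exp (- (t^2) / 2))"
      by (rule regular_kernel_clt[OF rk p0 np _ q6]) simp
    moreover have "\<forall>\<^sub>F n in sequentially.
      (\<integral>x. iexp (t * normalised_stat n (regular_kernel.adj (torus_kernel (r n)) x)) \<partial>iid_sample.P F) = char (distr (M n) borel (f n)) t"
      \<comment> \<open>The transfer is available for a nonempty sample, so n = 0 is left out of the
        comparison.\<close>
      using eventually_gt_at_top[of 0]
    proof eventually_elim
      case (elim n)
      then show ?case unfolding char f_def by (intro char_normalised_stat_rgg[OF assms(1) _ H0, symmetric])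
    qed
    ultimately show "(\<lambda>n. char (distr (M n) borel (f n)) t) \<longlonglongrightarrow> char std_normal_distribution t"
      by (simp add: char_std_normal_distribution Lim_transform_eventually)
  qed
  then show ?thesis by (simp only: f_eq)
qed

end
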